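(* Let $q\in[1,\infty]$ and let $\|\cdot\|$ denote the $\ell_q$ norm on $\mathbb R^d$ and on $\mathbb R^{d+1}$. Let $\varphi:(\mathbb R^d\setminus\{0\})\times\mathbb R\to(\mathbb R^d\setminus\{0\})\times\mathbb R$ be the homeomorphism $\varphi(\mathbf x,z)=(\mathbf x,z/\|\mathbf x\|)$. 1. Let $(\mathbf X,Z)$ be regularly varying in $\mathbb R^{d+1}$, with limit distribution $\Pi_\infty=\lim_{t\to\infty}\mathcal L\big(t^{-1}(\mathbf X,Z)\mid\|(\mathbf X,Z)\|>t\big)$ such that $\Pi_\infty\{(\mathbf x,z):\|\mathbf x\|>1\}>0$, and let $Y=Z/\|\mathbf X\|$. Then the random pair $(\mathbf X,Y)$ satisfies condition (RV) of the context, with limit distribution $$P_\infty(\cdot)=\frac{\Pi_\infty\circ\varphi^{-1}(\cdot)}{\Pi_\infty\{(\mathbf x,z):\|\mathbf x\|>1\}} .$$ 2. Conversely, let $(\mathbf X,Y)$ be a random pair satisfying conditions (B) and (RV) of the context, with limit distribution $P_\infty$. Define $Z=\|\mathbf X\|Y$. Then the random pair $(\mathbf X,Z)$ is regularly varying in $\mathbb R^{d+1}$, with limit distribution $\Pi_\infty=P_\infty\circ\varphi$. 3. Let $(\mathbf X,Z)$ be a random pair having a continuous, regularly varying density $\pi$ on $\mathbb R^{d+1}\setminus\{0\}$, with limit density $\pi_\infty$, i.e. there exists a regularly varying function $b(t)$ with index $\alpha>0$ such that $$\sup_{\|(\mathbf x,z)\|>1}\big|t^{d+1}b(t)\,\pi(t\mathbf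 x,tz)-\pi_\infty(\mathbf x,z)\big|\xrightarrow[t\to\infty]{}0 .$$ Assume in addition that the rescaled variable $Y=Z/\|\mathbf X\|$ is bounded (condition (B)). Then the rescaled pair $(\mathbf X,Y)$ satisfies condition (RV), and it has a continuous, regularly varying density $p(\mathbf x,y)=\|\mathbf x\|\,\pi(\mathbf x,\|\mathbf x\|y)$, with limit density $p_\infty(\mathbf x,y)=\|\mathbf x\|\,\pi_\infty(\mathbf x,\|\mathbf x\|y)$ and the same scaling function $b$ as that of the pair $(\mathbf X,Z)$, namely $$\sup_{\|\mathbf x\|\ge1,\ y\in\mathbb R}\big|b(t)\,t^d\,p(t\mathbf x,y)-p_\infty(\mathbf x,y)\big|\xrightarrow[t\to\infty]{}0 .$$ Finally, under the additional condition that the limit marginal density $\pi_{\mathbf x,\infty}(\mathbf x)=\int_{\mathbb R}\pi_\infty(\mathbf x,y)\,\mathrm dy$ is lower bounded on the unit sphere $\mathbb S$ of $\mathbb R^d$, i.e. $\inf_{\omega\in\mathbb S}\pi_{\mathbf x,\infty}(\omega)>0$, the pair $(\mathbf X,Y)$ also satisfies condition (C) of the context.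
   Context: Here $\mathbf X$ takes values in $\mathbb R^d$ and $Y,Z$ in $\mathbb R$. $\mathcal L(\cdot\mid\mathcal E)$ denotes conditional distribution given the event $\mathcal E$; limits of distributions are in the sense of weak convergence. $\Pi_\infty\circ\varphi^{-1}$ is the image measure $A\mapsto\Pi_\infty(\varphi^{-1}(A))$, and $P_\infty\circ\varphi$ is $A\mapsto P_\infty(\varphi(A))$. A positive function $b$ is regularly varying with index $\alpha$ if $b(tx)/b(t)\to x^{\alpha}$ as $t\to\infty$ for all $x>0$. A random vector $\mathbf U$ in $\mathbb R^m$ is regularly varying (with index $\alpha>0$) if there are a positive function $b$, regularly varying with index $\alpha$, and a nonzero Borel measure $\nu$ on $\mathbb R^m\setminus\{0\}$, finite on sets bounded away from $0$, with $b(t)\mathbb P(\mathbf U\in tA)\to\nu(A)$ as $t\to\infty$ for all Borel $A$ with $0\notin\mathrm{cl}(A)$ and $\nu(\partial A)=0$. Its limit distribution is the weak limit of $\mathcal L(t^{-1}\mathbf U\mid\|\mathbf U\|>t)$ as $t\to\infty$. Likewise the limit density $\pi_\infty$ is a function on $\mathbb R^{d+1}\setminus\{0\}$ that is not identically zero. Condition (B) (bounded target) for a pair $(\mathbf X,Y)$: there is $M>0$ such that $Y\in[-M,M]$ with probability $1$. Condition (RV) (regular variation with respect to the covariate) for a pair $(\mathbf X,Y)$: there is $\alpha>0$ with $\mathbb P(\|\mathbf X\|>ts)/\mathbb P(\|\mathbf X\|>t)\to s^{-\alpha}$ as $t\to\infty$ for all $s>0$, and $\mathcal L\big((t^{-1}\mathbf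 X,Y)\mid\|\mathbf X\|>t\big)$ converges as $t\to\infty$ to some limit distribution $P_\infty$ on $\{(\mathbf x,y)\in\mathbb R^{d+1}:\|\mathbf x\|>1,\ y\in\mathbb R\}$. Condition (C): let $(\mathbf X_\infty,Y_\infty)\sim P_\infty$ and let $f_{P_\infty}(\mathbf X_\infty)=\mathbb E(Y_\infty\mid\mathbf X_\infty)$ a.s. be the regression function of the limit pair; under (RV) it depends only on the angle, $f_{P_\infty}(\mathbf x)=h_\infty(\mathbf x/\|\mathbf x\|)$ for a function $h_\infty$ on the unit sphere, and this formula defines it on $\mathbb R^d\setminus\{0\}$. Let $f^*(\mathbf X)=\mathbb E(Y\mid\mathbf X)$ a.s. Condition (C) requires that $f_{P_\infty}$ is continuous on $\mathbb R^d\setminus\{0\}$ and $\mathbb E\big(|f^*(\mathbf X)-f_{P_\infty}(\mathbf X)|\ \big|\ \|\mathbf X\|\ge t\big)\to0$ as $t\to\infty$.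
   Formalization: Part 2: Π∞ = P∞∘φ is proved after dividing Π∞ by Π∞{‖x‖>1}, on {‖x‖>1}, with the limit measure being its homogeneous extension (false unnormalized). Part 3: π∞ is also assumed to be the pointwise limit at every nonzero point, as the display leaves it arbitrary on the unit ball. *)

theory Defs
  imports "HOL-Probability.Probability"
begin

text \<open>
  The space of dimension $d+1$ is \<^typ>\<open>(real^'d) \<times> real\<close>. Its Euclidean basis consists of the
  coordinate directions, so the following norm is the usual coordinatewise one on both
  \<^typ>\<open>real^'d\<close> and \<^typ>\<open>(real^'d) \<times> real\<close>.
\<close>

definition lq_norm :: "ereal \<Rightarrow> 'a::euclidean_space \<Rightarrow> real" where
  "lq_norm q x =
     (if q = \<infinity> then Max ((\<lambda>i. \<bar>x \<bullet> i\<bar>) ` Basis)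
      else (\<Sum>i\<in>Basis. \<bar>x \<bullet> i\<bar> powr real_of_ereal q) powr (1 / real_of_ereal q))"

text \<open>The map is only meaningful for nonzero \<^term>\<open>x\<close>; the value at \<^term>\<open>x = 0\<close> is junk.\<close>

definition phi :: "ereal \<Rightarrow> (real^'d) \<times> real \<Rightarrow> (real^'d) \<times> real" where
  "phi q = (\<lambda>(x, z). (x, z / lq_norm q x))"

definition cond_law :: "'w measure \<Rightarrow> 'w set \<Rightarrow> ('w \<Rightarrow> 'a::topological_space) \<Rightarrow> 'a measure" where
  "cond_law M E V = distr (uniform_measure M E) borel V"

definition weak_limit ::
  "('i \<Rightarrow> 'a::topological_space measure) \<Rightarrow> 'a measure \<Rightarrow> 'i filter \<Rightarrow> bool" where
  "weak_limit \<mu> L F \<longleftrightarrow>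
     (\<forall>f::'a \<Rightarrow> real. continuous_on UNIV f \<longrightarrow> bounded (range f) \<longrightarrow>
        ((\<lambda>t. \<integral>u. f u \<partial>\<mu> t) \<longlongrightarrow> (\<integral>u. f u \<partial>L)) F)"

definition regularly_varying_fun :: "(real \<Rightarrow> real) \<Rightarrow> real \<Rightarrow> bool" where
  "regularly_varying_fun b \<alpha> \<longleftrightarrow>
     (\<forall>t>0. b t > 0) \<and> (\<forall>x>0. ((\<lambda>t. b (t * x) / b t) \<longlongrightarrow> x powr \<alpha>) at_top)"

definition regularly_varying_with ::
  "'w measure \<Rightarrow> ('w \<Rightarrow> 'a::euclidean_space) \<Rightarrow> real \<Rightarrow> (real \<Rightarrow> real) \<Rightarrow> 'a measure \<Rightarrow> bool" where
  "regularly_varying_with M U \<alpha> b \<nu> \<longleftrightarrow>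
     \<alpha> > 0 \<and> regularly_varying_fun b \<alpha> \<and>
     sets \<nu> = sets (restrict_space borel (- {0})) \<and>
     emeasure \<nu> (space \<nu>) \<noteq> 0 \<and>
     (\<forall>A\<in>sets \<nu>. 0 \<notin> closure A \<longrightarrow> emeasure \<nu> A < \<infinity>) \<and>
     (\<forall>A\<in>sets borel. 0 \<notin> closure A \<longrightarrow> emeasure \<nu> (frontier A) = 0 \<longrightarrow>
        ((\<lambda>t. b t * measure M {\<omega> \<in> space M. U \<omega> \<in> (\<lambda>u. t *\<^sub>R u) ` A}) \<longlongrightarrow> measure \<nu> A) at_top)"

definition regularly_varying_vec :: "'w measure \<Rightarrow> ('w \<Rightarrow> 'a::euclidean_space) \<Rightarrow> bool" where
  "regularly_varying_vec M U \<longleftrightarrow> (\<exists>\<alpha> b \<nu>. regularly_varying_with M U \<alpha> b \<nu>)"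

definition limit_distribution ::
  "ereal \<Rightarrow> 'w measure \<Rightarrow> ('w \<Rightarrow> 'a::euclidean_space) \<Rightarrow> 'a measure \<Rightarrow> bool" where
  "limit_distribution q M U L \<longleftrightarrow>
     prob_space L \<and> sets L = sets borel \<and>
     weak_limit (\<lambda>t. cond_law M {\<omega> \<in> space M. lq_norm q (U \<omega>) > t} (\<lambda>\<omega>. (1 / t) *\<^sub>R U \<omega>)) L at_top"

definition cond_B :: "'w measure \<Rightarrow> ('w \<Rightarrow> real) \<Rightarrow> bool" where
  "cond_B M Y \<longleftrightarrow> (\<exists>B>0. AE \<omega> in M. Y \<omega> \<in> {-B..B})"

text \<open>
  The limit distribution lives on the open set of pairs with $\|x\| > 1$. It is represented as a
  Borel probability measure on the whole space that is concentrated on this set. Since the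
  conditional laws are concentrated there as well, weak convergence in the subspace and in the
  whole space agree.
\<close>

definition cond_RV ::
  "ereal \<Rightarrow> 'w measure \<Rightarrow> ('w \<Rightarrow> real^'d) \<Rightarrow> ('w \<Rightarrow> real) \<Rightarrow> ((real^'d) \<times> real) measure \<Rightarrow> bool" where
  "cond_RV q M X Y P \<longleftrightarrow>
     (\<exists>\<alpha>>0. \<forall>s>0.
        ((\<lambda>t. measure M {\<omega> \<in> space M. lq_norm q (X \<omega>) > t * s} /
              measure M {\<omega> \<in> space M. lq_norm q (X \<omega>) > t}) \<longlongrightarrow> s powr (- \<alpha>)) at_top) \<and>
     prob_space P \<and> sets P = sets borel \<and> (AE u in P. lq_norm q (fst u) > 1) \<and>
     weak_limit (\<lambda>t. cond_law M {\<omega> \<in> space M. lq_norm q (X \<omega>) > t}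
                       (\<lambda>\<omega>. ((1 / t) *\<^sub>R X \<omega>, Y \<omega>))) P at_top"

definition regression_function ::
  "'w measure \<Rightarrow> ('w \<Rightarrow> real^'d) \<Rightarrow> ('w \<Rightarrow> real) \<Rightarrow> (real^'d \<Rightarrow> real) \<Rightarrow> bool" where
  "regression_function M X Y f \<longleftrightarrow>
     integrable M Y \<and> f \<in> borel_measurable borel \<and>
     (AE \<omega> in M. f (X \<omega>) = real_cond_exp M (vimage_algebra (space M) X borel) Y \<omega>)"

text \<open>
  Regression functions are determined only almost everywhere; the condition asks for a version
  \<open>f\<^sub>P\<close> of the limit regression function that has the angular form and is continuous away from
  the origin. The choice of the version \<open>f\<close> of the regression function of the given pair is
  immaterial. The conditional expectation is a nonnegative integral, so that it cannot vanish
  merely because of a failure of integrability.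
\<close>

definition cond_C ::
  "ereal \<Rightarrow> 'w measure \<Rightarrow> ('w \<Rightarrow> real^'d) \<Rightarrow> ('w \<Rightarrow> real) \<Rightarrow> ((real^'d) \<times> real) measure \<Rightarrow> bool" where
  "cond_C q M X Y P \<longleftrightarrow>
     (\<exists>h f\<^sub>P f.
        (\<forall>x. x \<noteq> 0 \<longrightarrow> f\<^sub>P x = h ((1 / lq_norm q x) *\<^sub>R x)) \<and>
        regression_function P fst snd f\<^sub>P \<and>
        continuous_on (- {0}) f\<^sub>P \<and>
        regression_function M X Y f \<and>
        ((\<lambda>t. \<integral>\<^sup>+\<omega>. ennreal \<bar>f (X \<omega>) - f\<^sub>P (X \<omega>)\<bar>
                 \<partial>uniform_measure M {\<omega> \<in> space M. lq_norm q (X \<omega>) \<ge> t}) \<longlongrightarrow> 0) at_top)"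

text \<open>
  Uniform convergence on $\|u\| > 1$ alone says nothing about the values of the limit density on
  the closed unit ball. The pointwise convergence at every nonzero \<^term>\<open>u\<close> makes the limit
  density the limit on its whole domain (equivalently: homogeneous of degree $-(m + \alpha)$,
  where $m$ is the dimension).
\<close>

definition regularly_varying_density ::
  "ereal \<Rightarrow> real \<Rightarrow> (real \<Rightarrow> real) \<Rightarrow> ('a::euclidean_space \<Rightarrow> real) \<Rightarrow> ('a \<Rightarrow> real) \<Rightarrow> bool" where
  "regularly_varying_density q \<alpha> b \<pi> pi_inf \<longleftrightarrow>
     \<alpha> > 0 \<and> regularly_varying_fun b \<alpha> \<and>
     (\<exists>u. u \<noteq> 0 \<and> pi_inf u \<noteq> 0) \<and>
     (\<forall>u. u \<noteq> 0 \<longrightarrow> ((\<lambda>t. t ^ DIM('a) * b t * \<pi> (t *\<^sub>R u)) \<longlongrightarrow> pi_inf u) at_top) \<and>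
     ((\<lambda>t. SUP u\<in>{u. lq_norm q u > 1}.
              ennreal \<bar>t ^ DIM('a) * b t * \<pi> (t *\<^sub>R u) - pi_inf u\<bar>) \<longlongrightarrow> 0) at_top"

end

theory Submission
  imports Defs
begin

text \<open>
  Everything rests on homogeneity. If \<open>b t * P(U \<in> t A) \<rightarrow> \<nu> A\<close> and \<open>r\<close> is continuous and homogeneous of
  degree one, then \<open>s \<mapsto> \<nu> {r > s}\<close> is a multiple of \<open>s powr (-\<alpha>)\<close>, so no level set \<open>{r = s}\<close> is charged
  and \<open>1\<^bsub>{r > s}\<^esub>\<close> is an admissible test function. Applied to \<open>r(x, z) = lq_norm q x\<close>, this lets one replace
  the conditioning event \<open>{lq_norm q (X, Z) > t}\<close> by the smaller event \<open>{lq_norm q X > t}\<close>, where the map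
  \<open>phi q\<close> is continuous. Conversely, a bounded \<open>Y\<close> confines \<open>(X, lq_norm q X * Y)\<close> to a cone
  \<open>{|z| \<le> C * lq_norm q x}\<close>, on which being bounded away from the origin means that \<open>lq_norm q x\<close> is bounded
  below; the limit measure is then the increasing union of rescaled copies of \<open>P\<close>.

  For densities, the uniform convergence gives the integrals over a shell, \<open>b (2 * t) / b t \<rightarrow> 2 powr \<alpha> > 1\<close> makes
  the dyadic shells summable, and hence the conditional laws converge. Rescaling the covariate to the
  unit sphere, numerator and denominator of the regression function converge uniformly and the
  denominator stays away from zero, so the regression function converges uniformly at infinity,
  which is more than convergence in conditional mean.
\<close>

text \<open>In the direct statement \<open>L\<close> is not identified through the measure
  \<open>\<nu>\<close> of the regular variation: \<open>\<nu>\<close> only supplies tail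
  asymptotics, and a level set is \<open>L\<close>-null because the conditional laws charge thin
  layers around it little. In the converse, the limit measure must be built from a law that sees
  only \<open>lq_norm q x > 1\<close>. Comparing the conditional laws at the thresholds
  \<open>t\<close> and \<open>t * c\<close> gives a scaling relation for \<open>P\<close>; it makes
  the rescaled copies consistent, so that they increase and have a supremum. The normalisation is
  the reciprocal of the covariate tail, which turns scaled integrals into tail ratios times
  integrals against conditional laws. For densities, an almost sure bound on the quotient has to
  become a pointwise one: a continuous density vanishes off the cone everywhere, not just almost
  everywhere. Hence all sections \<open>y \<mapsto> p (x, y)\<close> live in one interval, section
  integrals inherit uniform convergence, and the limit density cannot live on the axis
  \<open>x = 0\<close> alone.\<close>

lemma lq_norm_nonneg [simp]: "0 \<le> lq_norm q x"
proof (cases "q = \<infinity>")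
  case True
  obtain i :: 'a where "i \<in> Basis" using nonempty_Basis by blast
  then have "\<bar>x \<bullet> i\<bar> \<le> Max ((\<lambda>i. \<bar>x \<bullet> i\<bar>) ` Basis)" by (intro Max_ge) auto
  with True show ?thesis by (simp add: lq_norm_def)
qed (simp add: lq_norm_def)

lemma lq_norm_pos:
  assumes "x \<noteq> 0" and "1 \<le> q"
  shows "0 < lq_norm q x"
proof -
  obtain i where i: "i \<in> Basis" "x \<bullet> i \<noteq> 0" using assms by (auto simp: euclidean_eq_iff[of x 0])
  show ?thesis
  proof (cases "q = \<infinity>")
    case True
    have "\<bar>x \<bullet> i\<bar> \<le> Max ((\<lambda>i. \<bar>x \<bullet> i\<bar>) ` Basis)" using i by (intro Max_ge) auto
    moreover have "0 < \<bar>x \<bullet> i\<bar>" using i by simp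
    ultimately show ?thesis using True by (simp add: lq_norm_def del: Max_ge_iff)
  next
    case False
    have "0 < \<bar>x \<bullet> i\<bar> powr real_of_ereal q" using i by simp
    also have "\<dots> \<le> (\<Sum>i\<in>Basis. \<bar>x \<bullet> i\<bar> powr real_of_ereal q)"
      using i by (intro member_le_sum) auto
    finally show ?thesis using False by (simp add: lq_norm_def)
  qed
qed

lemma lq_norm_scaleR:
  fixes x :: "'a::euclidean_space"
  assumes "1 \<le> q"
  shows "lq_norm q (t *\<^sub>R x) = \<bar>t\<bar> * lq_norm q x"
proof (cases q)
  case (real p)
  with assms have p: "p \<ge> 1" by simp
  have "(\<Sum>i\<in>Basis. \<bar>(t *\<^sub>R x) \<bullet> i\<bar> powr p) = \<bar>t\<bar> powr p * (\<Sum>i\<in>Basis. \<bar>x \<bullet> i\<bar> powr p)"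
    by (simp add: abs_mult powr_mult sum_distrib_left)
  with p real show ?thesis
    by (simp add: lq_norm_def powr_mult powr_powr sum_nonneg)
next
  case PInf
  have "Max ((\<lambda>s. \<bar>t\<bar> * s) ` (\<lambda>i. \<bar>x \<bullet> i\<bar>) ` Basis) = \<bar>t\<bar> * Max ((\<lambda>i. \<bar>x \<bullet> i\<bar>) ` Basis)"
    by (intro mono_Max_commute[symmetric]) (auto simp: mono_def mult_left_mono)
  then show ?thesis using PInf by (simp add: lq_norm_def abs_mult image_image)
qed (use assms in auto)

lemma lq_norm_0: "1 \<le> q \<Longrightarrow> lq_norm q (0::'a::euclidean_space) = 0"
  using lq_norm_scaleR[of q 0 "0::'a"] by simp

lemma continuous_on_Max_image:
  fixes f :: "'i \<Rightarrow> 'a::topological_space \<Rightarrow> real"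
  assumes "finite I" "I \<noteq> {}" and "\<And>i. i \<in> I \<Longrightarrow> continuous_on S (f i)"
  shows "continuous_on S (\<lambda>x. Max ((\<lambda>i. f i x) ` I))"
  using assms
proof (induction rule: finite_ne_induct)
  case (insert i I)
  have "(\<lambda>x. Max ((\<lambda>i. f i x) ` insert i I)) = (\<lambda>x. max (f i x) (Max ((\<lambda>i. f i x) ` I)))"
    using insert by auto
  with insert show ?case by (auto intro!: continuous_on_max)
qed auto

lemma continuous_lq_norm: "1 \<le> q \<Longrightarrow> continuous_on UNIV (lq_norm q :: 'a::euclidean_space \<Rightarrow> real)"
proof (cases q)
  case (real p)
  moreover assume "1 \<le> q"
  ultimately have "(lq_norm q :: 'a \<Rightarrow> real) = (\<lambda>x. (\<Sum>i\<in>Basis. \<bar>x \<bullet> i\<bar> powr p) powr (1 / p))" "p \<ge> 1"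
    by (auto simp: lq_norm_def)
  then show ?thesis by (auto intro!: continuous_intros continuous_on_powr' sum_nonneg)
next
  case PInf
  then have "(lq_norm q :: 'a \<Rightarrow> real) = (\<lambda>x. Max ((\<lambda>i. \<bar>x \<bullet> i\<bar>) ` Basis))"
    by (auto simp: lq_norm_def)
  then show ?thesis by (auto intro!: continuous_on_Max_image continuous_intros)
qed auto

lemma continuous_lq_norm_fst:
  fixes q :: ereal
  assumes "1 \<le> q"
  shows "continuous_on UNIV (\<lambda>u :: 'a::euclidean_space \<times> 'b::euclidean_space. lq_norm q (fst u))"
  by (rule continuous_on_compose2[OF continuous_lq_norm[OF assms]]) (auto intro!: continuous_intros)

text \<open>The coordinates of \<open>x\<close> are among those of \<open>(x, z)\<close>. This makes
  \<open>lq_norm q X > t\<close> a sub-event of the conditioning event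
  \<open>lq_norm q (X, Z) > t\<close>.\<close>

lemma lq_norm_fst_le:
  fixes x :: "'a::euclidean_space" and z :: "'b::euclidean_space"
  assumes "1 \<le> q"
  shows "lq_norm q x \<le> lq_norm q (x, z)"
proof (cases q)
  case (real p)
  with assms have p: "p \<ge> 1" by simp
  have "(\<Sum>i\<in>Basis. \<bar>(x, z) \<bullet> i\<bar> powr p) = (\<Sum>i\<in>Basis. \<bar>x \<bullet> i\<bar> powr p) + (\<Sum>i\<in>Basis. \<bar>z \<bullet> i\<bar> powr p)"
    unfolding Basis_prod_def
    by (subst sum.union_disjoint) (auto simp: sum.reindex inj_on_def Basis_prod_def)
  with p real show ?thesis
    by (auto simp: lq_norm_def intro!: powr_mono2 sum_nonneg)
next
  case PInf
  have "(\<lambda>i. \<bar>x \<bullet> i\<bar>) ` Basis \<subseteq> (\<lambda>i. \<bar>(x, z) \<bullet> i\<bar>) ` Basis"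
    by (force simp: Basis_prod_def)
  then have "Max ((\<lambda>i. \<bar>x \<bullet> i\<bar>) ` Basis) \<le> Max ((\<lambda>i. \<bar>(x, z) \<bullet> i\<bar>) ` Basis)"
    by (intro Max_mono) auto
  then show ?thesis using PInf by (simp add: lq_norm_def)
qed (use assms in auto)

text \<open>Minimum of the norm on the compact Euclidean unit sphere. Converts bounds on
  \<open>lq_norm q\<close> into Euclidean ones, as needed for balls around the origin, for
  compactness and for finite Lebesgue measure.\<close>

lemma lq_norm_ge_norm:
  assumes "1 \<le> q"
  obtains k where "k > 0" "\<And>x::'a::euclidean_space. k * norm x \<le> lq_norm q x"
proof -
  have "\<exists>a\<in>sphere (0::'a) 1. \<forall>x\<in>sphere (0::'a) 1. lq_norm q a \<le> lq_norm q x"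
    using continuous_on_subset[OF continuous_lq_norm[OF assms]]
    by (intro continuous_attains_inf) auto
  then obtain a :: 'a where a: "norm a = 1" "\<And>x::'a. norm x = 1 \<Longrightarrow> lq_norm q a \<le> lq_norm q x" by auto
  show ?thesis
  proof
    show "0 < lq_norm q a" using a assms by (intro lq_norm_pos) auto
    fix x :: 'a
    show "lq_norm q a * norm x \<le> lq_norm q x"
    proof (cases "x = 0")
      case False
      with a(2)[of "(1 / norm x) *\<^sub>R x"] have "lq_norm q a \<le> 1 / norm x * lq_norm q x"
        using lq_norm_scaleR[OF assms, of "1 / norm x" x] by simp
      with False show ?thesis by (simp add: field_simps)
    qed simp
  qed
qed

lemma borel_measurable_lq_norm [measurable (raw)]:
  "1 \<le> q \<Longrightarrow> f \<in> borel_measurable N \<Longrightarrow> (\<lambda>w. lq_norm q (f w :: 'a::euclidean_space)) \<in> borel_measurable N"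
  using borel_measurable_continuous_onI[OF continuous_lq_norm] measurable_compose by blast

section \<open>Weak convergence\<close>

lemma weak_limitD:
  fixes f :: "'a::topological_space \<Rightarrow> real"
  assumes "weak_limit \<mu> L F" "continuous_on UNIV f" "\<And>u. \<bar>f u\<bar> \<le> C"
  shows "((\<lambda>t. \<integral>u. f u \<partial>\<mu> t) \<longlongrightarrow> (\<integral>u. f u \<partial>L)) F"
  using assms unfolding weak_limit_def by (auto simp: bounded_iff)

lemma integrable_bounded_borel:
  fixes f :: "'a::topological_space \<Rightarrow> real"
  assumes "finite_measure N" "sets N = sets borel" "f \<in> borel_measurable borel" "\<And>u. \<bar>f u\<bar> \<le> C"
  shows "integrable N f"
  by (rule finite_measure.integrable_const_bound[where B=C])
     (use assms in \<open>auto simp: cong: measurable_cong_sets\<close>)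

lemma eventually_one_le_mult:
  fixes d :: real
  assumes "d > 0"
  shows "\<forall>\<^sub>F n in sequentially. real n * d \<ge> 1"
  using eventually_ge_at_top[of "nat \<lceil>1 / d\<rceil>"]
proof eventually_elim
  case (elim n)
  then have "real n \<ge> 1 / d" by linarith
  with assms show ?case by (simp add: field_simps)
qed

text \<open>A portmanteau statement with a test function attached: \<open>indicator A\<close> is
  squeezed between the continuous functions \<open>i n\<close> and \<open>c n\<close>, whose
  difference \<open>k n\<close> tends to 0 off \<open>frontier A\<close>. The factor
  \<open>g\<close> allows conditioning on \<open>A\<close> and testing with \<open>g\<close> at the
  same time.\<close>

lemma weak_limit_continuity_set:
  fixes L :: "'a::metric_space measure" and g :: "'a \<Rightarrow> real"
  assumes wl: "weak_limit \<mu> L F"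
    and ev: "\<forall>\<^sub>F t in F. prob_space (\<mu> t) \<and> sets (\<mu> t) = sets borel"
    and L: "prob_space L" "sets L = sets borel"
    and A: "A \<in> sets borel" "measure L (frontier A) = 0"
    and g: "continuous_on UNIV g" "\<And>u. \<bar>g u\<bar> \<le> C"
  shows "((\<lambda>t. \<integral>u. indicator A u * g u \<partial>\<mu> t) \<longlongrightarrow> (\<integral>u. indicator A u * g u \<partial>L)) F"
proof (cases "A = {} \<or> A = UNIV")
  case True
  then show ?thesis using weak_limitD[OF wl g] by auto
next
  \<comment> \<open>\<open>infdist\<close> to the empty set is 0, so the approximations below need
    both \<open>A\<close> and its complement nonempty.\<close>
  case False
  then have ne: "A \<noteq> {}" "- A \<noteq> {}" by auto
  interpret L: prob_space L by fact
  have C: "C \<ge> 0" using g(2)[of undefined] by linarith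
  define i c :: "nat \<Rightarrow> 'a \<Rightarrow> real"
    where "i n u = min 1 (real n * infdist u (- A))" and "c n u = max 0 (1 - real n * infdist u A)" for n u
  have cont: "continuous_on UNIV (i n)" "continuous_on UNIV (c n)" for n
    unfolding i_def c_def by (auto intro!: continuous_intros)
  have bnd: "0 \<le> i n u \<and> i n u \<le> indicator A u \<and> indicator A u \<le> c n u \<and> c n u \<le> 1" for n u
    by (auto simp: i_def c_def infdist_nonneg indicator_def)
  define k where "k n u = c n u - i n u" for n u
  have k: "continuous_on UNIV (k n)" "\<bar>k n u\<bar> \<le> 1" "0 \<le> k n u" for n u
    unfolding k_def using cont bnd[of n u] by (auto intro!: continuous_intros simp: abs_le_iff split: split_indicator_asm)
  have gm: "g \<in> borel_measurable borel" and km: "k n \<in> borel_measurable borel"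
    and im: "i n \<in> borel_measurable borel" for n
    using g k cont by (auto intro: borel_measurable_continuous_onI)
  have k0: "(\<lambda>n. k n u) \<longlonglongrightarrow> 0" if "u \<notin> frontier A" for u
  proof (rule tendsto_eventually)
    from that consider "u \<in> interior A" | "u \<notin> closure A" by (auto simp: frontier_def)
    then show "\<forall>\<^sub>F n in sequentially. k n u = 0"
    proof cases
      case 1
      then have "u \<notin> closure (- A)" by (simp add: closure_complement)
      then have "infdist u (- A) > 0"
        using in_closure_iff_infdist_zero[OF ne(2)] infdist_nonneg[of u "-A"] by (metis less_eq_real_def)
      moreover have "infdist u A = 0" using 1 interior_subset[of A] by auto
      ultimately show ?thesis using eventually_one_le_mult[of "infdist u (-A)"] by (auto simp: k_def i_def c_def elim: eventually_mono)
    next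
      case 2
      then have "infdist u A > 0"
        using in_closure_iff_infdist_zero[OF ne(1)] infdist_nonneg[of u A] by (metis less_eq_real_def)
      moreover have "u \<in> - A" using 2 closure_subset[of A] by auto
      then have "infdist u (- A) = 0" by auto
      ultimately show ?thesis using eventually_one_le_mult[of "infdist u A"] by (auto simp: k_def i_def c_def elim: eventually_mono)
    qed
  qed
  have "emeasure L (frontier A) = 0" using A by (simp add: L.emeasure_eq_measure)
  then have "AE u in L. u \<notin> frontier A"
    by (intro AE_not_in) (auto simp: null_sets_def L)
  then have "(\<lambda>n. \<integral>u. k n u \<partial>L) \<longlonglongrightarrow> (\<integral>u. 0 \<partial>L)"
    using k k0 km by (intro integral_dominated_convergence[where w="\<lambda>_. 1"])
      (auto simp: L cong: measurable_cong_sets)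
  then have kL: "(\<lambda>n. \<integral>u. k n u \<partial>L) \<longlonglongrightarrow> 0" by simp
  \<comment> \<open>The error bound has the same form for every law and is itself the integral of a
    bounded continuous function, so it passes to the limit along \<open>\<mu>\<close>.\<close>
  have approx: "\<bar>(\<integral>u. indicator A u * g u \<partial>N) - (\<integral>u. i n u * g u \<partial>N)\<bar> \<le> C * (\<integral>u. k n u \<partial>N)"
    if "prob_space N" "sets N = sets borel" for N n
  proof -
    interpret N: prob_space N by fact
    have b: "\<bar>(indicator A u - i n u) * g u\<bar> \<le> C * k n u" for u
      unfolding abs_mult k_def
      using mult_mono[of "\<bar>indicator A u - i n u\<bar>" "c n u - i n u" "\<bar>g u\<bar>" C] bnd[of n u] g(2)[of u]
      by (simp add: mult.commute)
    have bi: "\<bar>i n u * g u\<bar> \<le> C" "\<bar>indicator A u * g u\<bar> \<le> C" for u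
      using mult_mono[of "\<bar>i n u\<bar>" 1 "\<bar>g u\<bar>" C] bnd[of n u] g(2)[of u] C
      by (auto simp: abs_mult split: split_indicator split_indicator_asm)
    have I: "integrable N (\<lambda>u. i n u * g u)" "integrable N (\<lambda>u. indicator A u * g u)" "integrable N (k n)"
      using bi k(2) A(1) gm km im that N.finite_measure_axioms
      by (auto intro!: integrable_bounded_borel)
    have "\<bar>(\<integral>u. indicator A u * g u \<partial>N) - (\<integral>u. i n u * g u \<partial>N)\<bar> = \<bar>\<integral>u. (indicator A u - i n u) * g u \<partial>N\<bar>"
      by (subst Bochner_Integration.integral_diff[OF I(2,1), symmetric]) (simp add: left_diff_distrib)
    also have "\<dots> \<le> (\<integral>u. \<bar>(indicator A u - i n u) * g u\<bar> \<partial>N)" by (rule integral_abs_bound)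
    also have "\<dots> \<le> (\<integral>u. C * k n u \<partial>N)"
      using I b by (intro integral_mono) (auto simp: left_diff_distrib)
    finally show ?thesis by simp
  qed
  show ?thesis
  proof (rule tendstoI)
    fix e :: real assume e: "e > 0"
    \<comment> \<open>Two approximation errors of at most \<open>C * e'\<close>, under
      \<open>\<mu> t\<close> and under \<open>L\<close>, and one convergence error below
      \<open>e'\<close> add up to less than \<open>e\<close>.\<close>
    define e' where "e' = e / (2 * C + 1)"
    have e': "e' > 0" using e C by (simp add: e'_def)
    have "(2 * C + 1) * e' = e" using C by (simp add: e'_def)
    then have ee: "C * e' + (C * e' + e') = e" by (simp add: algebra_simps)
    obtain n where n: "(\<integral>u. k n u \<partial>L) < e'"
      using order_tendstoD(2)[OF kL e'] by (auto simp: eventually_sequentially)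
    have "((\<lambda>t. \<integral>u. k n u \<partial>\<mu> t) \<longlongrightarrow> (\<integral>u. k n u \<partial>L)) F"
      by (rule weak_limitD[OF wl]) (use k in auto)
    note 1 = order_tendstoD(2)[OF this n]
    have "((\<lambda>t. \<integral>u. i n u * g u \<partial>\<mu> t) \<longlongrightarrow> (\<integral>u. i n u * g u \<partial>L)) F"
    proof (rule weak_limitD[OF wl])
      show "\<bar>i n u * g u\<bar> \<le> 1 * C" for u unfolding abs_mult
        using bnd[of n u] g(2)[of u] C by (intro mult_mono) (auto split: split_indicator_asm)
    qed (use cont g in \<open>auto intro!: continuous_intros\<close>)
    note 2 = tendstoD[OF this e']
    from 1 2 ev show "\<forall>\<^sub>F t in F. dist (\<integral>u. indicator A u * g u \<partial>\<mu> t) (\<integral>u. indicator A u * g u \<partial>L) < e"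
    proof eventually_elim
      case (elim t)
      have "C * (\<integral>u. k n u \<partial>\<mu> t) \<le> C * e'" "C * (\<integral>u. k n u \<partial>L) \<le> C * e'"
        using elim n C by (auto intro!: mult_left_mono)
      with approx[of "\<mu> t" n] approx[of L n] elim L ee show ?case
        unfolding dist_real_def by linarith
    qed
  qed
qed

text \<open>A tent function with peak 1 at the level \<open>c\<close> and half-width
  \<open>d\<close> dominates the level set and is dominated by the layer, so the bound on layers
  passes to \<open>L\<close>. The layer is half open because layers arise as differences of
  tails.\<close>

lemma weak_limit_level_null:
  fixes L :: "'a::metric_space measure" and r :: "'a \<Rightarrow> real"
  assumes wl: "weak_limit \<mu> L F" and F: "F \<noteq> bot"
    and ev: "\<forall>\<^sub>F t in F. prob_space (\<mu> t) \<and> sets (\<mu> t) = sets borel"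
    and L: "prob_space L" "sets L = sets borel"
    and r: "continuous_on UNIV r"
    and small: "\<And>e. e > 0 \<Longrightarrow> \<exists>d>0. \<forall>\<^sub>F t in F. measure (\<mu> t) {u. c - d < r u \<and> r u \<le> c + d} \<le> e"
  shows "measure L {u. r u = c} = 0"
proof (rule antisym[OF field_le_epsilon measure_nonneg])
  fix e :: real assume "e > 0"
  then obtain d where d: "d > 0" and de: "\<forall>\<^sub>F t in F. measure (\<mu> t) {u. c - d < r u \<and> r u \<le> c + d} \<le> e"
    using small by blast
  interpret L: prob_space L by fact
  have [measurable]: "r \<in> borel_measurable borel" using r by (rule borel_measurable_continuous_onI)
  define f where "f u = max 0 (1 - \<bar>r u - c\<bar> / d)" for u
  have f: "continuous_on UNIV f" "\<bar>f u\<bar> \<le> 1" "0 \<le> f u"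
    "f u \<le> indicator {u. c - d < r u \<and> r u \<le> c + d} u" "indicator {u. r u = c} u \<le> f u" for u
    using r d unfolding f_def by (auto intro!: continuous_intros simp: indicator_def field_simps)
  have fm: "f \<in> borel_measurable borel" using f by (intro borel_measurable_continuous_onI)
  have "measure L {u. r u = c} = (\<integral>u. indicator {u. r u = c} u \<partial>L)"
    using L by (simp add: sets_eq_imp_space_eq[OF L(2)])
  also have "\<dots> \<le> (\<integral>u. f u \<partial>L)"
    using f L fm by (intro integral_mono integrable_bounded_borel[OF _ L(2), of _ 1]) (auto simp: indicator_def)
  also have "\<dots> \<le> e"
  proof (rule tendsto_upperbound[OF weak_limitD[OF wl f(1,2)] _ F])
    show "\<forall>\<^sub>F t in F. (\<integral>u. f u \<partial>\<mu> t) \<le> e" using de ev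
    proof eventually_elim
      case (elim t)
      then interpret m: prob_space "\<mu> t" by simp
      have "(\<integral>u. f u \<partial>\<mu> t) \<le> (\<integral>u. indicator {u. c - d < r u \<and> r u \<le> c + d} u \<partial>\<mu> t)"
        using f fm elim m.finite_measure_axioms
        by (intro integral_mono integrable_bounded_borel[of _ _ 1]) (auto simp: indicator_def)
      also have "\<dots> = measure (\<mu> t) {u. c - d < r u \<and> r u \<le> c + d}"
        using elim by (simp add: sets_eq_imp_space_eq[of "\<mu> t" borel])
      finally show ?case using elim by simp
    qed
  qed
  finally show "measure L {u. r u = c} \<le> 0 + e" by simp
qed

lemma integral_cond_law:
  fixes f :: "'a::topological_space \<Rightarrow> real"
  assumes M: "prob_space M" and [measurable]: "E \<in> sets M" "V \<in> borel_measurable M" "f \<in> borel_measurable borel"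
    and pos: "measure M E \<noteq> 0"
  shows "(\<integral>u. f u \<partial>cond_law M E V) = (\<integral>w. indicator E w * f (V w) \<partial>M) / measure M E"
proof -
  interpret prob_space M by fact
  have "measure M E > 0" using pos by (simp add: zero_less_measure_iff)
  then have eq: "uniform_measure M E = density M (\<lambda>w. ennreal (indicator E w / measure M E))"
    unfolding uniform_measure_def
    by (auto intro!: density_cong simp: emeasure_eq_measure divide_ennreal[symmetric] ennreal_indicator)
  have "(\<integral>u. f u \<partial>cond_law M E V) = (\<integral>w. f (V w) \<partial>uniform_measure M E)"
    unfolding cond_law_def by (rule integral_distr) auto
  also have "\<dots> = (\<integral>w. (indicator E w / measure M E) * f (V w) \<partial>M)"
    unfolding eq by (subst integral_density) auto
  finally show ?thesis by simp
qed

lemma cond_law_prob_space: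
  assumes M: "prob_space M" and "E \<in> sets M" "V \<in> borel_measurable M" and pos: "measure M E \<noteq> 0"
  shows "prob_space (cond_law M E V)" "sets (cond_law M E V) = sets borel"
proof -
  interpret prob_space M by fact
  have "prob_space (uniform_measure M E)"
    using pos by (intro prob_space_uniform_measure) (auto simp: emeasure_eq_measure)
  then show "prob_space (cond_law M E V)" unfolding cond_law_def
    using assms by (intro prob_space.prob_space_distr) auto
qed (simp add: cond_law_def)

lemma measure_cond_law:
  assumes M: "prob_space M" and [measurable]: "E \<in> sets M" "V \<in> borel_measurable M" "A \<in> sets borel"
    and pos: "measure M E \<noteq> 0"
  shows "measure (cond_law M E V) A = measure M {w \<in> space M. w \<in> E \<and> V w \<in> A} / measure M E"
proof -
  interpret prob_space M by fact
  have "measure (cond_law M E V) A = measure (uniform_measure M E) (V -` A \<inter> space M)"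
    unfolding cond_law_def by (subst measure_distr) auto
  also have "\<dots> = measure M (E \<inter> (V -` A \<inter> space M)) / measure M E"
    using pos by (subst measure_uniform_measure) (auto simp: emeasure_eq_measure)
  also have "E \<inter> (V -` A \<inter> space M) = {w \<in> space M. w \<in> E \<and> V w \<in> A}"
    using sets.sets_into_space[of E M] by auto
  finally show ?thesis .
qed

text \<open>The conditional expectation is a quotient in which \<open>a t\<close> cancels. Any
  normalisation that gives the mass of the conditioning event a positive limit will do: the scaling
  function \<open>b\<close>, or the reciprocal probability of a larger event.\<close>

lemma weak_limit_cond_lawI:
  fixes V :: "'i \<Rightarrow> 'w \<Rightarrow> 'a::topological_space"
  assumes M: "prob_space M" and E: "\<And>t. E t \<in> sets M" and V: "\<And>t. V t \<in> borel_measurable M"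
    and c: "c > 0" and a: "\<forall>\<^sub>F t in F. a t > 0"
    and mass: "((\<lambda>t. a t * measure M (E t)) \<longlongrightarrow> c) F"
    and lim: "\<And>g K. continuous_on UNIV g \<Longrightarrow> (\<And>u. \<bar>g u\<bar> \<le> K) \<Longrightarrow>
      ((\<lambda>t. a t * (\<integral>w. indicator (E t) w * g (V t w) \<partial>M)) \<longlongrightarrow> c * (\<integral>u. g u \<partial>L)) F"
  shows "weak_limit (\<lambda>t. cond_law M (E t) (V t)) L F"
  unfolding weak_limit_def
proof (intro allI impI)
  fix g :: "'a \<Rightarrow> real" assume g: "continuous_on UNIV g" "bounded (range g)"
  then obtain K where K: "\<And>u. \<bar>g u\<bar> \<le> K" by (auto simp: bounded_iff)
  have gm: "g \<in> borel_measurable borel" using g(1) by (rule borel_measurable_continuous_onI)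
  have "((\<lambda>t. a t * (\<integral>w. indicator (E t) w * g (V t w) \<partial>M) / (a t * measure M (E t)))
      \<longlongrightarrow> c * (\<integral>u. g u \<partial>L) / c) F"
    using c by (intro tendsto_divide lim[OF g(1) K] mass) auto
  moreover have "\<forall>\<^sub>F t in F. a t * (\<integral>w. indicator (E t) w * g (V t w) \<partial>M) / (a t * measure M (E t))
      = (\<integral>u. g u \<partial>cond_law M (E t) (V t))"
    using a order_tendstoD(1)[OF mass c]
    by eventually_elim (subst integral_cond_law[OF M E V gm], auto)
  ultimately show "((\<lambda>t. \<integral>u. g u \<partial>cond_law M (E t) (V t)) \<longlongrightarrow> (\<integral>u. g u \<partial>L)) F"
    using c by (simp add: Lim_transform_eventually)
qed

section \<open>Homogeneity of the limit measure\<close>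

lemma homogeneous_zero:
  fixes r :: "'a::real_vector \<Rightarrow> real"
  assumes "\<And>s u. s > 0 \<Longrightarrow> r (s *\<^sub>R u) = s * r u"
  shows "r 0 = 0"
  using assms[of 2 0] by simp

lemma mem_scaleR_image:
  fixes A :: "'a::real_vector set"
  shows "t > 0 \<Longrightarrow> u \<in> (\<lambda>u. t *\<^sub>R u) ` A \<longleftrightarrow> (1 / t) *\<^sub>R u \<in> A"
  by (force simp: image_iff)

lemma not_in_closure_superlevel:
  fixes r :: "'a::topological_space \<Rightarrow> real"
  assumes "continuous_on UNIV r" "r x < s"
  shows "x \<notin> closure {u. r u > s}"
proof -
  have "closure {u. r u > s} \<subseteq> {u. s \<le> r u}"
    using assms(1) by (intro closure_minimal closed_Collect_le) auto
  with assms(2) show ?thesis by auto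
qed

lemma frontier_superlevel:
  fixes r :: "'a::topological_space \<Rightarrow> real"
  assumes "continuous_on UNIV r"
  shows "frontier {u. r u > s} \<subseteq> {u. r u = s}"
proof -
  have "closure {u. r u > s} \<subseteq> {u. s \<le> r u}"
    using assms by (intro closure_minimal closed_Collect_le) auto
  moreover have "interior {u. r u > s} = {u. r u > s}"
    using assms by (intro interior_open open_Collect_less) auto
  ultimately show ?thesis by (auto simp: frontier_def)
qed

text \<open>Continuity of \<open>powr\<close> at \<open>c\<close>. Up to a constant the gap is the
  limiting mass of a layer around the level \<open>c\<close>; \<open>d < c\<close> keeps its lower
  level positive.\<close>

lemma powr_gap_small:
  fixes c e K a :: real
  assumes "c > 0" "e > 0"
  shows "\<exists>d>0. d < c \<and> K * ((c - d) powr a - (c + d) powr a) < e"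
proof -
  have "((\<lambda>d. K * ((c - d) powr a - (c + d) powr a)) \<longlongrightarrow> K * ((c - 0) powr a - (c + 0) powr a)) (at_right 0)"
    using assms by (intro tendsto_intros) auto
  then have "\<forall>\<^sub>F d in at_right 0. K * ((c - d) powr a - (c + d) powr a) < e"
    using assms by (intro order_tendstoD(2)) auto
  with eventually_at_right_real[OF assms(1)]
  have "\<forall>\<^sub>F d in at_right 0. d > 0 \<and> d < c \<and> K * ((c - d) powr a - (c + d) powr a) < e"
    by eventually_elim simp
  then show ?thesis using eventually_happens'[OF trivial_limit_at_right_real] by blast
qed

text \<open>
  The convergence hypothesis applies only to \<open>\<nu>\<close>-continuity sets. All but countably many levels are such,
  regular variation of \<open>b\<close> relates any two of them, and monotonicity then excludes the exceptional ones.
\<close>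

lemma regularly_varying_with_tail:
  fixes U :: "'w \<Rightarrow> 'a::euclidean_space" and r :: "'a \<Rightarrow> real"
  assumes rv: "regularly_varying_with M U \<alpha> b \<nu>"
    and r: "continuous_on UNIV r" "\<And>s u. s > 0 \<Longrightarrow> r (s *\<^sub>R u) = s * r u"
    and s: "s > 0"
  shows regularly_varying_with_level_null: "emeasure \<nu> {u. r u = s} = 0"
    and regularly_varying_with_superlevel: "measure \<nu> {u. r u > s} = s powr (-\<alpha>) * measure \<nu> {u. r u > 1}"
    and regularly_varying_with_tendsto:
      "((\<lambda>t. b t * measure M {w \<in> space M. r (U w) > t * s}) \<longlongrightarrow> s powr (-\<alpha>) * measure \<nu> {u. r u > 1}) at_top"
proof -
  note rv' = rv[unfolded regularly_varying_with_def]
  from rv' have a: "\<alpha> > 0" and bpos: "\<And>t. t > 0 \<Longrightarrow> b t > 0"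
    and brv: "\<And>x. x > 0 \<Longrightarrow> ((\<lambda>t. b (t * x) / b t) \<longlongrightarrow> x powr \<alpha>) at_top"
    and sets: "sets \<nu> = sets (restrict_space borel (- {0}))"
    and fin: "\<And>A. A \<in> sets \<nu> \<Longrightarrow> 0 \<notin> closure A \<Longrightarrow> emeasure \<nu> A < \<infinity>"
    and conv: "\<And>A. A \<in> sets borel \<Longrightarrow> 0 \<notin> closure A \<Longrightarrow> emeasure \<nu> (frontier A) = 0 \<Longrightarrow>
      ((\<lambda>t. b t * measure M {w \<in> space M. U w \<in> (\<lambda>u. t *\<^sub>R u) ` A}) \<longlongrightarrow> measure \<nu> A) at_top"
    by (auto simp: regularly_varying_fun_def)
  have r0: "r 0 = 0" using r(2) by (rule homogeneous_zero)
  have rm [measurable]: "r \<in> borel_measurable borel" using r by (intro borel_measurable_continuous_onI)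
  have setsI: "A \<in> sets \<nu>" if "A \<in> sets borel" "0 \<notin> A" for A
    using that by (auto simp: sets sets_restrict_space_iff)
  have space: "space \<nu> = - {0}" using sets_eq_imp_space_eq[OF sets] by simp
  have Gs: "{u. r u > s} \<in> sets \<nu>" "0 \<notin> closure {u. r u > s}" "emeasure \<nu> {u. r u > s} < \<infinity>" if "s > 0" for s
    using that setsI[of "{u. r u > s}"] r0 not_in_closure_superlevel[OF r(1), of 0 s] fin[of "{u. r u > s}"] by auto
  have Es: "{u. r u = s} \<in> sets \<nu>" if "s > 0" for s
    using that setsI[of "{u. r u = s}"] r0 by auto
  have level: "measure \<nu> {u. r u > s1} - measure \<nu> {u. r u > s2} \<ge> measure \<nu> {u. r u = s}"
    if "0 < s1" "s1 < s" "s < s2" for s1 s s2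
  proof -
    have "{u. r u > s1} \<in> fmeasurable \<nu>" using that Gs[of s1] by (intro fmeasurableI) auto
    then have "{u. r u > s1} - {u. r u > s2} \<in> fmeasurable \<nu>" using that Gs[of s2] by (intro fmeasurable_Diff) auto
    then have "measure \<nu> {u. r u = s} \<le> measure \<nu> ({u. r u > s1} - {u. r u > s2})"
      using that Es[of s] by (intro measure_mono_fmeasurable) auto
    also have "\<dots> = measure \<nu> {u. r u > s1} - measure \<nu> {u. r u > s2}"
      using that Gs[of s1] Gs[of s2] by (intro measure_Diff) auto
    finally show ?thesis .
  qed
  define good where "good s \<longleftrightarrow> s > 0 \<and> emeasure \<nu> {u. r u = s} = 0" for s
  have goodD: "((\<lambda>t. b t * measure M {w \<in> space M. r (U w) > t * s}) \<longlongrightarrow> measure \<nu> {u. r u > s}) at_top"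
    if "good s" for s
  proof -
    have s: "s > 0" using that by (simp add: good_def)
    have "emeasure \<nu> (frontier {u. r u > s}) \<le> emeasure \<nu> {u. r u = s}"
      using frontier_superlevel[OF r(1), of s] Es[OF s] by (intro emeasure_mono) auto
    then have "emeasure \<nu> (frontier {u. r u > s}) = 0" using that by (simp add: good_def)
    then have "((\<lambda>t. b t * measure M {w \<in> space M. U w \<in> (\<lambda>u. t *\<^sub>R u) ` {u. r u > s}}) \<longlongrightarrow> measure \<nu> {u. r u > s}) at_top"
      using Gs[OF s] by (intro conv) auto
    moreover have "\<forall>\<^sub>F t in at_top. b t * measure M {w \<in> space M. U w \<in> (\<lambda>u. t *\<^sub>R u) ` {u. r u > s}}
        = b t * measure M {w \<in> space M. r (U w) > t * s}"
      using eventually_gt_at_top[of 0]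
    proof eventually_elim
      case (elim t)
      have "{w \<in> space M. U w \<in> (\<lambda>u. t *\<^sub>R u) ` {u. r u > s}} = {w \<in> space M. r (U w) > t * s}"
        using elim by (auto simp: mem_scaleR_image r(2) pos_less_divide_eq mult.commute)
      then show ?case by simp
    qed
    ultimately show ?thesis by (rule Lim_transform_eventually)
  qed
  \<comment> \<open>Put \<open>t * x\<close> for \<open>t\<close> in the convergence at the good
    level \<open>s\<close> and correct the normalisation by \<open>b (t * x) / b t\<close>. This
    reaches the level \<open>x * s\<close> before it is known to be good.\<close>
  have scale: "((\<lambda>t. b t * measure M {w \<in> space M. r (U w) > t * (x * s)}) \<longlongrightarrow> x powr (-\<alpha>) * measure \<nu> {u. r u > s}) at_top"
    if "good s" "x > 0" for s x
  proof -
    have lim: "filterlim (\<lambda>t. t * x) at_top at_top" using that by real_asymp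
    have "((\<lambda>t. inverse (b (t * x) / b t) * (b (t * x) * measure M {w \<in> space M. r (U w) > (t * x) * s}))
        \<longlongrightarrow> inverse (x powr \<alpha>) * measure \<nu> {u. r u > s}) at_top"
      using that by (intro tendsto_intros brv filterlim_compose[OF goodD[OF that(1)] lim]) auto
    moreover have "\<forall>\<^sub>F t in at_top. inverse (b (t * x) / b t) * (b (t * x) * measure M {w \<in> space M. r (U w) > (t * x) * s})
       = b t * measure M {w \<in> space M. r (U w) > t * (x * s)}"
      using eventually_gt_at_top[of 0]
    proof eventually_elim
      case (elim t)
      then have "b (t * x) > 0" "b t > 0" using that by (auto intro: bpos)
      then show ?case by (simp add: field_simps)
    qed
    ultimately show ?thesis by (simp add: powr_minus Lim_transform_eventually)
  qed
  have dense: "\<exists>s. a < s \<and> s < c \<and> good s" if "0 < a" "a < c" for a c :: real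
  proof -
    \<comment> \<open>\<open>\<nu>\<close> is finite above the level \<open>a\<close>, so its image
      under \<open>r\<close> has at most countably many atoms, and any level above \<open>a\<close>
      that is not an atom is good.\<close>
    define N where "N = distr (restrict_space \<nu> {u. r u > a}) borel r"
    have rmN: "r \<in> measurable (restrict_space \<nu> {u. r u > a}) borel"
      by (intro measurable_restrict_space1) (auto simp: measurable_cong_sets[OF sets refl] intro: measurable_restrict_space1)
    have sp: "space (restrict_space \<nu> {u. r u > a}) = {u. r u > a}"
      using r0 that by (auto simp: space_restrict_space space)
    have em: "emeasure N B = emeasure \<nu> (r -` B \<inter> {u. r u > a})" if "B \<in> sets borel" for B
      unfolding N_def using Gs[OF \<open>0 < a\<close>] rmN that sp
      by (subst emeasure_distr) (auto simp: space intro!: emeasure_restrict_space)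
    interpret N: finite_borel_measure N
    proof (rule finite_borel_measure.intro)
      show "finite_measure N" using Gs(3)[OF that(1)] em[of UNIV]
        by (intro finite_measureI) (auto simp: N_def)
      show "finite_borel_measure_axioms N" by standard (simp add: N_def)
    qed
    have "uncountable ({a<..<c} - {x. measure N {x} > 0})"
      using that N.countable_atoms by (intro uncountable_minus_countable) (auto simp: uncountable_open_interval)
    then obtain s where s: "a < s" "s < c" "\<not> measure N {s} > 0" by (metis (no_types, lifting) DiffE countable_empty equals0I greaterThanLessThan_iff mem_Collect_eq)
    then have "emeasure N {s} = 0" using measure_nonneg[of N "{s}"] by (simp add: N.emeasure_eq_measure)
    moreover have "r -` {s} \<inter> {u. r u > a} = {u. r u = s}" using s by auto
    ultimately show ?thesis using em[of "{s}"] s that by (auto simp: good_def)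
  qed
  obtain s0 where s0: "good s0" using dense[of 1 2] by auto
  then have s0p: "s0 > 0" by (simp add: good_def)
  \<comment> \<open>At a good level the limit of the scaled tails is known twice: as
    \<open>measure \<nu>\<close> of the superlevel set and, by scaling from \<open>s0\<close>, as a
    power. Hence the power law with constant \<open>K\<close> at all good levels.\<close>
  define K where "K = s0 powr \<alpha> * measure \<nu> {u. r u > s0}"
  have GK: "measure \<nu> {u. r u > s} = K * s powr (-\<alpha>)" if "good s" for s
  proof -
    have s: "s > 0" using that by (simp add: good_def)
    have "measure \<nu> {u. r u > s} = (s / s0) powr (-\<alpha>) * measure \<nu> {u. r u > s0}"
      using scale[OF s0, of "s / s0"] s s0p goodD[OF that] by (auto dest: tendsto_unique[rotated])
    then show ?thesis using s s0p by (simp add: K_def powr_divide powr_minus field_simps)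
  qed
  have allgood: "good s" if s: "s > 0" for s
  proof -
    \<comment> \<open>The level set lies between good levels \<open>s1 < s < s2\<close>, and the
      power law makes the mass between them small.\<close>
    have "measure \<nu> {u. r u = s} \<le> 0 + e" if e: "e > 0" for e
    proof -
      obtain d where d: "0 < d" "d < s" "K * ((s - d) powr (-\<alpha>) - (s + d) powr (-\<alpha>)) < e"
        using powr_gap_small[OF s e] by blast
      obtain s1 where s1: "s - d < s1" "s1 < s" "good s1" using dense[of "s - d" s] d by auto
      obtain s2 where s2: "s < s2" "s2 < s + d" "good s2" using dense[of s "s + d"] s d by auto
      have "s1 powr (-\<alpha>) \<le> (s - d) powr (-\<alpha>)" "(s + d) powr (-\<alpha>) \<le> s2 powr (-\<alpha>)"
        using s1 s2 s d a by (auto intro!: powr_mono2')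
      then have "K * (s1 powr (-\<alpha>) - s2 powr (-\<alpha>)) \<le> K * ((s - d) powr (-\<alpha>) - (s + d) powr (-\<alpha>))"
        by (intro mult_left_mono) (auto simp: K_def)
      moreover have "0 < s1" using s1 d by linarith
      ultimately show ?thesis
        using level[OF \<open>0 < s1\<close> s1(2) s2(1)] GK[OF s1(3)] GK[OF s2(3)] d(3) by (simp add: right_diff_distrib)
    qed
    then have "measure \<nu> {u. r u = s} \<le> 0" by (rule field_le_epsilon)
    then have "measure \<nu> {u. r u = s} = 0" using measure_nonneg[of \<nu> "{u. r u = s}"] by linarith
    \<comment> \<open>\<open>measure\<close> is 0 also on sets of infinite mass, so finiteness has
      to be checked before passing to \<open>emeasure\<close>.\<close>
    moreover have "emeasure \<nu> {u. r u = s} \<le> emeasure \<nu> {u. r u > s / 2}"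
      using s Gs[of "s / 2"] by (intro emeasure_mono) auto
    then have "emeasure \<nu> {u. r u = s} \<noteq> \<infinity>" using Gs(3)[of "s / 2"] s by (auto simp: top_unique)
    ultimately show ?thesis using s by (auto simp: good_def emeasure_eq_ennreal_measure)
  qed
  show "emeasure \<nu> {u. r u = s} = 0" using allgood[OF s] by (simp add: good_def)
  have *: "measure \<nu> {u. r u > s} = s powr (-\<alpha>) * measure \<nu> {u. r u > 1}"
    using GK[OF allgood[OF s]] GK[OF allgood[of 1]] by simp
  show "measure \<nu> {u. r u > s} = s powr (-\<alpha>) * measure \<nu> {u. r u > 1}" by fact
  show "((\<lambda>t. b t * measure M {w \<in> space M. r (U w) > t * s}) \<longlongrightarrow> s powr (-\<alpha>) * measure \<nu> {u. r u > 1}) at_top"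
    using goodD[OF allgood[OF s]] * by simp
qed

text \<open>If \<open>{u. r u > 1}\<close> were null, homogeneity would make every
  \<open>{u. r u > 1 / real (Suc n)}\<close> null; these sets exhaust the space because
  \<open>r\<close> is positive off the origin, which contradicts that \<open>\<nu>\<close> is
  nonzero.\<close>

lemma regularly_varying_with_pos:
  fixes U :: "'w \<Rightarrow> 'a::euclidean_space" and r :: "'a \<Rightarrow> real"
  assumes rv: "regularly_varying_with M U \<alpha> b \<nu>"
    and r: "continuous_on UNIV r" "\<And>s u. s > 0 \<Longrightarrow> r (s *\<^sub>R u) = s * r u" and pos: "\<And>u. u \<noteq> 0 \<Longrightarrow> r u > 0"
  shows "measure \<nu> {u. r u > 1} > 0"
proof (rule ccontr)
  assume "\<not> measure \<nu> {u. r u > 1} > 0"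
  then have 0: "measure \<nu> {u. r u > 1} = 0" using measure_nonneg[of \<nu> "{u. r u > 1}"] by linarith
  note rv' = rv[unfolded regularly_varying_with_def]
  from rv' have sets: "sets \<nu> = sets (restrict_space borel (- {0}))"
    and fin: "\<And>A. A \<in> sets \<nu> \<Longrightarrow> 0 \<notin> closure A \<Longrightarrow> emeasure \<nu> A < \<infinity>"
    and nz: "emeasure \<nu> (space \<nu>) \<noteq> 0" by auto
  have r0: "r 0 = 0" using r(2) by (rule homogeneous_zero)
  have rm [measurable]: "r \<in> borel_measurable borel" using r by (intro borel_measurable_continuous_onI)
  have mem: "{u. r u > s} \<in> sets \<nu>" if "s > 0" for s
    using that r0 by (auto simp: sets sets_restrict_space_iff)
  have null: "{u. r u > 1 / real (Suc n)} \<in> null_sets \<nu>" for n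
  proof -
    have "emeasure \<nu> {u. r u > 1 / real (Suc n)} < \<infinity>"
      using not_in_closure_superlevel[OF r(1), of 0 "1 / real (Suc n)"] r0 mem by (intro fin) auto
    moreover have "measure \<nu> {u. r u > 1 / real (Suc n)} = 0"
      using regularly_varying_with_superlevel[OF rv r, of "1 / real (Suc n)"] 0 by simp
    ultimately have "emeasure \<nu> {u. r u > 1 / real (Suc n)} = 0" by (simp add: emeasure_eq_ennreal_measure)
    then show ?thesis using mem[of "1 / real (Suc n)"] by (intro null_setsI) simp_all
  qed
  have "space \<nu> \<subseteq> (\<Union>n. {u. r u > 1 / real (Suc n)})"
  proof
    fix u assume "u \<in> space \<nu>"
    then have "r u > 0" using pos sets_eq_imp_space_eq[OF sets] by auto
    then obtain n where "inverse (real (Suc n)) < r u" using reals_Archimedean by blast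
    then show "u \<in> (\<Union>n. {u. r u > 1 / real (Suc n)})" by (auto simp: inverse_eq_divide)
  qed
  moreover have null': "(\<Union>n. {u. r u > 1 / real (Suc n)}) \<in> null_sets \<nu>" by (rule null_sets_UN) (rule null)
  ultimately have "emeasure \<nu> (space \<nu>) \<le> emeasure \<nu> (\<Union>n. {u. r u > 1 / real (Suc n)})"
    by (intro emeasure_mono) (auto dest: null_setsD2)
  with nz null_setsD1[OF null'] show False by simp
qed

section \<open>From the regularly varying vector to the rescaled pair\<close>

lemma borel_measurable_phi:
  assumes "1 \<le> q"
  shows "(phi q :: (real^'d) \<times> real \<Rightarrow> _) \<in> borel_measurable borel"
  unfolding phi_def case_prod_beta borel_prod[symmetric] using assms by measurable

text \<open>The limit \<open>P\<close> is the image under \<open>phi q\<close> of \<open>L\<close>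
  conditioned on \<open>lq_norm q x > 1\<close>. On that event \<open>phi q\<close> is continuous,
  and the event is contained in the original conditioning event, so the new conditional law is a
  further conditioning of the given one.\<close>

lemma rescaled_pair_cond_RV:
  fixes q :: ereal and M :: "'w measure" and X :: "'w \<Rightarrow> real^'d" and Z :: "'w \<Rightarrow> real"
  assumes q: "1 \<le> q" and M: "prob_space M" and X [measurable]: "X \<in> borel_measurable M"
    and Z [measurable]: "Z \<in> borel_measurable M"
    and rv: "regularly_varying_vec M (\<lambda>w. (X w, Z w))"
    and ld: "limit_distribution q M (\<lambda>w. (X w, Z w)) L"
    and pos: "measure L {(x, z). lq_norm q x > 1} > 0"
  shows "\<exists>P. cond_RV q M X (\<lambda>w. Z w / lq_norm q (X w)) P \<and>
             (\<forall>A\<in>sets borel. A \<subseteq> {(x, y). lq_norm q x > 1} \<longrightarrow>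
                measure P A = measure L (phi q -` A) / measure L {(x, z). lq_norm q x > 1})"
proof -
  interpret prob_space M by fact
  obtain \<alpha> b \<nu> where rvw: "regularly_varying_with M (\<lambda>w. (X w, Z w)) \<alpha> b \<nu>"
    using rv by (auto simp: regularly_varying_vec_def)
  then have a: "\<alpha> > 0" and bpos: "\<And>t. t > 0 \<Longrightarrow> b t > 0"
    by (auto simp: regularly_varying_with_def regularly_varying_fun_def)
  define U where "U w = (X w, Z w)" for w
  have Um [measurable]: "U \<in> borel_measurable M" unfolding U_def by measurable
  define N r :: "(real^'d) \<times> real \<Rightarrow> real" where "N = lq_norm q" and "r u = lq_norm q (fst u)" for u
  let ?R = "\<lambda>t. {w \<in> space M. r (U w) > t}"
  let ?W = "\<lambda>t w. (1 / t) *\<^sub>R U w"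
  have L: "prob_space L" "sets L = sets borel"
    and wl: "weak_limit (\<lambda>t. cond_law M {w \<in> space M. N (U w) > t} (\<lambda>w. (1 / t) *\<^sub>R U w)) L at_top"
    using ld by (auto simp: limit_distribution_def U_def N_def)
  interpret L: prob_space L by fact
  have Nc: "continuous_on UNIV N" "\<And>s u. s > 0 \<Longrightarrow> N (s *\<^sub>R u) = s * N u" "\<And>u. u \<noteq> 0 \<Longrightarrow> N u > 0"
    using q by (auto simp: N_def lq_norm_scaleR continuous_lq_norm lq_norm_pos)
  have rc: "continuous_on UNIV r" "r (s *\<^sub>R u) = s * r u" if "s > 0" for s u
    using that continuous_lq_norm_fst[OF q] by (auto simp: r_def[abs_def] lq_norm_scaleR[OF q])
  have rc1: "continuous_on UNIV r" using rc[of 1] by simp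
  have [measurable]: "N \<in> borel_measurable borel" "r \<in> borel_measurable borel"
    using Nc rc1 by (auto intro: borel_measurable_continuous_onI)
  have rN: "r u \<le> N u" for u unfolding N_def r_def using lq_norm_fst_le[OF q, of "fst u" "snd u"] by simp
  have rset: "{(x, z). lq_norm q x > 1} = {u. r u > 1}" by (auto simp: r_def)
  define n c where "n = measure \<nu> {u. N u > 1}" and "c = measure \<nu> {u. r u > 1}"
  have n: "n > 0" unfolding n_def
    by (rule regularly_varying_with_pos[OF rvw]) (use Nc in auto)
  note rvU = rvw[folded U_def]
  have Nlim: "((\<lambda>t. b t * prob {w \<in> space M. N (U w) > t}) \<longlongrightarrow> n) at_top"
    using regularly_varying_with_tendsto[OF rvU, of N 1] Nc by (auto simp: n_def)
  have rlim: "((\<lambda>t. b t * prob (?R (t * s))) \<longlongrightarrow> s powr (-\<alpha>) * c) at_top" if "s > 0" for s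
    using regularly_varying_with_tendsto[OF rvU, of r s] rc that by (auto simp: c_def)
  define E where "E t = {w \<in> space M. N (U w) > t}" for t
  have Em [measurable]: "E t \<in> sets M" for t unfolding E_def by measurable
  define \<mu> where "\<mu> t = cond_law M (E t) (\<lambda>w. (1 / t) *\<^sub>R U w)" for t
  have wl: "weak_limit \<mu> L at_top" using wl by (simp add: \<mu>_def[abs_def] E_def)
  have Epos: "\<forall>\<^sub>F t in at_top. t > 0 \<and> prob (E t) > 0"
    using order_tendstoD(1)[OF Nlim n] eventually_gt_at_top[of 0]
    by eventually_elim (auto simp: E_def zero_less_mult_iff dest: bpos)
  then have ev: "\<forall>\<^sub>F t in at_top. prob_space (\<mu> t) \<and> sets (\<mu> t) = sets borel"
    by eventually_elim (auto simp: \<mu>_def cond_law_prob_space(2)[OF M] intro!: cond_law_prob_space(1) M)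
  \<comment> \<open>Layers around the level 1 have a limiting conditional mass of at most
    \<open>c / n\<close> times a gap of powers; \<open>c\<close> and \<open>n\<close> come from the
    tails of \<open>r\<close> and of \<open>N\<close>.\<close>
  have null: "measure L {u. r u = 1} = 0"
  proof (rule weak_limit_level_null[OF wl _ ev L rc1])
    fix e :: real assume e: "e > 0"
    obtain d where d: "0 < d" "d < 1" "c / n * ((1 - d) powr (-\<alpha>) - (1 + d) powr (-\<alpha>)) < e"
      using powr_gap_small[OF zero_less_one e] by blast
    let ?r = "\<lambda>t s. prob (?R (t * s))"
    have "((\<lambda>t. (b t * ?r t (1 - d) - b t * ?r t (1 + d)) / (b t * prob (E t))) \<longlongrightarrow> ((1 - d) powr (-\<alpha>) * c - (1 + d) powr (-\<alpha>) * c) / n) at_top"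
      unfolding E_def using d n by (intro tendsto_intros rlim Nlim) auto
    moreover have "((1 - d) powr (-\<alpha>) * c - (1 + d) powr (-\<alpha>) * c) / n < e" using d(3) by (simp add: algebra_simps diff_divide_distrib)
    ultimately have "\<forall>\<^sub>F t in at_top. (b t * ?r t (1 - d) - b t * ?r t (1 + d)) / (b t * prob (E t)) < e" by (rule order_tendstoD(2))
    from this Epos
    have "\<forall>\<^sub>F t in at_top. measure (\<mu> t) {u. 1 - d < r u \<and> r u \<le> 1 + d} \<le> e"
    proof eventually_elim
      case (elim t)
      have "measure (\<mu> t) {u. 1 - d < r u \<and> r u \<le> 1 + d} = prob {w \<in> space M. w \<in> E t \<and> (1 / t) *\<^sub>R U w \<in> {u. 1 - d < r u \<and> r u \<le> 1 + d}} / prob (E t)"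
        unfolding \<mu>_def using elim by (intro measure_cond_law M) auto
      also have "\<dots> \<le> prob ((?R (t * (1 - d))) - (?R (t * (1 + d)))) / prob (E t)"
      proof (intro divide_right_mono finite_measure_mono)
        have "r (?W t w) = r (U w) / t" for w using rc(2)[of "1 / t"] elim by simp
        then show "{w \<in> space M. w \<in> E t \<and> (1 / t) *\<^sub>R U w \<in> {u. 1 - d < r u \<and> r u \<le> 1 + d}}
          \<subseteq> (?R (t * (1 - d))) - (?R (t * (1 + d)))"
          using elim by (auto simp: pos_less_divide_eq pos_divide_le_eq mult.commute not_less)
      qed auto
      also have "\<dots> = (?r t (1 - d) - ?r t (1 + d)) / prob (E t)"
      proof (subst finite_measure_Diff)
        have "t * (1 - d) \<le> t * (1 + d)" using elim d by (intro mult_left_mono) auto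
        then show "(?R (t * (1 + d))) \<subseteq> (?R (t * (1 - d)))" by auto
      qed auto
      also have "\<dots> = (b t * ?r t (1 - d) - b t * ?r t (1 + d)) / (b t * prob (E t))"
        using bpos[of t] elim by (simp add: right_diff_distrib[symmetric])
      finally show ?case using elim by simp
    qed
    with d show "\<exists>d>0. \<forall>\<^sub>F t in at_top. measure (\<mu> t) {u. 1 - d < r u \<and> r u \<le> 1 + d} \<le> e" by auto
  qed auto
  have fr: "measure L (frontier {u. r u > 1}) = 0"
  proof -
    have "measure L (frontier {u. r u > 1}) \<le> measure L {u. r u = 1}"
      using frontier_superlevel[OF rc1] by (intro L.finite_measure_mono) (auto simp: L)
    then show ?thesis using null measure_nonneg[of L] by (metis antisym)
  qed
  define l where "l = measure L {u. r u > 1}"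
  have l: "l > 0" using pos by (simp add: l_def rset)
  \<comment> \<open>By \<open>rN\<close> the event \<open>?R t\<close> lies inside
    \<open>E t\<close>, so restricting the conditional law to \<open>r u > 1\<close> yields an
    unconditional integral over \<open>?R t\<close> divided by \<open>prob (E t)\<close>.\<close>
  have lim: "((\<lambda>t. (\<integral>w. indicator (?R t) w * g (?W t w) \<partial>M) / prob (E t))
     \<longlongrightarrow> (\<integral>u. indicator {u. r u > 1} u * g u \<partial>L)) at_top"
    if g: "continuous_on UNIV g" "\<And>u. \<bar>g u\<bar> \<le> C" for g C
  proof -
    have [measurable]: "g \<in> borel_measurable borel" using g by (intro borel_measurable_continuous_onI)
    have "((\<lambda>t. \<integral>u. indicator {u. r u > 1} u * g u \<partial>\<mu> t) \<longlongrightarrow> (\<integral>u. indicator {u. r u > 1} u * g u \<partial>L)) at_top"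
      by (rule weak_limit_continuity_set[OF wl ev L _ fr g]) auto
    moreover have "\<forall>\<^sub>F t in at_top. (\<integral>u. indicator {u. r u > 1} u * g u \<partial>\<mu> t)
       = (\<integral>w. indicator (?R t) w * g (?W t w) \<partial>M) / prob (E t)"
      using Epos
    proof eventually_elim
      case (elim t)
      have "(\<integral>u. indicator {u. r u > 1} u * g u \<partial>\<mu> t)
        = (\<integral>w. indicator (E t) w * (indicator {u. r u > 1} (?W t w) * g (?W t w)) \<partial>M) / prob (E t)"
        unfolding \<mu>_def using elim by (intro integral_cond_law M) auto
      also have "(\<integral>w. indicator (E t) w * (indicator {u. r u > 1} (?W t w) * g (?W t w)) \<partial>M)
         = (\<integral>w. indicator (?R t) w * g (?W t w) \<partial>M)"
      proof (rule Bochner_Integration.integral_cong[OF refl])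
        fix w assume w: "w \<in> space M"
        have "r (?W t w) = r (U w) / t" using rc(2)[of "1 / t"] elim by simp
        then show "indicator (E t) w * (indicator {u. r u > 1} (?W t w) * g (?W t w))
          = indicator (?R t) w * g (?W t w)"
          using elim w rN[of "U w"] by (auto simp: indicator_def E_def)
      qed
      finally show ?case .
    qed
    ultimately show ?thesis by (rule Lim_transform_eventually)
  qed
  have lim1: "((\<lambda>t. prob (?R t) / prob (E t)) \<longlongrightarrow> l) at_top"
    using lim[of "\<lambda>_. 1" 1] by (simp add: l_def sets_eq_imp_space_eq[OF L(2)])
  \<comment> \<open>The same ratio, now from the tails of \<open>\<nu>\<close>. Comparison with
    \<open>lim1\<close> turns the hypothesis on \<open>L\<close> into \<open>c > 0\<close>, which
    makes the quotient of limits below meaningful.\<close>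
  have "((\<lambda>t. (b t * prob (?R (t * 1))) / (b t * prob (E t))) \<longlongrightarrow> 1 powr (-\<alpha>) * c / n) at_top"
    unfolding E_def using n by (intro tendsto_intros rlim Nlim) auto
  moreover have "\<forall>\<^sub>F t in at_top. (b t * prob (?R (t * 1))) / (b t * prob (E t)) = prob (?R t) / prob (E t)"
    using eventually_gt_at_top[of 0] by eventually_elim (auto dest: bpos)
  ultimately have "((\<lambda>t. prob (?R t) / prob (E t)) \<longlongrightarrow> 1 powr (-\<alpha>) * c / n) at_top"
    by (rule Lim_transform_eventually)
  from tendsto_unique[OF _ this lim1] have "1 powr (-\<alpha>) * c / n = l" by simp
  then have c: "c > 0" using l n by (simp add: field_simps zero_less_mult_iff)
  have tail: "((\<lambda>t. prob (?R (t * s)) / prob (?R t)) \<longlongrightarrow> s powr (-\<alpha>)) at_top" if "s > 0" for s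
  proof -
    have "((\<lambda>t. (b t * prob (?R (t * s))) / (b t * prob (?R (t * 1)))) \<longlongrightarrow> (s powr (-\<alpha>) * c) / (1 powr (-\<alpha>) * c)) at_top"
      using c that by (intro tendsto_intros rlim) auto
    moreover have "\<forall>\<^sub>F t in at_top. (b t * prob (?R (t * s))) / (b t * prob (?R (t * 1))) = prob (?R (t * s)) / prob (?R t)"
      using eventually_gt_at_top[of 0] by eventually_elim (auto dest: bpos)
    ultimately show ?thesis using c by (simp add: Lim_transform_eventually)
  qed
  have phim [measurable]: "phi q \<in> borel_measurable borel"
    using q by (rule borel_measurable_phi)
  define R where "R = {u \<in> space L. r u > 1}"
  have R: "R = {u. r u > 1}" by (simp add: R_def sets_eq_imp_space_eq[OF L(2)])
  have Rm: "R \<in> sets L" by (simp add: L R)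
  have phimL: "phi q \<in> borel_measurable L" using phim by (simp cong: measurable_cong_sets add: L)
  have Rpos: "measure L R \<noteq> 0" using l by (simp add: R l_def)
  define P where "P = cond_law L R (phi q)"
  have P: "prob_space P" "sets P = sets borel" unfolding P_def
    using cond_law_prob_space[OF L(1) Rm phimL Rpos] by auto
  interpret P: prob_space P by fact
  have fst_phi: "fst (phi q u) = fst u" for u by (simp add: phi_def case_prod_beta)
  have mP: "measure P A = measure L (phi q -` A) / l" if "A \<in> sets borel" "A \<subseteq> {u. r u > 1}" for A
  proof -
    have "measure P A = measure L {u \<in> space L. u \<in> R \<and> phi q u \<in> A} / measure L R"
      unfolding P_def by (rule measure_cond_law[OF L(1) Rm phimL that(1) Rpos])
    also have "{u \<in> space L. u \<in> R \<and> phi q u \<in> A} = phi q -` A"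
    proof -
      have "u \<in> R" if "phi q u \<in> A" for u
        using that \<open>A \<subseteq> {u. r u > 1}\<close> fst_phi[of u] by (force simp: R r_def)
      then show ?thesis by (auto simp: sets_eq_imp_space_eq[OF L(2)])
    qed
    finally show ?thesis by (simp add: R l_def)
  qed
  have "measure P {u. r u > 1} = 1"
  proof -
    have "phi q -` {u. r u > 1} = {u. r u > 1}" by (auto simp: r_def fst_phi)
    then show ?thesis using l by (subst mP) (auto simp: l_def)
  qed
  then have AEP: "AE u in P. u \<in> {u. r u > 1}"
    by (subst P.AE_in_set_eq_1) (auto simp: P)
  have wlP: "weak_limit (\<lambda>t. cond_law M (?R t) (\<lambda>w. ((1 / t) *\<^sub>R X w, Z w / lq_norm q (X w)))) P at_top"
  proof (rule weak_limit_cond_lawI[OF M _ _ l, where a="\<lambda>t. 1 / prob (E t)"])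
    show "\<forall>\<^sub>F t in at_top. 0 < 1 / prob (E t)" using Epos by eventually_elim simp
    show "((\<lambda>t. 1 / prob (E t) * prob (?R t)) \<longlongrightarrow> l) at_top" using lim1 by simp
    fix f :: "(real^'d) \<times> real \<Rightarrow> real" and K assume fc: "continuous_on UNIV f" and K: "\<And>u. \<bar>f u\<bar> \<le> K"
    have [measurable]: "f \<in> borel_measurable borel" using fc by (intro borel_measurable_continuous_onI)
    \<comment> \<open>\<open>phi q\<close> is discontinuous at \<open>x = 0\<close>. Replacing the
      norm in the denominator by its maximum with 1 gives a continuous map that agrees with
      \<open>phi q\<close> wherever \<open>r u > 1\<close>.\<close>
    define ph where "ph u = (fst u, snd u / max 1 (r u))" for u :: "(real^'d) \<times> real"
    have ph: "continuous_on UNIV ph" unfolding ph_def by (intro continuous_intros rc1) (auto simp: max_def)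
    have ph_eq: "ph u = phi q u" if "r u > 1" for u
      using that by (auto simp: ph_def phi_def r_def case_prod_beta max_def)
    have "((\<lambda>t. 1 / prob (E t) * (\<integral>w. indicator (?R t) w * f (ph (?W t w)) \<partial>M))
     \<longlongrightarrow> (\<integral>u. indicator {u. r u > 1} u * f (ph u) \<partial>L)) at_top"
      using lim[of "\<lambda>u. f (ph u)" K] K continuous_on_compose2[OF fc ph] by simp
    moreover have "(\<integral>u. indicator {u. r u > 1} u * f (ph u) \<partial>L) = l * (\<integral>u. f u \<partial>P)"
    proof -
      have "(\<integral>u. f u \<partial>P) = (\<integral>u. indicator R u * f (phi q u) \<partial>L) / measure L R"
        unfolding P_def by (rule integral_cond_law[OF L(1) Rm phimL _ Rpos]) simp
      also have "(\<integral>u. indicator R u * f (phi q u) \<partial>L) = (\<integral>u. indicator {u. r u > 1} u * f (ph u) \<partial>L)"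
        using ph_eq by (intro Bochner_Integration.integral_cong) (auto simp: R indicator_def)
      finally show ?thesis using l by (simp add: R l_def)
    qed
    ultimately have 1: "((\<lambda>t. 1 / prob (E t) * (\<integral>w. indicator (?R t) w * f (ph (?W t w)) \<partial>M))
     \<longlongrightarrow> l * (\<integral>u. f u \<partial>P)) at_top" by simp
    show "((\<lambda>t. 1 / prob (E t) * (\<integral>w. indicator (?R t) w * f ((1 / t) *\<^sub>R X w, Z w / lq_norm q (X w)) \<partial>M))
     \<longlongrightarrow> l * (\<integral>u. f u \<partial>P)) at_top"
    proof (rule Lim_transform_eventually[OF 1], use eventually_gt_at_top[of 0] in eventually_elim)
      case (elim t)
      have "ph (?W t w) = ((1 / t) *\<^sub>R X w, Z w / lq_norm q (X w))" if "r (U w) > t" for w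
      proof -
        have "r (?W t w) > 1" using rc(2)[of "1 / t"] elim that by simp
        then have "ph (?W t w) = phi q (?W t w)" by (rule ph_eq)
        also have "\<dots> = ((1 / t) *\<^sub>R X w, Z w / lq_norm q (X w))"
          using elim q by (simp add: phi_def U_def lq_norm_scaleR)
        finally show ?thesis .
      qed
      then show ?case
        by (intro arg_cong[where f="\<lambda>v. 1 / prob (E t) * v"] Bochner_Integration.integral_cong) (auto simp: indicator_def)
    qed
  qed (use q in measurable)
  have rU: "r (U w) = lq_norm q (X w)" for w by (simp add: r_def U_def)
  have "cond_RV q M X (\<lambda>w. Z w / lq_norm q (X w)) P"
    unfolding cond_RV_def using a tail[unfolded rU] P AEP wlP[unfolded rU] by (auto simp: r_def)
  then show ?thesis using mP by (intro exI[of _ P]) (auto simp: rset l_def)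
qed

section \<open>From the rescaled pair to the regularly varying vector\<close>

text \<open>The indicator of a proper open set is the pointwise limit of
  \<open>min 1 (real n * infdist u (- S))\<close>, and the open sets form a generator closed under
  intersection.\<close>

lemma prob_measure_eqI_continuous:
  fixes P Q :: "'a::metric_space measure"
  assumes P: "prob_space P" "sets P = sets borel" and Q: "prob_space Q" "sets Q = sets borel"
    and eq: "\<And>f. continuous_on UNIV f \<Longrightarrow> bounded (range f) \<Longrightarrow> (\<integral>u. f u \<partial>P) = (\<integral>u. (f u :: real) \<partial>Q)"
  shows "P = Q"
proof -
  interpret P: prob_space P by fact
  interpret Q: prob_space Q by fact
  have open_eq: "emeasure P S = emeasure Q S" if S: "open S" for S
  proof (cases "S = UNIV")
    case True
    then show ?thesis
      using P.emeasure_space_1 Q.emeasure_space_1 sets_eq_imp_space_eq[OF P(2)] sets_eq_imp_space_eq[OF Q(2)] by simp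
  next
    case False
    define f where "f n u = min 1 (real n * infdist u (- S))" for n u
    have f: "continuous_on UNIV (f n)" "\<bar>f n u\<bar> \<le> 1" for n u
      unfolding f_def by (auto intro!: continuous_intros simp: infdist_nonneg)
    have fm: "f n \<in> borel_measurable borel" for n using f by (intro borel_measurable_continuous_onI)
    have lim: "(\<lambda>n. f n u) \<longlonglongrightarrow> indicator S u" for u
    proof (cases "u \<in> S")
      case True
      then have "infdist u (- S) > 0"
        using in_closed_iff_infdist_zero[of "- S" u] S False infdist_nonneg[of u "- S"] by (auto simp: less_le)
      then have "\<forall>\<^sub>F n in sequentially. real n * infdist u (- S) \<ge> 1" by (rule eventually_one_le_mult)
      then show ?thesis using True by (intro tendsto_eventually) (auto simp: f_def elim: eventually_mono)
    next
      case False
      then show ?thesis by (simp add: f_def)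
    qed
    have conv: "(\<lambda>n. \<integral>u. f n u \<partial>N) \<longlonglongrightarrow> measure N S" if "prob_space N" "sets N = sets borel" for N
    proof -
      interpret N: prob_space N by fact
      have "(\<lambda>n. \<integral>u. f n u \<partial>N) \<longlonglongrightarrow> (\<integral>u. indicator S u \<partial>N)"
        using f fm lim S by (intro integral_dominated_convergence[where w="\<lambda>_. 1"])
          (auto simp: that cong: measurable_cong_sets)
      then show ?thesis by (simp add: sets_eq_imp_space_eq[OF that(2)])
    qed
    have "(\<integral>u. f n u \<partial>P) = (\<integral>u. f n u \<partial>Q)" for n using f by (intro eq) (auto simp: bounded_iff)
    then have "measure P S = measure Q S"
      using conv[OF P] conv[OF Q] by (simp add: LIMSEQ_unique)
    then show ?thesis by (simp add: P.emeasure_eq_measure Q.emeasure_eq_measure)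
  qed
  show ?thesis
    by (rule measure_eqI_generator_eq[where E="Collect open" and \<Omega>=UNIV and A="\<lambda>_. UNIV"])
       (auto simp: Int_stable_def P Q open_eq borel_def)
qed

lemma frontier_vimage_subset:
  assumes "continuous_on UNIV f"
  shows "frontier (f -` A) \<subseteq> f -` frontier A"
proof -
  have "closed (f -` closure A)" "open (f -` interior A)"
    using assms by (auto intro: closed_vimage open_vimage)
  have "closure (f -` A) \<subseteq> f -` closure A"
    by (rule closure_minimal) (use \<open>closed (f -` closure A)\<close> closure_subset[of A] in auto)
  moreover have "f -` interior A \<subseteq> interior (f -` A)"
    by (rule interior_maximal) (use \<open>open (f -` interior A)\<close> interior_subset[of A] in auto)
  ultimately show ?thesis by (auto simp: frontier_def)
qed

text \<open>
  Unlike \<^term>\<open>phi q\<close>, its inverse \<open>(x, y) \<mapsto> (x, lq_norm q x * y)\<close> is continuous on the whole space, so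
  preimages of continuity sets under it need no care at \<open>x = 0\<close>. The image of \<open>s powr \<alpha> * P\<close> under the
  map below is the part of the limit measure carried by \<open>{lq_norm q x > 1 / s}\<close>.
\<close>

definition inv_phi_scaled :: "ereal \<Rightarrow> real \<Rightarrow> (real^'d) \<times> real \<Rightarrow> (real^'d) \<times> real" where
  "inv_phi_scaled q s u = ((1 / s) *\<^sub>R fst u, lq_norm q (fst u) * snd u / s)"

text \<open>Where the covariate is nonzero, \<open>inv_phi_scaled q s\<close> inverts scaling by
  \<open>s\<close> followed by \<open>phi q\<close>. Images under \<open>phi q\<close> thus become
  preimages under a continuous map.\<close>

lemma phi_image_scaled:
  assumes "1 \<le> q" "s > 0" "A \<subseteq> {(x, z). lq_norm q x > 1 / s}"
  shows "phi q ` ((\<lambda>u. s *\<^sub>R u) ` A) = inv_phi_scaled q s -` A"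
proof (intro equalityI subsetI)
  fix u assume "u \<in> phi q ` ((\<lambda>u. s *\<^sub>R u) ` A)"
  then obtain x z where xz: "(x, z) \<in> A" "u = phi q (s *\<^sub>R x, s * z)" by auto
  with assms have "0 < 1 / s" "1 / s < lq_norm q x" by auto
  then have "lq_norm q x > 0" by linarith
  then show "u \<in> inv_phi_scaled q s -` A"
    using xz assms by (simp add: phi_def inv_phi_scaled_def lq_norm_scaleR)
next
  fix u assume u: "u \<in> inv_phi_scaled q s -` A"
  obtain x y where xy: "u = (x, y)" by fastforce
  have "lq_norm q x > 0" using u assms xy by (auto simp: inv_phi_scaled_def lq_norm_scaleR field_simps)
  then have "u = phi q (s *\<^sub>R inv_phi_scaled q s u)"
    using assms xy by (simp add: phi_def inv_phi_scaled_def lq_norm_scaleR)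
  with u show "u \<in> phi q ` ((\<lambda>u. s *\<^sub>R u) ` A)" by blast
qed

lemma continuous_inv_phi_scaled:
  assumes "1 \<le> q"
  shows "continuous_on UNIV (inv_phi_scaled q s)"
  unfolding inv_phi_scaled_def divide_inverse
  by (intro continuous_intros continuous_lq_norm_fst assms)

text \<open>\<open>P\<close> lives on \<open>lq_norm q x > 1\<close>, whereas the limit distribution
  of the vector lives on the larger set \<open>lq_norm q (x, z) > 1\<close>. Hence the conclusion
  describes an extension: \<open>\<nu>\<close> continues \<open>P\<close> by homogeneity, has no
  mass on the axis \<open>x = 0\<close>, and \<open>L\<close> is \<open>\<nu>\<close> normalised
  outside the unit ball. Restricted to \<open>lq_norm q x > 1\<close> and renormalised,
  \<open>L\<close> returns \<open>P\<close> composed with \<open>phi q\<close>.\<close>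

lemma regularly_varying_of_cond_RV:
  fixes q :: ereal and M :: "'w measure" and X :: "'w \<Rightarrow> real^'d" and Y :: "'w \<Rightarrow> real"
  assumes q: "1 \<le> q" and M: "prob_space M" and X [measurable]: "X \<in> borel_measurable M"
    and Y [measurable]: "Y \<in> borel_measurable M"
    and B: "cond_B M Y" and RV: "cond_RV q M X Y P"
  shows "\<exists>\<alpha> b \<nu> L.
           regularly_varying_with M (\<lambda>w. (X w, lq_norm q (X w) * Y w)) \<alpha> b \<nu> \<and>
           (\<forall>A\<in>sets borel. A \<subseteq> {(x, z). lq_norm q x > 1} \<longrightarrow>
              measure \<nu> A = measure P (phi q ` A)) \<and>
           (\<forall>s>0. \<forall>A\<in>sets borel. A \<subseteq> {(x, z). lq_norm q x > 1 / s} \<longrightarrow>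
              measure \<nu> A = s powr \<alpha> * measure P (phi q ` ((\<lambda>u. s *\<^sub>R u) ` A))) \<and>
           emeasure \<nu> {(x, z). x = 0 \<and> z \<noteq> 0} = 0 \<and>
           limit_distribution q M (\<lambda>w. (X w, lq_norm q (X w) * Y w)) L \<and>
           (\<forall>A\<in>sets borel. A \<subseteq> {u. lq_norm q u > 1} \<longrightarrow>
              measure L A = measure \<nu> A / measure \<nu> {u. lq_norm q u > 1}) \<and>
           measure L {(x, z). lq_norm q x > 1} > 0 \<and>
           (\<forall>A\<in>sets borel. A \<subseteq> {(x, z). lq_norm q x > 1} \<longrightarrow>
              measure L A / measure L {(x, z). lq_norm q x > 1} = measure P (phi q ` A))"
proof -
  interpret prob_space M by fact
  obtain C where C: "C > 0" and YC: "AE w in M. \<bar>Y w\<bar> \<le> C"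
    using B by (auto simp: cond_B_def abs_le_iff minus_le_iff)
  define N r :: "(real^'d) \<times> real \<Rightarrow> real" where "N = lq_norm q" and "r u = lq_norm q (fst u)" for u
  let ?E = "\<lambda>t. {w \<in> space M. lq_norm q (X w) > t}"
  define F where "F t = prob (?E t)" for t
  define \<mu> where "\<mu> t = cond_law M (?E t) (\<lambda>w. ((1 / t) *\<^sub>R X w, Y w))" for t
  from RV obtain \<alpha> where a: "\<alpha> > 0" and tail: "\<And>s. s > 0 \<Longrightarrow> ((\<lambda>t. F (t * s) / F t) \<longlongrightarrow> s powr (-\<alpha>)) at_top"
    by (auto simp: cond_RV_def F_def)
  from RV have P: "prob_space P" "sets P = sets borel" and r1: "AE u in P. r u > 1"
    and wl: "weak_limit \<mu> P at_top"
    by (auto simp: cond_RV_def r_def \<mu>_def[abs_def])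
  interpret P: prob_space P by fact
  have spP: "space P = UNIV" using sets_eq_imp_space_eq[OF P(2)] by simp
  have Nc: "continuous_on UNIV N" "\<And>s u. s > 0 \<Longrightarrow> N (s *\<^sub>R u) = s * N u" "\<And>u. u \<noteq> 0 \<Longrightarrow> N u > 0"
    using q by (auto simp: N_def lq_norm_scaleR continuous_lq_norm lq_norm_pos)
  have rc: "continuous_on UNIV r" "\<And>s u. s > 0 \<Longrightarrow> r (s *\<^sub>R u) = s * r u" and r_nonneg: "\<And>u. r u \<ge> 0"
    using continuous_lq_norm_fst[OF q] by (auto simp: r_def[abs_def] lq_norm_scaleR[OF q])
  have [measurable]: "N \<in> borel_measurable borel" "r \<in> borel_measurable borel"
    using Nc rc by (auto intro: borel_measurable_continuous_onI)
  have rN: "r u \<le> N u" for u unfolding N_def r_def using lq_norm_fst_le[OF q, of "fst u" "snd u"] by simp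
  have Xset [measurable]: "(?E t) \<in> sets M" for t using q by measurable
  have F_mono: "F t \<le> F s" if "s \<le> t" for s t
    unfolding F_def using that by (intro finite_measure_mono) auto
  \<comment> \<open>For the factor 1 the tail ratio tends to 1. Since \<open>x / 0 = 0\<close>, the
    tail is nonzero for large arguments, and by monotonicity everywhere.\<close>
  have Fpos: "F t > 0" for t
  proof -
    have "\<forall>\<^sub>F s in at_top. F (s * 1) / F s > 0" by (rule order_tendstoD(1)[OF tail]) auto
    with eventually_ge_at_top[of t] have "\<forall>\<^sub>F s::real in at_top. F t > 0"
    proof eventually_elim
      case (elim s)
      have "F s \<noteq> 0" using elim by auto
      then have "F s > 0" using measure_nonneg[of M] by (simp add: F_def less_le)
      with F_mono[OF elim(1)] show ?case by linarith
    qed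
    then show ?thesis by simp
  qed
  have ev: "\<forall>\<^sub>F t in at_top. prob_space (\<mu> t) \<and> sets (\<mu> t) = sets borel"
  proof (intro always_eventually allI conjI)
    show "prob_space (\<mu> t)" for t
      unfolding \<mu>_def by (rule cond_law_prob_space(1)[OF M Xset]) (use Fpos[of t] F_def in auto)
    show "sets (\<mu> t) = sets borel" for t by (simp add: \<mu>_def cond_law_def)
  qed
  have int_\<mu>: "(\<integral>u. f u \<partial>\<mu> t) = (\<integral>w. indicator (?E t) w * f ((1 / t) *\<^sub>R X w, Y w) \<partial>M) / F t"
    if "f \<in> borel_measurable borel" for f t
    unfolding \<mu>_def F_def by (intro integral_cond_law M that) (use Fpos[of t] F_def in auto)
  \<comment> \<open>Regular variation of this \<open>b\<close> is the tail condition inverted. The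
    choice also fixes the scale of the limit measure: \<open>{u. r u > 1}\<close> gets mass
    1.\<close>
  define b where "b t = 1 / F t" for t
  have brv: "regularly_varying_fun b \<alpha>"
    unfolding regularly_varying_fun_def
  proof (intro conjI allI impI)
    fix x :: real assume x: "x > 0"
    have "((\<lambda>t. inverse (F (t * x) / F t)) \<longlongrightarrow> inverse (x powr (-\<alpha>))) at_top"
      using x by (intro tendsto_inverse tail) auto
    then show "((\<lambda>t. b (t * x) / b t) \<longlongrightarrow> x powr \<alpha>) at_top"
      by (simp add: b_def powr_minus)
  qed (simp add: b_def Fpos)
  \<comment> \<open>By the tail condition the layer between \<open>c - d\<close> and
    \<open>c + d\<close> has at most the limiting mass
    \<open>(c - d) powr (-\<alpha>) - (c + d) powr (-\<alpha>)\<close>. This makes the sets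
    \<open>{u. r u > c}\<close> continuity sets of \<open>P\<close>.\<close>
  have level: "measure P {u. r u = c} = 0" if c: "c > 0" for c
  proof (rule weak_limit_level_null[OF wl _ ev P rc(1)])
    fix e :: real assume e: "e > 0"
    obtain d where d: "0 < d" "d < c" "(c - d) powr (-\<alpha>) - (c + d) powr (-\<alpha>) < e"
      using powr_gap_small[OF c e, of 1 "-\<alpha>"] by auto
    have "((\<lambda>t. F (t * (c - d)) / F t - F (t * (c + d)) / F t) \<longlongrightarrow> (c - d) powr (-\<alpha>) - (c + d) powr (-\<alpha>)) at_top"
      using d by (intro tendsto_diff tail) auto
    from order_tendstoD(2)[OF this d(3)] eventually_gt_at_top[of 0]
    have "\<forall>\<^sub>F t in at_top. measure (\<mu> t) {u. c - d < r u \<and> r u \<le> c + d} \<le> e"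
    proof eventually_elim
      case (elim t)
      have le: "t * (c - d) \<le> t * (c + d)" using elim d by (intro mult_left_mono) auto
      have "measure (\<mu> t) {u. c - d < r u \<and> r u \<le> c + d}
         = prob {w \<in> space M. w \<in> (?E t) \<and> ((1 / t) *\<^sub>R X w, Y w) \<in> {u. c - d < r u \<and> r u \<le> c + d}} / F t"
        unfolding \<mu>_def F_def by (intro measure_cond_law M) (use Fpos[of t] F_def in auto)
      also have "\<dots> \<le> prob ((?E (t * (c - d))) - (?E (t * (c + d)))) / F t"
        using elim Fpos[of t] q
        by (intro divide_right_mono finite_measure_mono)
           (auto simp: r_def lq_norm_scaleR pos_less_divide_eq pos_divide_le_eq mult.commute not_less)
      also have "\<dots> = (F (t * (c - d)) - F (t * (c + d))) / F t"
        unfolding F_def using le by (subst finite_measure_Diff) auto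
      finally show ?case using elim by (simp add: diff_divide_distrib)
    qed
    with d show "\<exists>d>0. \<forall>\<^sub>F t in at_top. measure (\<mu> t) {u. c - d < r u \<and> r u \<le> c + d} \<le> e" by auto
  qed auto

  \<comment> \<open>Scaling relation of the limit law\<close>
  define S where "S c u = ((1 / c) *\<^sub>R fst u, snd u)" for c and u :: "(real^'d) \<times> real"
  have Sc: "continuous_on UNIV (S c)" if "c > 0" for c
    unfolding S_def using that by (auto intro!: continuous_intros)
  have Sm: "S c \<in> borel_measurable borel" if "c > 0" for c
    using Sc[OF that] by (rule borel_measurable_continuous_onI)
  \<comment> \<open>Restricting the conditional law at the threshold \<open>t\<close> to
    \<open>r u > c\<close> and rescaling by \<open>S c\<close> gives \<open>F (t * c) / F t\<close>
    times the conditional law at \<open>t * c\<close>; \<open>c \<ge> 1\<close> makes the events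
    nested. Both sides converge, and their limits are compared.\<close>
  have P_scale_int: "(\<integral>u. indicator {u. r u > c} u * g (S c u) \<partial>P) = c powr (-\<alpha>) * (\<integral>u. g u \<partial>P)"
    if c: "c \<ge> 1" and g: "continuous_on UNIV g" "\<And>u. \<bar>g u\<bar> \<le> K" for c g K
  proof -
    have [measurable]: "g \<in> borel_measurable borel" "S c \<in> borel_measurable borel"
      using g Sm c by (auto intro: borel_measurable_continuous_onI)
    have "measure P (frontier {u. r u > c}) \<le> measure P {u. r u = c}"
      using frontier_superlevel[OF rc(1)] by (intro P.finite_measure_mono) (auto simp: P)
    then have fr: "measure P (frontier {u. r u > c}) = 0"
      using level[of c] c measure_nonneg[of P "frontier {u. r u > c}"] by linarith
    have 1: "((\<lambda>t. \<integral>u. indicator {u. r u > c} u * g (S c u) \<partial>\<mu> t) \<longlongrightarrow> (\<integral>u. indicator {u. r u > c} u * g (S c u) \<partial>P)) at_top"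
      by (rule weak_limit_continuity_set[OF wl ev P _ fr, where C=K])
         (use g c continuous_on_compose2[OF g(1) Sc] in auto)
    have "filterlim (\<lambda>t. t * c) at_top at_top" using c by real_asymp
    then have "((\<lambda>t. (\<integral>u. g u \<partial>\<mu> (t * c))) \<longlongrightarrow> (\<integral>u. g u \<partial>P)) at_top"
      by (rule filterlim_compose[OF weak_limitD[OF wl g]])
    then have 2: "((\<lambda>t. F (t * c) / F t * (\<integral>u. g u \<partial>\<mu> (t * c))) \<longlongrightarrow> c powr (-\<alpha>) * (\<integral>u. g u \<partial>P)) at_top"
      using c by (intro tendsto_mult tail) auto
    have "\<forall>\<^sub>F t in at_top. F (t * c) / F t * (\<integral>u. g u \<partial>\<mu> (t * c)) = (\<integral>u. indicator {u. r u > c} u * g (S c u) \<partial>\<mu> t)"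
      using eventually_gt_at_top[of 0]
    proof eventually_elim
      case (elim t)
      have "(\<integral>u. indicator {u. r u > c} u * g (S c u) \<partial>\<mu> t)
         = (\<integral>w. indicator (?E t) w * (indicator {u. r u > c} ((1 / t) *\<^sub>R X w, Y w) * g (S c ((1 / t) *\<^sub>R X w, Y w))) \<partial>M) / F t"
        by (rule int_\<mu>) simp
      also have "\<dots> = (\<integral>w. indicator (?E (t * c)) w * g ((1 / (t * c)) *\<^sub>R X w, Y w) \<partial>M) / F t"
      proof (intro arg_cong2[where f="(/)"] Bochner_Integration.integral_cong refl)
        fix w assume "w \<in> space M"
        have "t < lq_norm q (X w)" if "t * c < lq_norm q (X w)"
          using mult_left_mono[of 1 c t] elim c that by linarith
        then show "indicator (?E t) w * (indicator {u. r u > c} ((1 / t) *\<^sub>R X w, Y w) * g (S c ((1 / t) *\<^sub>R X w, Y w)))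
           = indicator (?E (t * c)) w * g ((1 / (t * c)) *\<^sub>R X w, Y w)"
          using elim q by (auto simp: indicator_def r_def lq_norm_scaleR S_def pos_less_divide_eq mult.commute)
      qed
      also have "\<dots> = F (t * c) / F t * (\<integral>u. g u \<partial>\<mu> (t * c))"
        using Fpos[of "t * c"] by (subst int_\<mu>) auto
      finally show ?case by simp
    qed
    from Lim_transform_eventually[OF 2 this] show ?thesis by (rule tendsto_unique[OF _ 1, rotated]) simp
  qed
  \<comment> \<open>Read as a statement about laws: \<open>P\<close> conditioned on
    \<open>r u > c\<close> and rescaled by \<open>S c\<close> is \<open>P\<close> again, because a
    law is determined by its continuous test functions.\<close>
  have P_scale: "measure P {u. r u > c \<and> S c u \<in> A} = c powr (-\<alpha>) * measure P A"
    if c: "c \<ge> 1" and A: "A \<in> sets borel" for c A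
  proof -
    have R: "{u. r u > c} \<in> sets P" by (simp add: P)
    have SP: "S c \<in> borel_measurable P" using Sm[of c] c by (simp add: P cong: measurable_cong_sets)
    have "(\<integral>u. indicator {u. r u > c} u * 1 \<partial>P) = c powr (-\<alpha>) * (\<integral>u. 1 \<partial>P)"
      by (rule P_scale_int[OF c, of _ 1]) auto
    then have mR: "measure P {u. r u > c} = c powr (-\<alpha>)" by (simp add: spP P.prob_space[unfolded spP])
    then have nz: "measure P {u. r u > c} \<noteq> 0" using c by simp
    have "cond_law P {u. r u > c} (S c) = P"
    proof (rule prob_measure_eqI_continuous[OF cond_law_prob_space[OF P(1) R SP nz] P])
      fix f :: "(real^'d) \<times> real \<Rightarrow> real" assume f: "continuous_on UNIV f" "bounded (range f)"
      then obtain K where K: "\<And>u. \<bar>f u\<bar> \<le> K" by (auto simp: bounded_iff)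
      have "(\<integral>u. f u \<partial>cond_law P {u. r u > c} (S c)) = (\<integral>u. indicator {u. r u > c} u * f (S c u) \<partial>P) / measure P {u. r u > c}"
        by (rule integral_cond_law[OF P(1) R SP _ nz]) (use f in \<open>auto intro: borel_measurable_continuous_onI\<close>)
      also have "\<dots> = (\<integral>u. f u \<partial>P)" using P_scale_int[OF c f(1) K] c by (simp add: mR)
      finally show "(\<integral>u. f u \<partial>cond_law P {u. r u > c} (S c)) = (\<integral>u. f u \<partial>P)" .
    qed
    then have "measure P A = measure P {u \<in> space P. u \<in> {u. r u > c} \<and> S c u \<in> A} / measure P {u. r u > c}"
      using measure_cond_law[OF P(1) R SP A nz] by simp
    then show ?thesis using c by (simp add: mR spP)
  qed
  \<comment> \<open>A continuous test function that vanishes exactly for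
    \<open>\<bar>snd u\<bar> \<le> C\<close> has integral 0 under every \<open>\<mu> t\<close>,
    hence under \<open>P\<close>.\<close>
  have Y1: "AE u in P. \<bar>snd u\<bar> \<le> C"
  proof -
    define f where "f u = min 1 (max 0 (\<bar>snd u\<bar> - C))" for u :: "(real^'d) \<times> real"
    have f: "continuous_on UNIV f" "\<bar>f u\<bar> \<le> 1" "f u \<ge> 0" for u
      unfolding f_def by (auto intro!: continuous_intros)
    have fm: "f \<in> borel_measurable borel" using f by (intro borel_measurable_continuous_onI)
    have "(\<integral>u. f u \<partial>\<mu> t) = 0" for t
    proof -
      have "(\<integral>w. indicator (?E t) w * f ((1 / t) *\<^sub>R X w, Y w) \<partial>M) = 0"
        using YC by (intro integral_eq_zero_AE) (auto simp: f_def elim: eventually_mono)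
      then show ?thesis using int_\<mu>[OF fm, of t] by simp
    qed
    then have "((\<lambda>t. 0) \<longlongrightarrow> (\<integral>u. f u \<partial>P)) (at_top :: real filter)"
      using weak_limitD[OF wl f(1,2)] by simp
    then have "(\<integral>u. f u \<partial>P) = 0" by (simp add: tendsto_const_iff)
    moreover have "integrable P f" using f fm P by (intro integrable_bounded_borel[of _ _ 1]) auto
    ultimately have "AE u in P. f u = 0" using f by (simp add: integral_nonneg_eq_0_iff_AE)
    then show ?thesis
    proof eventually_elim
      case (elim u)
      then show ?case by (auto simp: f_def min_def max_def split: if_splits)
    qed
  qed

  \<comment> \<open>The limit measure as a supremum of rescaled copies of the limit law\<close>
  define \<psi> where "\<psi> = (inv_phi_scaled q :: real \<Rightarrow> (real^'d) \<times> real \<Rightarrow> _)"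
  have \<psi>c: "continuous_on UNIV (\<psi> s)" for s unfolding \<psi>_def by (rule continuous_inv_phi_scaled[OF q])
  have \<psi>m [measurable]: "\<psi> s \<in> borel_measurable borel" for s using \<psi>c by (rule borel_measurable_continuous_onI)
  have \<psi>P: "\<psi> s \<in> borel_measurable P" for s by (simp add: P cong: measurable_cong_sets)
  have r\<psi>: "r (\<psi> s u) = r u / s" if "s > 0" for s u
    using that q by (simp add: r_def \<psi>_def inv_phi_scaled_def lq_norm_scaleR)
  have vim: "\<psi> s -` A \<in> sets borel" if "A \<in> sets borel" for s A
    using measurable_sets[OF \<psi>m that, of s] by simp
  define \<nu>s where "\<nu>s s = scale_measure (ennreal (s powr \<alpha>)) (distr P borel (\<psi> s))" for s
  have sets_\<nu>s: "sets (\<nu>s s) = sets borel" for s by (simp add: \<nu>s_def)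
  have em_\<nu>s: "emeasure (\<nu>s s) A = ennreal (s powr \<alpha> * measure P (\<psi> s -` A))" if "A \<in> sets borel" for s A
    using that \<psi>P by (simp add: \<nu>s_def emeasure_distr P.emeasure_eq_measure spP ennreal_mult)
  \<comment> \<open>On \<open>{u. r u > 1 / s}\<close> the copies for \<open>m\<close> and
    \<open>s\<close> agree. This is \<open>P_scale\<close> with \<open>c = m / s\<close>, since
    \<open>\<psi> s\<close> after \<open>S (m / s)\<close> is \<open>\<psi> m\<close>.\<close>
  have compat: "measure P (\<psi> m -` (A \<inter> {u. r u > 1 / s})) * m powr \<alpha> = s powr \<alpha> * measure P (\<psi> s -` A)"
    if "0 < s" "s \<le> m" "A \<in> sets borel" for s m A
  proof -
    have "\<psi> m -` (A \<inter> {u. r u > 1 / s}) = {u. r u > m / s \<and> S (m / s) u \<in> \<psi> s -` A}"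
    proof -
      have "\<psi> s (S (m / s) u) = \<psi> m u" for u
        using that q by (simp add: S_def \<psi>_def inv_phi_scaled_def lq_norm_scaleR)
      moreover have "r (\<psi> m u) > 1 / s \<longleftrightarrow> r u > m / s" for u
      proof -
        have "m > 0" using that by linarith
        then show ?thesis using that(1) by (simp add: r\<psi> field_simps)
      qed
      ultimately show ?thesis by auto
    qed
    also have "measure P \<dots> = (m / s) powr (-\<alpha>) * measure P (\<psi> s -` A)"
      using that vim by (intro P_scale) auto
    finally show ?thesis using that by (simp add: powr_divide powr_minus field_simps)
  qed
  \<comment> \<open>The part of the cone that carries the copy for \<open>s\<close>:
    \<open>\<bar>y\<bar> \<le> C\<close> becomes \<open>\<bar>z\<bar> \<le> C * lq_norm q x\<close>,
    and \<open>r u > 1\<close> becomes \<open>r u > 1 / s\<close>.\<close>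
  define supp where "supp s = {u. r u > 1 / s \<and> \<bar>snd u\<bar> \<le> C * r u}" for s
  have \<psi>supp: "AE u in P. \<psi> s u \<in> supp s" if "s > 0" for s
    using r1 Y1
  proof eventually_elim
    case (elim u)
    have "r u * \<bar>snd u\<bar> \<le> r u * C" using elim by (intro mult_left_mono r_nonneg) auto
    then show ?case using elim that r\<psi>[OF that, of u] r_nonneg[of u]
      by (auto simp: supp_def \<psi>_def inv_phi_scaled_def r_def[symmetric] abs_mult divide_right_mono
          divide_strict_right_mono mult.commute)
  qed
  have supp_eq: "measure P (\<psi> s -` A) = measure P (\<psi> s -` A')"
    if "s > 0" "A \<in> sets borel" "A' \<in> sets borel" "A \<inter> supp s = A' \<inter> supp s" for s A A'
    using \<psi>supp[OF that(1)] that vim by (intro P.finite_measure_eq_AE) (auto simp: P elim!: eventually_mono)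
  have mono: "emeasure (\<nu>s s) A \<le> emeasure (\<nu>s m) A" if "0 < s" "s \<le> m" "A \<in> sets borel" for s m A
  proof -
    have "s powr \<alpha> * measure P (\<psi> s -` A) = m powr \<alpha> * measure P (\<psi> m -` (A \<inter> {u. r u > 1 / s}))"
      using compat[OF that] by (simp add: mult.commute)
    also have "\<dots> \<le> m powr \<alpha> * measure P (\<psi> m -` A)"
      using that vim by (intro mult_left_mono P.finite_measure_mono) (auto simp: P)
    finally show ?thesis using that by (simp add: em_\<nu>s ennreal_leI)
  qed
  \<comment> \<open>The copies form a chain of measures on one sigma algebra, so their supremum is
    computed set by set.\<close>
  define \<nu>f where "\<nu>f = (SUP n. \<nu>s (real (Suc n)))"
  have sets_\<nu>f: "sets \<nu>f = sets borel"
    unfolding \<nu>f_def by (rule sets_SUP) (auto simp: sets_\<nu>s)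
  have chain: "Complete_Partial_Order.chain (\<le>) (range (\<lambda>n. \<nu>s (real (Suc n))))"
  proof (rule Complete_Partial_Order.chainI)
    fix x y assume "x \<in> range (\<lambda>n. \<nu>s (real (Suc n)))" "y \<in> range (\<lambda>n. \<nu>s (real (Suc n)))"
    then obtain i j where ij: "x = \<nu>s (real (Suc i))" "y = \<nu>s (real (Suc j))" by auto
    have "\<nu>s (real (Suc i)) \<le> \<nu>s (real (Suc j))" if "i \<le> j" for i j
      using that mono[of "real (Suc i)" "real (Suc j)"]
      by (subst le_measure) (auto simp: sets_\<nu>s)
    then show "x \<le> y \<or> y \<le> x" using ij by (metis nat_le_linear)
  qed
  have em_\<nu>f: "emeasure \<nu>f A = (SUP n. emeasure (\<nu>s (real (Suc n))) A)" if "A \<in> sets borel" for A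
    unfolding \<nu>f_def using that chain by (intro emeasure_SUP_chain[where N=borel]) (auto simp: sets_\<nu>s)
  \<comment> \<open>If inside the cone the set \<open>A\<close> stays above the level
    \<open>1 / s\<close>, the copies for all \<open>m \<ge> s\<close> agree on \<open>A\<close> and
    the supremum is attained at \<open>s\<close>. Points of \<open>A\<close> outside the cone carry
    no mass.\<close>
  have \<nu>f_eq: "emeasure \<nu>f A = emeasure (\<nu>s s) A"
    if A: "A \<in> sets borel" and s: "s > 0" and sub: "\<And>u. u \<in> A \<Longrightarrow> \<bar>snd u\<bar> \<le> C * r u \<Longrightarrow> r u > 1 / s" for A s
  proof -
    have *: "emeasure (\<nu>s m) A = emeasure (\<nu>s s) A" if "m \<ge> s" for m
    proof -
      have "measure P (\<psi> m -` A) = measure P (\<psi> m -` (A \<inter> {u. r u > 1 / s}))"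
        using A s that sub by (intro supp_eq) (auto simp: supp_def)
      then show ?thesis using compat[OF s that A] by (simp add: em_\<nu>s A mult.commute)
    qed
    obtain n0 where n0: "s \<le> real (Suc n0)" using real_arch_simple[of s] by (metis le_SucI of_nat_le_iff order_trans le_refl)
    show ?thesis unfolding em_\<nu>f[OF A]
    proof (rule antisym)
      show "(SUP n. emeasure (\<nu>s (real (Suc n))) A) \<le> emeasure (\<nu>s s) A"
      proof (rule SUP_least)
        fix n
        have "emeasure (\<nu>s (real (Suc n))) A \<le> emeasure (\<nu>s (max s (real (Suc n)))) A"
          by (rule mono) (use A in auto)
        then show "emeasure (\<nu>s (real (Suc n))) A \<le> emeasure (\<nu>s s) A" using *[of "max s (real (Suc n))"] by simp
      qed
      show "emeasure (\<nu>s s) A \<le> (SUP n. emeasure (\<nu>s (real (Suc n))) A)"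
        unfolding *[OF n0, symmetric] by (rule SUP_upper[OF UNIV_I])
    qed
  qed
  define \<nu> where "\<nu> = restrict_space \<nu>f (- {0})"
  have sets_\<nu>: "sets \<nu> = sets (restrict_space borel (- {0}))"
    unfolding \<nu>_def by (rule sets_restrict_space_cong[OF sets_\<nu>f])
  have sp\<nu>: "space \<nu> = - {0}" using sets_eq_imp_space_eq[OF sets_\<nu>] by simp
  have em_\<nu>: "emeasure \<nu> A = emeasure \<nu>f A" if "A \<in> sets borel" "0 \<notin> A" for A
    unfolding \<nu>_def using that by (intro emeasure_restrict_space) (auto simp: sets_\<nu>f)
  have m_\<nu>: "emeasure \<nu> A = ennreal (s powr \<alpha> * measure P (\<psi> s -` A))" "measure \<nu> A = s powr \<alpha> * measure P (\<psi> s -` A)"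
    if "A \<in> sets borel" "0 \<notin> A" "s > 0" "\<And>u. u \<in> A \<Longrightarrow> \<bar>snd u\<bar> \<le> C * r u \<Longrightarrow> r u > 1 / s" for A s
  proof -
    show *: "emeasure \<nu> A = ennreal (s powr \<alpha> * measure P (\<psi> s -` A))"
      using that em_\<nu>[of A] \<nu>f_eq[of A s] em_\<nu>s[of A s] by auto
    then show "measure \<nu> A = s powr \<alpha> * measure P (\<psi> s -` A)" by (simp add: measure_def)
  qed
  obtain k where k: "k > 0" "\<And>x::real^'d. k * norm x \<le> lq_norm q x" using lq_norm_ge_norm[OF q] by blast
  have away: "\<exists>s>0. \<forall>u\<in>A. \<bar>snd u\<bar> \<le> C * r u \<longrightarrow> r u > 1 / s" if "0 \<notin> closure A" for A
  proof -
    have "open (- closure A)" "0 \<in> - closure A" using that by auto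
    then obtain e where e: "e > 0" "ball 0 e \<subseteq> - closure A" by (meson open_contains_ball)
    \<comment> \<open>In the cone \<open>norm u \<le> r u / k + C * r u = K * r u\<close>. A point
      outside the ball of radius \<open>e\<close> therefore has \<open>r u \<ge> e / K\<close>, and
      the witness \<open>2 * K / e\<close> leaves a factor 2 for the strict inequality.\<close>
    define K where "K = 1 / k + C"
    have K: "K > 0" using k C by (auto simp: K_def intro: add_pos_pos)
    have "r u > 1 / (2 * K / e)" if u: "u \<in> A" "\<bar>snd u\<bar> \<le> C * r u" for u
    proof (rule ccontr)
      assume "\<not> r u > 1 / (2 * K / e)"
      then have "K * r u \<le> e / 2" using K e by (simp add: field_simps)
      have "norm u \<le> norm (fst u) + norm (snd u)" by (metis norm_Pair_le prod.collapse)
      also have "\<dots> \<le> r u / k + C * r u"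
        using k(2)[of "fst u"] k(1) u by (intro add_mono) (auto simp: r_def field_simps)
      also have "\<dots> = K * r u" by (simp add: K_def field_simps)
      also have "\<dots> < e" using \<open>K * r u \<le> e / 2\<close> e by linarith
      finally have "u \<in> ball 0 e" by simp
      then show False using e u closure_subset[of A] by auto
    qed
    then show ?thesis using K e by (intro exI[of _ "2 * K / e"]) auto
  qed

  \<comment> \<open>Convergence of the scaled laws to the limit measure\<close>
  define U where "U w = (X w, lq_norm q (X w) * Y w)" for w
  let ?G = "\<lambda>t. {w \<in> space M. N (U w) > t}"
  let ?W = "\<lambda>t w. (1 / t) *\<^sub>R U w"
  have Um [measurable]: "U \<in> borel_measurable M" unfolding U_def using q by measurable
  \<comment> \<open>The weak limit is used at the threshold \<open>t / s\<close>: there the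
    conditional law, transported by \<open>\<psi> s\<close>, is that of the vector divided by
    \<open>t\<close>, given that its covariate exceeds the level \<open>1 / s\<close>. The ratio
    \<open>F (t / s) / F t\<close> supplies \<open>s powr \<alpha>\<close>.\<close>
  have conv: "((\<lambda>t. b t * (\<integral>w. indicator A (?W t w) * g (?W t w) \<partial>M))
      \<longlongrightarrow> s powr \<alpha> * (\<integral>u. indicator A (\<psi> s u) * g (\<psi> s u) \<partial>P)) at_top"
    if A [measurable]: "A \<in> sets borel" and A0: "0 \<notin> closure A" and Afr: "emeasure \<nu> (frontier A) = 0"
      and s: "s > 0" and sub: "\<forall>u\<in>A. \<bar>snd u\<bar> \<le> C * r u \<longrightarrow> r u > 1 / s"
      and g: "continuous_on UNIV g" "\<And>u. \<bar>g u\<bar> \<le> K" for A s g K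
  proof -
    have [measurable]: "g \<in> borel_measurable borel" using g by (intro borel_measurable_continuous_onI)
    \<comment> \<open>The copy for \<open>s\<close> lies below \<open>\<nu>\<close>, so a
      \<open>\<nu>\<close>-null frontier has a \<open>P\<close>-null preimage, and that preimage
      contains the frontier of the preimage of \<open>A\<close>.\<close>
    have "measure P (\<psi> s -` frontier A) = 0"
    proof -
      have "0 \<notin> frontier A" using A0 by (simp add: frontier_def)
      have "emeasure (\<nu>s s) (frontier A) \<le> (SUP n. emeasure (\<nu>s (real (Suc n))) (frontier A))"
      proof -
        obtain n0 where n0: "s \<le> real (Suc n0)" using real_arch_simple[of s] by (metis le_SucI of_nat_le_iff order_trans le_refl)
        have "emeasure (\<nu>s s) (frontier A) \<le> emeasure (\<nu>s (real (Suc n0))) (frontier A)"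
          using s n0 by (intro mono) auto
        then show ?thesis by (rule SUP_upper2[OF UNIV_I])
      qed
      also have "\<dots> = emeasure \<nu> (frontier A)"
        using \<open>0 \<notin> frontier A\<close> by (simp add: em_\<nu>f em_\<nu>)
      finally have "emeasure (\<nu>s s) (frontier A) = 0" using Afr by simp
      then show ?thesis using s by (simp add: em_\<nu>s ennreal_eq_0_iff mult_le_0_iff) (metis measure_nonneg antisym)
    qed
    moreover have "measure P (frontier (\<psi> s -` A)) \<le> measure P (\<psi> s -` frontier A)"
      using frontier_vimage_subset[OF \<psi>c] vim by (intro P.finite_measure_mono) (auto simp: P)
    ultimately have fr: "measure P (frontier (\<psi> s -` A)) = 0"
      using measure_nonneg[of P "frontier (\<psi> s -` A)"] by linarith
    have 1: "((\<lambda>t. \<integral>u. indicator (\<psi> s -` A) u * g (\<psi> s u) \<partial>\<mu> t) \<longlongrightarrow> (\<integral>u. indicator (\<psi> s -` A) u * g (\<psi> s u) \<partial>P)) at_top"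
      by (rule weak_limit_continuity_set[OF wl ev P vim[OF A] fr, where C=K])
         (use g continuous_on_compose2[OF g(1) \<psi>c] in auto)
    have fl: "filterlim (\<lambda>t. t * (1 / s)) at_top at_top" using s by real_asymp
    have 2: "((\<lambda>t. F (t * (1 / s)) / F t * (\<integral>u. indicator (\<psi> s -` A) u * g (\<psi> s u) \<partial>\<mu> (t * (1 / s))))
       \<longlongrightarrow> (1 / s) powr (-\<alpha>) * (\<integral>u. indicator (\<psi> s -` A) u * g (\<psi> s u) \<partial>P)) at_top"
      using s by (intro tendsto_mult tail filterlim_compose[OF 1 fl]) auto
    have "\<forall>\<^sub>F t in at_top. F (t * (1 / s)) / F t * (\<integral>u. indicator (\<psi> s -` A) u * g (\<psi> s u) \<partial>\<mu> (t * (1 / s)))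
        = b t * (\<integral>w. indicator A (?W t w) * g (?W t w) \<partial>M)"
      using eventually_gt_at_top[of 0]
    proof eventually_elim
      case (elim t)
      define t' where "t' = t * (1 / s)"
      have t': "t' > 0" using elim s by (simp add: t'_def)
      have [measurable]: "\<psi> s -` A \<in> sets borel" by (rule vim[OF A])
      have "(\<integral>u. indicator (\<psi> s -` A) u * g (\<psi> s u) \<partial>\<mu> t')
        = (\<integral>w. indicator (?E (t')) w * (indicator (\<psi> s -` A) ((1 / t') *\<^sub>R X w, Y w) * g (\<psi> s ((1 / t') *\<^sub>R X w, Y w))) \<partial>M) / F t'"
        by (rule int_\<mu>) simp
      also have "(\<integral>w. indicator (?E (t')) w * (indicator (\<psi> s -` A) ((1 / t') *\<^sub>R X w, Y w) * g (\<psi> s ((1 / t') *\<^sub>R X w, Y w))) \<partial>M)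
        = (\<integral>w. indicator A (?W t w) * g (?W t w) \<partial>M)"
      \<comment> \<open>Equality holds only almost surely: outside the cone \<open>A\<close> may
        reach below the level \<open>1 / s\<close>, but the scaled vector lies in the cone almost
        surely.\<close>
      proof (rule integral_cong_AE)
        show "AE w in M. indicator (?E (t')) w * (indicator (\<psi> s -` A) ((1 / t') *\<^sub>R X w, Y w) * g (\<psi> s ((1 / t') *\<^sub>R X w, Y w)))
          = indicator A (?W t w) * g (?W t w)"
          using YC AE_space
        proof eventually_elim
          case (elim w)
          have eq: "\<psi> s ((1 / t') *\<^sub>R X w, Y w) = (1 / t) *\<^sub>R U w"
            using t' s \<open>t > 0\<close> q by (simp add: \<psi>_def inv_phi_scaled_def U_def lq_norm_scaleR t'_def)
          have "\<bar>snd (?W t w)\<bar> \<le> C * r (?W t w)"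
            using elim \<open>t > 0\<close> q mult_left_mono[of "\<bar>Y w\<bar>" C "lq_norm q (X w)"]
            by (simp add: U_def r_def lq_norm_scaleR abs_mult divide_right_mono mult.commute)
          moreover have "r (?W t w) > 1 / s \<longleftrightarrow> lq_norm q (X w) > t'"
            using \<open>t > 0\<close> s q by (simp add: r_def U_def lq_norm_scaleR t'_def field_simps)
          ultimately show ?case using sub elim unfolding eq by (auto simp: indicator_def eq)
        qed
      qed (use q in measurable)
      finally show ?case using Fpos[of t'] by (simp add: t'_def b_def)
    qed
    from Lim_transform_eventually[OF 2 this] show ?thesis
      using s by (simp add: powr_divide powr_minus indicator_def)
  qed
  have conv1: "((\<lambda>t. b t * prob {w \<in> space M. U w \<in> (\<lambda>u. t *\<^sub>R u) ` A}) \<longlongrightarrow> measure \<nu> A) at_top"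
    if A [measurable]: "A \<in> sets borel" and A0: "0 \<notin> closure A" and Afr: "emeasure \<nu> (frontier A) = 0" for A
  proof -
    obtain s where s: "s > 0" "\<forall>u\<in>A. \<bar>snd u\<bar> \<le> C * r u \<longrightarrow> r u > 1 / s" using away[OF A0] by auto
    have [measurable]: "\<psi> s -` A \<in> sets P" using vim[OF A] by (simp add: P)
    have "((\<lambda>t. b t * (\<integral>w. indicator A (?W t w) * 1 \<partial>M))
      \<longlongrightarrow> s powr \<alpha> * (\<integral>u. indicator A (\<psi> s u) * 1 \<partial>P)) at_top"
      by (rule conv[OF A A0 Afr s, of _ 1]) auto
    moreover have "(\<integral>u. indicator A (\<psi> s u) * 1 \<partial>P) = measure P (\<psi> s -` A)"
      by (simp add: indicator_vimage[symmetric] spP)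
    moreover have "measure \<nu> A = s powr \<alpha> * measure P (\<psi> s -` A)"
      using A A0 s closure_subset[of A] by (intro m_\<nu>) auto
    ultimately have 1: "((\<lambda>t. b t * (\<integral>w. indicator A (?W t w) * 1 \<partial>M)) \<longlongrightarrow> measure \<nu> A) at_top"
      by simp
    have "\<forall>\<^sub>F t in at_top. b t * (\<integral>w. indicator A (?W t w) * 1 \<partial>M) = b t * prob {w \<in> space M. U w \<in> (\<lambda>u. t *\<^sub>R u) ` A}"
      using eventually_gt_at_top[of 0]
    proof eventually_elim
      case (elim t)
      have "(\<integral>w. indicator A (?W t w) * 1 \<partial>M) = (\<integral>w. (indicator {w \<in> space M. U w \<in> (\<lambda>u. t *\<^sub>R u) ` A} w :: real) \<partial>M)"
        by (intro Bochner_Integration.integral_cong) (auto simp: indicator_def mem_scaleR_image[OF elim])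
      also have "\<dots> = prob {w \<in> space M. U w \<in> (\<lambda>u. t *\<^sub>R u) ` A}"
        by (simp add: mem_scaleR_image[OF elim])
      finally show ?case by simp
    qed
    from Lim_transform_eventually[OF 1 this] show ?thesis .
  qed
  have \<nu>_r1: "measure \<nu> {u. r u > 1} = 1" "emeasure \<nu> {u. r u > 1} = 1"
  proof -
    have "{u. r u > 1} \<in> sets P" by (simp add: P)
    then have *: "measure P (\<psi> 1 -` {u. r u > 1}) = 1"
      using r1 by (subst P.prob_eq_1) (auto simp: vimage_def r\<psi>)
    have r0: "r 0 = 0" using rc(2) by (rule homogeneous_zero)
    show "measure \<nu> {u. r u > 1} = 1" "emeasure \<nu> {u. r u > 1} = 1"
      using * m_\<nu>[of "{u. r u > 1}" 1] r0 by auto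
  qed
  have rvw: "regularly_varying_with M U \<alpha> b \<nu>"
    unfolding regularly_varying_with_def
  proof (intro conjI ballI impI a brv sets_\<nu>)
    show "emeasure \<nu> (space \<nu>) \<noteq> 0"
      using \<nu>_r1 emeasure_space[of \<nu> "{u. r u > 1}"] by auto
    fix A assume A: "A \<in> sets \<nu>" "0 \<notin> closure A"
    then have "A \<in> sets borel" by (auto simp: sets_\<nu> sets_restrict_space_iff)
    moreover obtain s where "s > 0" "\<forall>u\<in>A. \<bar>snd u\<bar> \<le> C * r u \<longrightarrow> r u > 1 / s" using away[OF A(2)] by auto
    moreover have "0 \<notin> A" using A(2) closure_subset[of A] by auto
    ultimately show "emeasure \<nu> A < \<infinity>" using m_\<nu>(1)[of A s] by auto
  qed (use conv1 in auto)
  have nuA: "measure \<nu> A = s powr \<alpha> * measure P (phi q ` ((\<lambda>u. s *\<^sub>R u) ` A))"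
    if "s > 0" "A \<in> sets borel" "A \<subseteq> {(x, z). lq_norm q x > 1 / s}" for s A
  proof -
    have "\<not> 1 / s < 0" using that by simp
    then have "0 \<notin> A" using that lq_norm_0[OF q, where 'a="real^'d"] by (auto simp: zero_prod_def)
    then show ?thesis
      using that phi_image_scaled[OF q that(1,3)] by (subst m_\<nu>(2)[of A s]) (auto simp: \<psi>_def r_def)
  qed
  have nuA1: "measure \<nu> A = measure P (phi q ` A)"
    if "A \<in> sets borel" "A \<subseteq> {(x, z). lq_norm q x > 1}" for A
    using nuA[of 1 A] that by simp
  have axis: "emeasure \<nu> {(x, z). x = 0 \<and> z \<noteq> 0} = 0"
  proof -
    have eq: "{(x, z). x = 0 \<and> z \<noteq> 0} = {u :: (real^'d) \<times> real. fst u = 0 \<and> snd u \<noteq> 0}" by auto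
    have [measurable]: "{u :: (real^'d) \<times> real. fst u = 0 \<and> snd u \<noteq> 0} \<in> sets borel"
    proof -
      have "closed {u :: (real^'d) \<times> real. fst u = 0}" "closed {u :: (real^'d) \<times> real. snd u = 0}"
        by (intro closed_Collect_eq continuous_intros)+
      then have "{u :: (real^'d) \<times> real. fst u = 0} - {u. snd u = 0} \<in> sets borel" by (intro sets.Diff borel_closed)
      then show ?thesis by (simp add: set_diff_eq)
    qed
    have "{u :: (real^'d) \<times> real. fst u = 0 \<and> snd u \<noteq> 0} \<inter> supp 1 = {} \<inter> supp 1"
      using lq_norm_0[OF q, where 'a="real^'d"] by (auto simp: supp_def r_def)
    then have "measure P (\<psi> 1 -` {u :: (real^'d) \<times> real. fst u = 0 \<and> snd u \<noteq> 0}) = measure P (\<psi> 1 -` {})"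
      by (intro supp_eq) auto
    moreover have "emeasure \<nu> {u :: (real^'d) \<times> real. fst u = 0 \<and> snd u \<noteq> 0} = ennreal (1 powr \<alpha> * measure P (\<psi> 1 -` {u. fst u = 0 \<and> snd u \<noteq> 0}))"
      using C lq_norm_0[OF q, where 'a="real^'d"] by (intro m_\<nu>(1)) (auto simp: r_def)
    ultimately show ?thesis unfolding eq by simp
  qed

  \<comment> \<open>The limit distribution of the vector\<close>
  define D where "D = {u. N u > 1}"
  have N0: "N 0 = 0" using Nc(2) by (rule homogeneous_zero)
  have D: "D \<in> sets borel" "0 \<notin> closure D" "0 \<notin> D"
    using not_in_closure_superlevel[OF Nc(1), of 0 1] N0 by (auto simp: D_def)
  obtain s where s: "s > 0" "\<forall>u\<in>D. \<bar>snd u\<bar> \<le> C * r u \<longrightarrow> r u > 1 / s" using away[OF D(2)] by auto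
  have Dfr: "emeasure \<nu> (frontier D) = 0"
  proof -
    have "emeasure \<nu> (frontier D) \<le> emeasure \<nu> {u. N u = 1}"
      using frontier_superlevel[OF Nc(1), of 1] N0 by (intro emeasure_mono) (auto simp: D_def sets_\<nu> sets_restrict_space_iff)
    then show ?thesis using regularly_varying_with_level_null[OF rvw Nc(1,2), of 1] by simp
  qed
  have \<psi>D: "\<psi> s -` D \<in> sets P" using vim[OF D(1)] by (simp add: P)
  have \<nu>D: "measure \<nu> D = s powr \<alpha> * measure P (\<psi> s -` D)" using D s by (intro m_\<nu>) auto
  have \<nu>Dpos: "measure \<nu> D > 0"
    unfolding D_def by (rule regularly_varying_with_pos[OF rvw]) (use Nc in auto)
  then have nz: "measure P (\<psi> s -` D) \<noteq> 0" using \<nu>D by auto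
  \<comment> \<open>\<open>D\<close> is bounded away from the origin, so a single copy describes
    \<open>\<nu>\<close> on \<open>D\<close>, and \<open>\<nu>\<close> normalised on
    \<open>D\<close> is the image under \<open>\<psi> s\<close> of a conditioned
    \<open>P\<close>.\<close>
  define L where "L = cond_law P (\<psi> s -` D) (\<psi> s)"
  have L: "prob_space L" "sets L = sets borel"
    unfolding L_def using cond_law_prob_space[OF P(1) \<psi>D \<psi>P nz] by auto
  have mL: "measure L A = measure \<nu> A / measure \<nu> D" if "A \<in> sets borel" "A \<subseteq> D" for A
  proof -
    have "measure L A = measure P {u \<in> space P. u \<in> \<psi> s -` D \<and> \<psi> s u \<in> A} / measure P (\<psi> s -` D)"
      unfolding L_def by (rule measure_cond_law[OF P(1) \<psi>D \<psi>P that(1) nz])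
    also have "{u \<in> space P. u \<in> \<psi> s -` D \<and> \<psi> s u \<in> A} = \<psi> s -` A" using that by (auto simp: spP)
    also have "measure P (\<psi> s -` A) / measure P (\<psi> s -` D) = measure \<nu> A / measure \<nu> D"
      using that D s m_\<nu>(2)[of A s] unfolding \<nu>D by (subst m_\<nu>(2)[of A s]) auto
    finally show ?thesis .
  qed
  have bD: "((\<lambda>t. b t * prob (?G t)) \<longlongrightarrow> measure \<nu> D) at_top"
    using regularly_varying_with_tendsto[OF rvw Nc(1,2), of 1] by (simp add: D_def)
  have "weak_limit (\<lambda>t. cond_law M (?G t) (\<lambda>w. (1 / t) *\<^sub>R U w)) L at_top"
  proof (rule weak_limit_cond_lawI[OF M _ _ \<nu>Dpos _ bD])
    show "\<forall>\<^sub>F t in at_top. 0 < b t" using Fpos by (simp add: b_def)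
    fix g :: "(real^'d) \<times> real \<Rightarrow> real" and K assume g: "continuous_on UNIV g" and K: "\<And>u. \<bar>g u\<bar> \<le> K"
    have [measurable]: "g \<in> borel_measurable borel" using g by (intro borel_measurable_continuous_onI)
    have "(\<integral>u. g u \<partial>L) = (\<integral>u. indicator (\<psi> s -` D) u * g (\<psi> s u) \<partial>P) / measure P (\<psi> s -` D)"
      unfolding L_def by (rule integral_cond_law[OF P(1) \<psi>D \<psi>P _ nz]) simp
    then have "s powr \<alpha> * (\<integral>u. indicator D (\<psi> s u) * g (\<psi> s u) \<partial>P) = measure \<nu> D * (\<integral>u. g u \<partial>L)"
      using nz by (simp add: \<nu>D indicator_def)
    with conv[OF D(1,2) Dfr s g K]
    have 1: "((\<lambda>t. b t * (\<integral>w. indicator D (?W t w) * g (?W t w) \<partial>M)) \<longlongrightarrow> measure \<nu> D * (\<integral>u. g u \<partial>L)) at_top"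
      by simp
    show "((\<lambda>t. b t * (\<integral>w. indicator (?G t) w * g (?W t w) \<partial>M)) \<longlongrightarrow> measure \<nu> D * (\<integral>u. g u \<partial>L)) at_top"
    proof (rule Lim_transform_eventually[OF 1], use eventually_gt_at_top[of 0] in eventually_elim)
      case (elim t)
      then show ?case using Nc(2)[of "1 / t"]
        by (intro arg_cong2[where f="(*)"] refl Bochner_Integration.integral_cong) (auto simp: indicator_def D_def)
    qed
  qed auto
  with L have ld: "limit_distribution q M U L" by (simp add: limit_distribution_def N_def)
  have rset: "{(x, z). lq_norm q x > 1} = {u. r u > 1}" by (auto simp: r_def)
  have rD: "{u. r u > 1} \<subseteq> D" unfolding D_def using rN less_le_trans by blast
  have Lr: "measure L {u. r u > 1} = 1 / measure \<nu> D" using rD \<nu>_r1 by (subst mL) auto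
  have last: "measure L A / measure L {u. r u > 1} = measure P (phi q ` A)"
    if "A \<in> sets borel" "A \<subseteq> {u. r u > 1}" for A
    using that rD \<nu>Dpos nuA1[of A] Lr mL[of A] by (simp add: rset)
  show ?thesis
    using rvw nuA1 nuA axis ld mL Lr \<nu>Dpos last
    unfolding rset N_def[symmetric] U_def[abs_def, symmetric] D_def[symmetric]
    by (intro exI[of _ \<alpha>] exI[of _ b] exI[of _ \<nu>] exI[of _ L]) (auto simp: U_def[abs_def])
qed

section \<open>Densities\<close>

text \<open>The part of \<open>S\<close> where \<open>g\<close> is nonzero is open; if it were
  nonempty, it would not be negligible.\<close>

lemma AE_lborel_open_zero:
  fixes g :: "'a::euclidean_space \<Rightarrow> real"
  assumes S: "open S" and g: "continuous_on S g" and ae: "AE u in lborel. u \<in> S \<longrightarrow> g u = 0" and u: "u \<in> S"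
  shows "g u = 0"
proof (rule ccontr)
  assume "g u \<noteq> 0"
  have "open (g -` (- {0}) \<inter> S)" using continuous_open_preimage[OF g S, of "- {0}"] by (simp add: Int_commute open_Compl)
  moreover have "g -` (- {0}) \<inter> S \<noteq> {}" using u \<open>g u \<noteq> 0\<close> by auto
  ultimately have "\<not> negligible (g -` (- {0}) \<inter> S)" by (rule open_not_negligible)
  moreover have "AE u in lebesgue. u \<notin> g -` (- {0}) \<inter> S"
    using AE_completion[OF ae] by eventually_elim auto
  then have "negligible (g -` (- {0}) \<inter> S)"
    by (subst negligible_iff_null_sets, subst AE_iff_null_sets)
       (use \<open>open (g -` (- {0}) \<inter> S)\<close> in auto)
  ultimately show False by simp
qed

lemma AE_lborel_fst_nonzero: "AE u in (lborel :: ('a::euclidean_space \<times> 'b::euclidean_space) measure). fst u \<noteq> 0"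
proof -
  have "{0} \<times> UNIV \<in> null_sets (lborel \<Otimes>\<^sub>M lborel :: ('a \<times> 'b) measure)"
    by (intro null_setsI) (auto simp: lborel.emeasure_pair_measure_Times)
  then have "{0} \<times> UNIV \<in> null_sets (lborel :: ('a \<times> 'b) measure)" by (simp only: lborel_prod)
  from AE_not_in[OF this] show ?thesis by eventually_elim auto
qed

lemma borel_measurable_continuous_off_0:
  fixes f :: "'a::euclidean_space \<Rightarrow> real"
  assumes "continuous_on (- {0}) f"
  shows "f \<in> borel_measurable borel"
  using assms by (intro borel_measurable_continuous_countable_exceptions[of "{0}"]) auto

lemma nn_integral_lborel_prod:
  fixes f :: "'a::euclidean_space \<times> 'b::euclidean_space \<Rightarrow> ennreal"
  assumes "f \<in> borel_measurable borel"
  shows "(\<integral>\<^sup>+u. f u \<partial>lborel) = (\<integral>\<^sup>+x. \<integral>\<^sup>+y. f (x, y) \<partial>lborel \<partial>lborel)"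
  using assms by (subst lborel.nn_integral_fst) (simp_all add: lborel_prod)

text \<open>Substitute \<open>z = lq_norm q x * y\<close> in each section; the factor in front is
  the Jacobian. The substitution degenerates only for \<open>x = 0\<close>, a null set of
  covariates.\<close>

lemma distributed_rescale:
  fixes q :: ereal and X :: "'w \<Rightarrow> real^'d" and Z :: "'w \<Rightarrow> real"
  assumes q: "1 \<le> q" and D: "distributed M lborel (\<lambda>w. (X w, Z w)) (\<lambda>u. ennreal (\<pi> u))"
  shows "distributed M lborel (\<lambda>w. (X w, Z w / lq_norm q (X w)))
    (\<lambda>u. ennreal (lq_norm q (fst u) * \<pi> (fst u, lq_norm q (fst u) * snd u)))"
proof -
  define f where "f u = ennreal (\<pi> u)" for u
  have f [measurable]: "f \<in> borel_measurable borel" using distributed_borel_measurable[OF D] by (simp add: f_def[abs_def])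
  have XZ [measurable]: "(\<lambda>w. (X w, Z w)) \<in> measurable M borel" using distributed_measurable[OF D] by simp
  have [measurable]: "fst \<in> borel_measurable (borel :: ((real^'d) \<times> real) measure)" "snd \<in> borel_measurable (borel :: ((real^'d) \<times> real) measure)"
    by (auto intro!: borel_measurable_continuous_onI continuous_intros)
  define p where "p u = ennreal (lq_norm q (fst u)) * f (fst u, lq_norm q (fst u) * snd u)" for u :: "(real^'d) \<times> real"
  have p_eq: "ennreal (lq_norm q (fst u) * \<pi> (fst u, lq_norm q (fst u) * snd u)) = p u" for u
    by (simp add: p_def f_def ennreal_mult')
  have p [measurable]: "p \<in> borel_measurable borel" unfolding p_def using q by measurable
  have ph [measurable]: "(phi q :: (real^'d) \<times> real \<Rightarrow> _) \<in> borel_measurable borel" by (rule borel_measurable_phi[OF q])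
  have XY: "(\<lambda>w. (X w, Z w / lq_norm q (X w))) = (\<lambda>w. phi q (X w, Z w))" by (simp add: phi_def)
  have "distr M lborel (\<lambda>w. phi q (X w, Z w)) = density lborel p"
  proof (rule measure_eqI)
    fix A assume "A \<in> sets (distr M lborel (\<lambda>w. phi q (X w, Z w)))"
    then have A [measurable]: "A \<in> sets borel" by simp
    have "emeasure (distr M lborel (\<lambda>w. phi q (X w, Z w))) A = (\<integral>\<^sup>+u. indicator A u \<partial>distr M lborel (\<lambda>w. phi q (X w, Z w)))"
      by simp
    also have "\<dots> = (\<integral>\<^sup>+w. indicator A (phi q (X w, Z w)) \<partial>M)"
      by (rule nn_integral_distr) auto
    also have "\<dots> = (\<integral>\<^sup>+u. f u * indicator A (phi q u) \<partial>lborel)"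
      unfolding f_def by (rule distributed_nn_integral[OF D, symmetric]) measurable
    also have "\<dots> = (\<integral>\<^sup>+x. \<integral>\<^sup>+z. f (x, z) * indicator A (phi q (x, z)) \<partial>lborel \<partial>lborel)"
      by (rule nn_integral_lborel_prod) measurable
    also have "\<dots> = (\<integral>\<^sup>+x. \<integral>\<^sup>+y. p (x, y) * indicator A (x, y) \<partial>lborel \<partial>lborel)"
    proof (rule nn_integral_cong_AE)
      show "AE x::real^'d in lborel. (\<integral>\<^sup>+z. f (x, z) * indicator A (phi q (x, z)) \<partial>lborel) = (\<integral>\<^sup>+y. p (x, y) * indicator A (x, y) \<partial>lborel)"
        using AE_lborel_singleton[of "0::real^'d"]
      proof eventually_elim
        case (elim x)
        then have N: "lq_norm q x > 0" by (rule lq_norm_pos[OF _ q])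
        have "(\<integral>\<^sup>+z. f (x, z) * indicator A (phi q (x, z)) \<partial>lborel)
           = ennreal \<bar>lq_norm q x\<bar> * (\<integral>\<^sup>+y. f (x, 0 + lq_norm q x * y) * indicator A (phi q (x, 0 + lq_norm q x * y)) \<partial>lborel)"
          using N by (intro nn_integral_real_affine) auto
        also have "\<dots> = (\<integral>\<^sup>+y. p (x, y) * indicator A (x, y) \<partial>lborel)"
          using N by (subst nn_integral_cmult[symmetric]) (auto simp: p_def phi_def mult.assoc)
        finally show ?case .
      qed
    qed
    also have "\<dots> = (\<integral>\<^sup>+u. p u * indicator A u \<partial>lborel)"
      by (rule nn_integral_lborel_prod[symmetric]) measurable
    also have "\<dots> = emeasure (density lborel p) A" by (simp add: emeasure_density)
    finally show "emeasure (distr M lborel (\<lambda>w. phi q (X w, Z w))) A = emeasure (density lborel p) A" .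
  qed simp
  then show ?thesis unfolding distributed_def XY p_eq by simp
qed

text \<open>
  Where the section \<open>p (x, \<cdot>)\<close> is not integrable or vanishes almost everywhere, the quotient is
  \<open>0\<close>; such \<open>x\<close> are not charged by the law of \<open>X\<close>.
\<close>

lemma regression_function_of_density:
  fixes X :: "'w \<Rightarrow> real^'d" and Y :: "'w \<Rightarrow> real" and p :: "(real^'d) \<times> real \<Rightarrow> real"
  assumes M: "prob_space M" and D: "distributed M lborel (\<lambda>w. (X w, Y w)) (\<lambda>u. ennreal (p u))"
    and p0: "\<And>u. p u \<ge> 0" and supp: "\<And>x y. \<bar>y\<bar> > B \<Longrightarrow> p (x, y) = 0" and B: "B \<ge> 0"
  shows "regression_function M X Y (\<lambda>x. (\<integral>y. y * p (x, y) \<partial>lborel) / (\<integral>y. p (x, y) \<partial>lborel))"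
proof -
  interpret prob_space M by fact
  have pm [measurable]: "p \<in> borel_measurable borel" using distributed_real_measurable[OF p0 D] by simp
  have XY [measurable]: "(\<lambda>w. (X w, Y w)) \<in> measurable M borel" using distributed_measurable[OF D] by simp
  have cf [measurable]: "fst \<in> borel_measurable (borel :: ((real^'d) \<times> real) measure)" "snd \<in> borel_measurable (borel :: ((real^'d) \<times> real) measure)"
    by (auto intro!: borel_measurable_continuous_onI continuous_intros)
  have X [measurable]: "X \<in> borel_measurable M" and Y [measurable]: "Y \<in> borel_measurable M"
    using measurable_compose[OF XY cf(1)] measurable_compose[OF XY cf(2)] by simp_all
  have YB: "AE w in M. \<bar>Y w\<bar> \<le> B"
  proof -
    have "AE u in lborel. 0 < ennreal (p u) \<longrightarrow> \<bar>snd u\<bar> \<le> B"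
      using supp by (intro AE_I2) (metis ennreal_0 less_irrefl not_less prod.collapse)
    then have "AE w in M. \<bar>snd (X w, Y w)\<bar> \<le> B"
      by (subst distributed_AE2[OF D, of "\<lambda>u. \<bar>snd u\<bar> \<le> B"]) auto
    then show ?thesis by simp
  qed
  then have Yint: "integrable M Y" by (intro integrable_const_bound[where B=B]) auto
  define n d where "n x = (\<integral>y. y * p (x, y) \<partial>lborel)" and "d x = (\<integral>y. p (x, y) \<partial>lborel)" for x
  define f where "f x = n x / d x" for x
  have [measurable]: "n \<in> borel_measurable borel" "d \<in> borel_measurable borel"
    unfolding n_def[abs_def] d_def[abs_def]
    by (auto intro!: lborel.borel_measurable_lebesgue_integral simp: split_beta')
  have fm [measurable]: "f \<in> borel_measurable borel" unfolding f_def[abs_def] by measurable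
  have d0: "d x \<ge> 0" for x unfolding d_def using p0 by (intro integral_nonneg_AE) auto
  have yp: "\<bar>y * p (x, y)\<bar> \<le> B * p (x, y)" for x y
    using supp[of y x] p0[of "(x, y)"] by (cases "\<bar>y\<bar> > B") (auto simp: abs_mult intro!: mult_right_mono)
  have nd: "integrable lborel (\<lambda>y. y * p (x, y))" "\<bar>n x\<bar> \<le> B * d x" if I: "integrable lborel (\<lambda>y. p (x, y))" for x
  proof -
    show "integrable lborel (\<lambda>y. y * p (x, y))"
      by (rule Bochner_Integration.integrable_bound[OF integrable_mult_right[OF I, of B]]) (use yp order_trans[OF yp abs_ge_self] in auto)
    have "\<bar>n x\<bar> \<le> (\<integral>y. \<bar>y * p (x, y)\<bar> \<partial>lborel)" unfolding n_def by (rule integral_abs_bound)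
    also have "\<dots> \<le> (\<integral>y. B * p (x, y) \<partial>lborel)"
      using \<open>integrable lborel (\<lambda>y. y * p (x, y))\<close> I yp by (intro integral_mono) auto
    finally show "\<bar>n x\<bar> \<le> B * d x" by (simp add: d_def)
  qed
  have fB: "\<bar>f x\<bar> \<le> B" for x
  proof (cases "integrable lborel (\<lambda>y. p (x, y)) \<and> d x \<noteq> 0")
    case True
    then show ?thesis using nd(2)[of x] d0[of x] by (simp add: f_def abs_divide divide_le_eq less_le)
  next
    case False
    then have "d x = 0" unfolding d_def using not_integrable_integral_eq by blast
    then show ?thesis using B by (simp add: f_def)
  qed
  \<comment> \<open>If \<open>d x = 0\<close>, the bound on \<open>n x\<close> forces
    \<open>n x = 0\<close>, so the identity survives the convention for division by zero.\<close>
  have fd: "f x * d x = n x" if "integrable lborel (\<lambda>y. p (x, y))" for x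
    using nd(2)[OF that] by (cases "d x = 0") (auto simp: f_def)
  have pint: "integrable lborel p"
    using distributed_integrable[OF D, of "\<lambda>_. 1"] p0 by simp
  then have pint': "integrable (lborel \<Otimes>\<^sub>M lborel) p" by (simp add: lborel_prod)
  have ae: "AE x in lborel. integrable lborel (\<lambda>y. p (x, y))"
    by (rule lborel_pair.AE_integrable_fst'[OF pint'])
  \<comment> \<open>The bound by a multiple of \<open>p\<close> gives integrability on the product
    space, so Fubini applies.\<close>
  have Fub: "(\<integral>w. g (X w, Y w) \<partial>M) = (\<integral>x. (\<integral>y. p (x, y) * g (x, y) \<partial>lborel) \<partial>lborel)"
    if [measurable]: "g \<in> borel_measurable borel" and gB: "\<And>u. \<bar>p u * g u\<bar> \<le> K * p u" for g K
  proof -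
    have "(\<integral>w. g (X w, Y w) \<partial>M) = (\<integral>u. p u * g u \<partial>lborel)"
      by (rule distributed_integral[OF D, symmetric]) (use p0 in auto)
    moreover have "integrable lborel (\<lambda>u. p u * g u)"
      by (rule Bochner_Integration.integrable_bound[OF integrable_mult_right[OF pint, of K]]) (use gB order_trans[OF gB abs_ge_self] in auto)
    then have "integrable (lborel \<Otimes>\<^sub>M lborel) (\<lambda>u. p u * g u)" by (simp add: lborel_prod)
    from lborel_pair.integral_fst'[OF this]
    have "(\<integral>x. (\<integral>y. p (x, y) * g (x, y) \<partial>lborel) \<partial>lborel) = (\<integral>u. p u * g u \<partial>lborel)" by (simp add: lborel_prod)
    ultimately show ?thesis by simp
  qed
  let ?F = "vimage_algebra (space M) X borel"
  have sub: "subalgebra M ?F"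
    unfolding subalgebra_def using X by (auto simp: sets_vimage_algebra2 intro: measurable_sets)
  interpret F: finite_measure_subalgebra M ?F by unfold_locales (rule sub)
  have "AE w in M. real_cond_exp M ?F Y w = f (X w)"
  proof (rule F.real_cond_exp_charact)
    show "integrable M Y" by fact
    show "integrable M (\<lambda>w. f (X w))" using fB by (intro integrable_const_bound[where B=B]) auto
    have "X \<in> measurable ?F borel" by (rule measurable_vimage_algebra1) auto
    then show "(\<lambda>w. f (X w)) \<in> borel_measurable ?F" by measurable
    fix A assume "A \<in> sets ?F"
    then obtain S where S [measurable]: "S \<in> sets borel" and A: "A = X -` S \<inter> space M"
      by (auto simp: sets_vimage_algebra2)
    have "(\<integral>w\<in>A. Y w \<partial>M) = (\<integral>w. (\<lambda>u. indicator S (fst u) * snd u) (X w, Y w) \<partial>M)"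
      unfolding set_lebesgue_integral_def by (intro Bochner_Integration.integral_cong) (auto simp: A indicator_def)
    also have "\<dots> = (\<integral>x. (\<integral>y. p (x, y) * (indicator S (fst (x, y)) * snd (x, y)) \<partial>lborel) \<partial>lborel)"
      by (rule Fub[of _ B]) (use yp p0 B in \<open>auto simp: indicator_def mult.commute\<close>)
    also have "\<dots> = (\<integral>x. indicator S x * n x \<partial>lborel)"
      unfolding n_def by (intro Bochner_Integration.integral_cong refl) (auto simp: indicator_def mult.commute)
    also have "\<dots> = (\<integral>x. (\<integral>y. p (x, y) * (indicator S (fst (x, y)) * f (fst (x, y))) \<partial>lborel) \<partial>lborel)"
    proof (rule integral_cong_AE)
      show "AE x in lborel. indicator S x * n x = (\<integral>y. p (x, y) * (indicator S (fst (x, y)) * f (fst (x, y))) \<partial>lborel)"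
        using ae
      proof eventually_elim
        case (elim x)
        have "(\<integral>y. p (x, y) * (indicator S (fst (x, y)) * f (fst (x, y))) \<partial>lborel) = d x * (indicator S x * f x)"
          by (simp add: d_def)
        also have "\<dots> = indicator S x * n x" by (simp add: fd[OF elim, symmetric])
        finally show ?case ..
      qed
      show "(\<lambda>x. \<integral>y. p (x, y) * (indicator S (fst (x, y)) * f (fst (x, y))) \<partial>lborel) \<in> borel_measurable lborel"
        by simp
    qed measurable
    also have "\<dots> = (\<integral>w. (\<lambda>u. indicator S (fst u) * f (fst u)) (X w, Y w) \<partial>M)"
    proof (rule Fub[of _ B, symmetric])
      show "\<bar>p u * (indicator S (fst u) * f (fst u))\<bar> \<le> B * p u" for u
        using mult_left_mono[OF fB p0[of u], of "fst u"] B p0[of u] by (auto simp: indicator_def abs_mult mult.commute)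
    qed measurable
    also have "\<dots> = (\<integral>w\<in>A. f (X w) \<partial>M)"
      unfolding set_lebesgue_integral_def by (intro Bochner_Integration.integral_cong) (auto simp: A indicator_def)
    finally show "(\<integral>w\<in>A. Y w \<partial>M) = (\<integral>w\<in>A. f (X w) \<partial>M)" .
  qed
  then have "AE w in M. f (X w) = real_cond_exp M ?F Y w" by eventually_elim simp
  then have "regression_function M X Y f" unfolding regression_function_def using Yint fm by auto
  then show ?thesis by (simp add: f_def[abs_def] n_def d_def)
qed

section \<open>Regularly varying densities\<close>

lemma ennreal_tendsto_0I:
  fixes f :: "'i \<Rightarrow> ennreal"
  assumes "\<And>e::real. e > 0 \<Longrightarrow> \<forall>\<^sub>F t in F. f t \<le> ennreal e"
  shows "(f \<longlongrightarrow> 0) F"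
proof (rule order_tendstoI)
  fix a :: ennreal assume "0 < a"
  then obtain e where e: "0 < ennreal e" "ennreal e < a" by (metis ennreal_cases ennreal_0 ennreal_less_top dense less_top_ennreal order.strict_trans)
  then have "e > 0" by (simp add: ennreal_less_zero_iff)
  from assms[OF this] show "\<forall>\<^sub>F t in F. f t < a" by eventually_elim (use e in \<open>auto intro: le_less_trans\<close>)
qed simp

lemma lborel_integral_scaleR:
  fixes f :: "'a::euclidean_space \<Rightarrow> real"
  assumes [measurable]: "f \<in> borel_measurable borel" and t: "t > 0"
  shows "(\<integral>u. f u \<partial>lborel) = t ^ DIM('a) * (\<integral>u. f (t *\<^sub>R u) \<partial>lborel)"
proof -
  have "(\<integral>u. f u \<partial>lborel) = (\<integral>u. f u \<partial>density (distr lborel borel (\<lambda>x. 0 + t *\<^sub>R x)) (\<lambda>_. ennreal (\<bar>t\<bar> ^ DIM('a))))"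
    using t by (subst lborel_affine[of t 0]) (auto simp: ennreal_power)
  also have "\<dots> = (\<integral>u. \<bar>t\<bar> ^ DIM('a) * f u \<partial>distr lborel borel (\<lambda>x. 0 + t *\<^sub>R x))"
    by (subst integral_density) auto
  also have "\<dots> = (\<integral>u. \<bar>t\<bar> ^ DIM('a) * f (0 + t *\<^sub>R u) \<partial>lborel)"
    by (rule integral_distr) auto
  finally show ?thesis using t by simp
qed

context
  fixes q :: ereal and \<alpha> :: real and b :: "real \<Rightarrow> real" and \<pi> pi_inf :: "'a::euclidean_space \<Rightarrow> real"
  assumes q: "1 \<le> q" and cont: "continuous_on (- {0}) \<pi>" and nonneg: "\<And>u. u \<noteq> 0 \<Longrightarrow> \<pi> u \<ge> 0"
    and rd: "regularly_varying_density q \<alpha> b \<pi> pi_inf"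
begin

lemma rvd_basic:
  shows rvd_index_pos: "\<alpha> > 0" and rvd_scaling_pos: "\<And>t. t > 0 \<Longrightarrow> b t > 0"
    and rvd_scaling_ratio: "\<And>x. x > 0 \<Longrightarrow> ((\<lambda>t. b (t * x) / b t) \<longlongrightarrow> x powr \<alpha>) at_top"
    and rvd_tendsto: "\<And>u. u \<noteq> 0 \<Longrightarrow> ((\<lambda>t. t ^ DIM('a) * b t * \<pi> (t *\<^sub>R u)) \<longlongrightarrow> pi_inf u) at_top"
  using rd by (auto simp: regularly_varying_density_def regularly_varying_fun_def)

lemma rvd_nonneg: "u \<noteq> 0 \<Longrightarrow> pi_inf u \<ge> 0"
proof (rule tendsto_lowerbound[OF rvd_tendsto])
  assume "u \<noteq> 0"
  show "\<forall>\<^sub>F t in at_top. 0 \<le> t ^ DIM('a) * b t * \<pi> (t *\<^sub>R u)"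
    using eventually_gt_at_top[of 0]
  proof eventually_elim
    case (elim t)
    then show ?case using nonneg[of "t *\<^sub>R u"] rvd_scaling_pos[of t] \<open>u \<noteq> 0\<close> by simp
  qed
qed auto

text \<open>The limit at \<open>s *\<^sub>R u\<close> along \<open>t\<close> is the limit at
  \<open>u\<close> along \<open>t * s\<close>, up to two corrections: changing the argument of
  \<open>b\<close> costs \<open>s powr \<alpha>\<close>, and the power of \<open>t\<close> costs
  \<open>s ^ DIM('a)\<close>.\<close>

lemma rvd_homogeneous:
  assumes s: "s > 0" and u: "u \<noteq> 0"
  shows "pi_inf (s *\<^sub>R u) = s powr (-\<alpha>) / s ^ DIM('a) * pi_inf u"
proof -
  have lim: "filterlim (\<lambda>t. t * s) at_top at_top" using s by real_asymp
  have "((\<lambda>t. inverse (b (t * s) / b t) / s ^ DIM('a) * ((t * s) ^ DIM('a) * b (t * s) * \<pi> ((t * s) *\<^sub>R u)))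
     \<longlongrightarrow> inverse (s powr \<alpha>) / s ^ DIM('a) * pi_inf u) at_top"
    using s by (intro tendsto_intros rvd_scaling_ratio filterlim_compose[OF rvd_tendsto[OF u] lim]) auto
  moreover have "\<forall>\<^sub>F t in at_top. inverse (b (t * s) / b t) / s ^ DIM('a) * ((t * s) ^ DIM('a) * b (t * s) * \<pi> ((t * s) *\<^sub>R u))
     = t ^ DIM('a) * b t * \<pi> (t *\<^sub>R (s *\<^sub>R u))"
    using eventually_gt_at_top[of 0]
  proof eventually_elim
    case (elim t)
    have "b (t * s) > 0" using elim s by (intro rvd_scaling_pos) auto
    then show ?case using s by (simp add: power_mult_distrib field_simps)
  qed
  ultimately have "((\<lambda>t. t ^ DIM('a) * b t * \<pi> (t *\<^sub>R (s *\<^sub>R u))) \<longlongrightarrow> inverse (s powr \<alpha>) / s ^ DIM('a) * pi_inf u) at_top"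
    by (rule Lim_transform_eventually)
  from tendsto_unique[OF _ rvd_tendsto this] s u show ?thesis by (simp add: powr_minus)
qed

lemma rvd_uniform_open:
  assumes e: "e > 0"
  shows "\<forall>\<^sub>F t in at_top. \<forall>u. lq_norm q u > 1 \<longrightarrow> \<bar>t ^ DIM('a) * b t * \<pi> (t *\<^sub>R u) - pi_inf u\<bar> \<le> e"
proof -
  have "((\<lambda>t. SUP u\<in>{u. lq_norm q u > 1}. ennreal \<bar>t ^ DIM('a) * b t * \<pi> (t *\<^sub>R u) - pi_inf u\<bar>) \<longlongrightarrow> 0) at_top"
    using rd by (simp add: regularly_varying_density_def)
  from order_tendstoD(2)[OF this, of "ennreal e"] e
  have "\<forall>\<^sub>F t in at_top. (SUP u\<in>{u. lq_norm q u > 1}. ennreal \<bar>t ^ DIM('a) * b t * \<pi> (t *\<^sub>R u) - pi_inf u\<bar>) < ennreal e" by simp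
  then show ?thesis
  proof eventually_elim
    case (elim t)
    show ?case
    proof (intro allI impI)
      fix u :: 'a assume "lq_norm q u > 1"
      then have "ennreal \<bar>t ^ DIM('a) * b t * \<pi> (t *\<^sub>R u) - pi_inf u\<bar> \<le> ennreal e"
        using elim by (intro order_trans[OF SUP_upper less_imp_le]) auto
      then show "\<bar>t ^ DIM('a) * b t * \<pi> (t *\<^sub>R u) - pi_inf u\<bar> \<le> e" using e by simp
    qed
  qed
qed

lemma nonzero_of_lq_norm: "lq_norm q u > 0 \<Longrightarrow> u \<noteq> (0::'a)"
  using lq_norm_0[OF q, where 'a='a] by auto

lemma rvd_scaled_continuous:
  "t > 0 \<Longrightarrow> continuous_on (- {0}) (\<lambda>u. t ^ DIM('a) * b t * \<pi> (t *\<^sub>R u))"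
  by (intro continuous_intros continuous_on_compose2[OF cont]) auto

text \<open>A uniform limit is continuous outside the closed unit ball; homogeneity transports this
  to the exterior of every ball, and these open sets cover everything but the origin.\<close>

lemma rvd_continuous: "continuous_on (- {0}) pi_inf"
proof -
  have 1: "continuous_on {u. lq_norm q u > 1} pi_inf"
  proof (rule uniform_limit_theorem[where F = "at_top :: real filter"])
    show "\<forall>\<^sub>F t in at_top. continuous_on {u. lq_norm q u > 1} (\<lambda>u. t ^ DIM('a) * b t * \<pi> (t *\<^sub>R u))"
      using eventually_gt_at_top[of 0]
    proof eventually_elim
      case (elim t)
      then show ?case
        by (rule continuous_on_subset[OF rvd_scaled_continuous]) (use lq_norm_0[OF q, where 'a='a] in auto)
    qed
    show "uniform_limit {u. lq_norm q u > 1} (\<lambda>t u. t ^ DIM('a) * b t * \<pi> (t *\<^sub>R u)) pi_inf at_top"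
    proof (rule uniform_limitI)
      fix e :: real assume "e > 0"
      then have "e / 2 > 0" by simp
      from rvd_uniform_open[OF this]
      show "\<forall>\<^sub>F t in at_top. \<forall>u\<in>{u. lq_norm q u > 1}. dist (t ^ DIM('a) * b t * \<pi> (t *\<^sub>R u)) (pi_inf u) < e"
        by eventually_elim (use \<open>e > 0\<close> in \<open>force simp: dist_real_def\<close>)
    qed
  qed simp
  define V where "V s = {u::'a. lq_norm q u > 1 / s}" for s
  have "continuous_on (\<Union>s\<in>{0<..}. V s) pi_inf"
  proof (rule continuous_on_open_UN)
    fix s :: real assume "s \<in> {0<..}"
    then have s: "s > 0" by simp
    show "open (V s)" unfolding V_def using continuous_lq_norm[OF q] by (intro open_Collect_less) auto
    have "continuous_on (V s) (\<lambda>u. s powr \<alpha> * s ^ DIM('a) * pi_inf (s *\<^sub>R u))"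
      by (intro continuous_intros continuous_on_compose2[OF 1])
         (use s q in \<open>auto simp: V_def lq_norm_scaleR field_simps\<close>)
    moreover have "s powr \<alpha> * s ^ DIM('a) * pi_inf (s *\<^sub>R u) = pi_inf u" if "u \<in> V s" for u
    proof -
      have "lq_norm q u > 0" using that s by (auto simp: V_def intro: less_trans[of 0 "1 / s"])
      then show ?thesis using s by (simp add: rvd_homogeneous nonzero_of_lq_norm powr_minus field_simps)
    qed
    ultimately show "continuous_on (V s) pi_inf" by (rule continuous_on_eq)
  qed
  moreover have "- {0} \<subseteq> (\<Union>s\<in>{0<..}. V s)"
  proof
    fix u :: 'a assume "u \<in> - {0}"
    then have "lq_norm q u > 0" using lq_norm_pos[OF _ q] by auto
    then have "u \<in> V (2 / lq_norm q u)" "2 / lq_norm q u > 0" by (auto simp: V_def)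
    then show "u \<in> (\<Union>s\<in>{0<..}. V s)" by blast
  qed
  ultimately show ?thesis by (rule continuous_on_subset)
qed

text \<open>The definition takes the supremum over \<open>lq_norm q u > 1\<close> only. A boundary
  point \<open>u\<close> is approached by \<open>s *\<^sub>R u\<close> with \<open>s\<close>
  decreasing to 1, and the difference is continuous there.\<close>

lemma rvd_uniform:
  assumes e: "e > 0"
  shows "\<forall>\<^sub>F t in at_top. \<forall>u. lq_norm q u \<ge> 1 \<longrightarrow> \<bar>t ^ DIM('a) * b t * \<pi> (t *\<^sub>R u) - pi_inf u\<bar> \<le> e"
  using rvd_uniform_open[OF e] eventually_gt_at_top[of 0]
proof eventually_elim
  case (elim t)
  define g where "g u = \<bar>t ^ DIM('a) * b t * \<pi> (t *\<^sub>R u) - pi_inf u\<bar>" for u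
  have gc: "continuous_on (- {0}) g"
    unfolding g_def using elim by (intro continuous_intros rvd_scaled_continuous rvd_continuous)
  have all: "g v \<le> e" if "lq_norm q v > 1" for v using elim(1) that by (simp add: g_def)
  show ?case
  proof (intro allI impI)
    fix u :: 'a assume u: "lq_norm q u \<ge> 1"
    then have u0: "u \<noteq> 0" by (intro nonzero_of_lq_norm) auto
    have "isCont g u" using gc u0 by (simp add: continuous_on_eq_continuous_at open_Compl)
    moreover have "((\<lambda>s. s *\<^sub>R u) \<longlongrightarrow> 1 *\<^sub>R u) (at_right (1::real))" by (intro tendsto_intros)
    ultimately have "((\<lambda>s. g (s *\<^sub>R u)) \<longlongrightarrow> g u) (at_right (1::real))"
      by (intro isCont_tendsto_compose[of u g]) auto
    moreover have "\<forall>\<^sub>F s in at_right (1::real). g (s *\<^sub>R u) \<le> e"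
      using eventually_at_right_less[of 1]
    proof eventually_elim
      case (elim s)
      then have "1 * 1 < s * lq_norm q u" using u by (intro mult_less_le_imp_less) auto
      then have "lq_norm q (s *\<^sub>R u) > 1" using elim q by (simp add: lq_norm_scaleR)
      then show ?case by (rule all)
    qed
    ultimately have "g u \<le> e" by (rule tendsto_upperbound) simp
    then show "\<bar>t ^ DIM('a) * b t * \<pi> (t *\<^sub>R u) - pi_inf u\<bar> \<le> e" by (simp add: g_def)
  qed
qed

text \<open>Homogeneity reduces the bound to the unit sphere of \<open>lq_norm q\<close>, which is
  compact and on which \<open>pi_inf\<close> is continuous.\<close>

lemma rvd_bounded: "\<exists>K\<ge>0. \<forall>u. lq_norm q u \<ge> 1 \<longrightarrow> pi_inf u \<le> K * lq_norm q u powr (-\<alpha>) / lq_norm q u ^ DIM('a)"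
proof -
  obtain k where k: "k > 0" "\<And>x::'a. k * norm x \<le> lq_norm q x" using lq_norm_ge_norm[OF q] by blast
  have cl: "closed {u::'a. lq_norm q u = 1}"
    using continuous_lq_norm[OF q] by (intro closed_Collect_eq) auto
  have "bounded {u::'a. lq_norm q u = 1}"
  proof (rule boundedI)
    fix u :: 'a assume "u \<in> {u. lq_norm q u = 1}"
    with k(2)[of u] k(1) show "norm u \<le> 1 / k" by (simp add: field_simps)
  qed
  with cl have comp: "compact {u::'a. lq_norm q u = 1}" by (simp add: compact_eq_bounded_closed)
  have sub: "{u::'a. lq_norm q u = 1} \<subseteq> - {0}" using nonzero_of_lq_norm by force
  have "bounded (pi_inf ` {u. lq_norm q u = 1})"
    by (intro compact_imp_bounded compact_continuous_image comp continuous_on_subset[OF rvd_continuous sub])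
  then obtain K where K: "\<And>u. lq_norm q u = 1 \<Longrightarrow> \<bar>pi_inf u\<bar> \<le> K" by (auto simp: bounded_iff)
  have "pi_inf u \<le> max K 0 * lq_norm q u powr (-\<alpha>) / lq_norm q u ^ DIM('a)" if u: "lq_norm q u \<ge> 1" for u
  proof -
    define s dir where "s = lq_norm q u" and "dir = (1 / lq_norm q u) *\<^sub>R u"
    have s: "s > 0" and dir: "lq_norm q dir = 1" and uw: "u = s *\<^sub>R dir" using u q by (auto simp: s_def dir_def lq_norm_scaleR)
    have "pi_inf u = s powr (-\<alpha>) / s ^ DIM('a) * pi_inf dir"
      unfolding uw using dir by (intro rvd_homogeneous s nonzero_of_lq_norm) simp
    also have "\<dots> \<le> s powr (-\<alpha>) / s ^ DIM('a) * max K 0"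
      using K[OF dir] s by (intro mult_left_mono) auto
    finally show ?thesis by (simp add: s_def mult.commute)
  qed
  then show ?thesis by (intro exI[of _ "max K 0"]) auto
qed

lemma rvd_borel: "pi_inf \<in> borel_measurable borel" "\<pi> \<in> borel_measurable borel"
  using rvd_continuous cont by (auto intro: borel_measurable_continuous_off_0)

text \<open>The dyadic shells of the tail are controlled by \<^term>\<open>b t \<le> \<rho> * b (2 * t)\<close> with \<open>\<rho> < 1\<close>,
  which makes the masses of the shells summable without Potter bounds.\<close>

lemma rvd_integral_tendsto:
  fixes U :: "'w \<Rightarrow> 'a" and h :: "'a \<Rightarrow> real"
  assumes M: "prob_space M" and D: "distributed M lborel U (\<lambda>u. ennreal (\<pi> u))"
    and h: "h \<in> borel_measurable borel" "\<And>u. \<bar>h u\<bar> \<le> C" "\<And>u. lq_norm q u \<le> 1 \<Longrightarrow> h u = 0"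
  shows rvd_integrable: "integrable lborel (\<lambda>u. h u * pi_inf u)"
    and rvd_tendsto_integral: "((\<lambda>t. b t * (\<integral>w. h ((1 / t) *\<^sub>R U w) \<partial>M)) \<longlongrightarrow> (\<integral>u. h u * pi_inf u \<partial>lborel)) at_top"
proof -
  interpret prob_space M by fact
  note [measurable] = rvd_borel h(1)
  have U [measurable]: "U \<in> borel_measurable M" using distributed_measurable[OF D] by simp
  define N where "N = (lq_norm q :: 'a \<Rightarrow> real)"
  let ?G = "\<lambda>t. {w \<in> space M. N (U w) > t}"
  let ?W = "\<lambda>t w. (1 / t) *\<^sub>R U w"
  have N [measurable]: "N \<in> borel_measurable borel" unfolding N_def by (intro borel_measurable_continuous_onI continuous_lq_norm q)
  have Nt: "N (t *\<^sub>R u) = t * N u" if "t > 0" for t u using that q by (simp add: N_def lq_norm_scaleR)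
  obtain k where k: "k > 0" "\<And>x::'a. k * norm x \<le> N x" using lq_norm_ge_norm[OF q] unfolding N_def by blast
  have C: "C \<ge> 0" using h(2)[of 0] by linarith
  have E1: "(\<integral>w. g (?W t w) \<partial>M) = (\<integral>u. g u * (t ^ DIM('a) * \<pi> (t *\<^sub>R u)) \<partial>lborel)"
    if [measurable]: "g \<in> borel_measurable borel" and t: "t > 0" for g t
  proof -
    \<comment> \<open>\<open>\<pi>\<close> may be negative at the origin; \<open>\<pi>'\<close> is
      nonnegative everywhere, induces the same density and differs from \<open>\<pi>\<close> at most
      there.\<close>
    define \<pi>' where "\<pi>' u = max 0 (\<pi> u)" for u
    have [measurable]: "\<pi>' \<in> borel_measurable borel" unfolding \<pi>'_def by measurable
    have "(\<lambda>u. ennreal (\<pi> u)) = (\<lambda>u. ennreal (\<pi>' u))" by (auto simp: \<pi>'_def max_def ennreal_neg)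
    with D have D': "distributed M lborel U (\<lambda>u. ennreal (\<pi>' u))" by simp
    have "(\<integral>w. g (?W t w) \<partial>M) = (\<integral>u. \<pi>' u * g ((1 / t) *\<^sub>R u) \<partial>lborel)"
      by (rule distributed_integral[OF D', symmetric]) (auto simp: \<pi>'_def)
    also have "\<dots> = t ^ DIM('a) * (\<integral>u. \<pi>' (t *\<^sub>R u) * g ((1 / t) *\<^sub>R (t *\<^sub>R u)) \<partial>lborel)"
      by (rule lborel_integral_scaleR) (use t in auto)
    also have "\<dots> = t ^ DIM('a) * (\<integral>u. \<pi> (t *\<^sub>R u) * g u \<partial>lborel)"
    proof (intro arg_cong2[where f="(*)"] refl integral_cong_AE)
      show "AE u in lborel. \<pi>' (t *\<^sub>R u) * g ((1 / t) *\<^sub>R (t *\<^sub>R u)) = \<pi> (t *\<^sub>R u) * g u"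
        using AE_lborel_singleton[of "0::'a"] by eventually_elim (use t nonneg in \<open>auto simp: \<pi>'_def max_def intro: antisym\<close>)
    qed measurable
    also have "\<dots> = (\<integral>u. g u * (t ^ DIM('a) * \<pi> (t *\<^sub>R u)) \<partial>lborel)"
      by (subst integral_mult_right_zero[symmetric]) (simp add: ac_simps)
    finally show ?thesis .
  qed
  \<comment> \<open>The first \<open>n\<close> dyadic shells together. This set is bounded, so
    uniform convergence of the densities gives convergence of the integrals over it.\<close>
  define S where "S n = {u. N u > 1 \<and> N u \<le> 2 ^ n}" for n :: nat
  have Sm [measurable]: "S n \<in> sets borel" for n unfolding S_def by measurable
  have Sfin: "emeasure lborel (S n) < \<infinity>" for n
  proof (rule emeasure_bounded_finite)
    show "bounded (S n)" using k by (intro boundedI[of _ "2 ^ n / k"]) (auto simp: S_def field_simps intro: order_trans)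
  qed
  obtain K where K: "K \<ge> 0" "\<And>u. N u \<ge> 1 \<Longrightarrow> pi_inf u \<le> K"
  proof -
    obtain K where K: "K \<ge> 0" "\<And>u. N u \<ge> 1 \<Longrightarrow> pi_inf u \<le> K * N u powr (-\<alpha>) / N u ^ DIM('a)"
      using rvd_bounded unfolding N_def by blast
    have "pi_inf u \<le> K" if u: "N u \<ge> 1" for u
    proof -
      have "N u powr (-\<alpha>) \<le> 1" using u rvd_index_pos by (simp add: powr_minus inverse_le_1_iff ge_one_powr_ge_zero)
      moreover have "1 \<le> N u ^ DIM('a)" using u by (rule one_le_power)
      ultimately have "K * N u powr (-\<alpha>) / N u ^ DIM('a) \<le> K * 1 / 1"
        using K(1) by (intro frac_le mult_left_mono) auto
      with K(2)[OF u] show ?thesis by simp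
    qed
    with K(1) that show ?thesis by blast
  qed
  have pi0: "pi_inf u \<ge> 0" "u \<noteq> 0" if "u \<in> S n" for u n
  proof -
    show "u \<noteq> 0" using that by (intro nonzero_of_lq_norm) (auto simp: S_def N_def)
    then show "pi_inf u \<ge> 0" by (rule rvd_nonneg)
  qed
  have pi_int: "integrable lborel (\<lambda>u. indicator (S n) u * (g u * pi_inf u))"
    if [measurable]: "g \<in> borel_measurable borel" and g: "\<And>u. \<bar>g u\<bar> \<le> C'" for g n C'
  proof (rule Bochner_Integration.integrable_bound[where f="\<lambda>u. (C' * K) * indicator (S n) u"])
    show "integrable lborel (\<lambda>u. C' * K * indicator (S n) u)" using Sfin by (intro integrable_mult_right) (auto intro: integrable_real_indicator)
    show "AE u in lborel. norm (indicator (S n) u * (g u * pi_inf u)) \<le> norm (C' * K * indicator (S n) u)"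
    proof (intro AE_I2)
      fix u
      show "norm (indicator (S n) u * (g u * pi_inf u)) \<le> norm (C' * K * indicator (S n) u)"
      proof (cases "u \<in> S n")
        case True
        have "\<bar>g u\<bar> * \<bar>pi_inf u\<bar> \<le> C' * K"
          using True pi0[OF True] K(2)[of u] g[of u] by (intro mult_mono) (auto simp: S_def)
        then show ?thesis using True by (simp add: abs_mult[symmetric] order_trans[OF _ abs_ge_self])
      qed simp
    qed
  qed measurable
  have trunc: "((\<lambda>t. b t * (\<integral>w. indicator (S n) (?W t w) * g (?W t w) \<partial>M))
     \<longlongrightarrow> (\<integral>u. indicator (S n) u * (g u * pi_inf u) \<partial>lborel)) at_top"
    if [measurable]: "g \<in> borel_measurable borel" and g: "\<And>u. \<bar>g u\<bar> \<le> C'" for g n C'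
  proof (rule tendstoI)
    fix e :: real assume e: "e > 0"
    define v where "v = measure lborel (S n)"
    have C': "C' \<ge> 0" using g[of 0] by linarith
    have v: "v \<ge> 0" by (simp add: v_def)
    \<comment> \<open>Makes the total error \<open>C' * e' * v\<close> smaller than
      \<open>e\<close>; the \<open>+ 1\<close> keeps the denominator positive when \<open>C'\<close>
      or \<open>v\<close> is 0.\<close>
    define e' where "e' = e / (C' * v + 1)"
    have den: "C' * v + 1 > 0" using C' v by (simp add: add_nonneg_pos)
    then have e': "e' > 0" using e by (simp add: e'_def)
    have ee: "C' * e' * v < e" using den e by (simp add: e'_def field_simps)
    from rvd_uniform[OF e'] eventually_gt_at_top[of 0]
    show "\<forall>\<^sub>F t in at_top. dist (b t * (\<integral>w. indicator (S n) (?W t w) * g (?W t w) \<partial>M))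
      (\<integral>u. indicator (S n) u * (g u * pi_inf u) \<partial>lborel) < e"
    proof eventually_elim
      case (elim t)
      let ?d = "\<lambda>u. t ^ DIM('a) * b t * \<pi> (t *\<^sub>R u)"
      have eq: "b t * (\<integral>w. indicator (S n) (?W t w) * g (?W t w) \<partial>M) = (\<integral>u. indicator (S n) u * (g u * ?d u) \<partial>lborel)"
        by (subst E1[of "\<lambda>u. indicator (S n) u * g u" t]) (use elim in \<open>auto simp: integral_mult_right_zero[symmetric] ac_simps simp del: integral_mult_right_zero\<close>)
      have bd: "\<bar>indicator (S n) u * (g u * (?d u - pi_inf u))\<bar> \<le> C' * e' * indicator (S n) u" for u
      proof (cases "u \<in> S n")
        case True
        then have "\<bar>g u\<bar> * \<bar>?d u - pi_inf u\<bar> \<le> C' * e'"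
          using g[of u] elim C' by (intro mult_mono) (auto simp: S_def N_def)
        then show ?thesis using True by (simp add: abs_mult)
      qed simp
      have I2: "integrable lborel (\<lambda>u. C' * e' * indicator (S n) u)"
        using Sfin by (intro integrable_mult_right) (auto intro: integrable_real_indicator)
      have I1: "integrable lborel (\<lambda>u. indicator (S n) u * (g u * (?d u - pi_inf u)))"
        by (rule Bochner_Integration.integrable_bound[OF I2]) (use bd order_trans[OF bd abs_ge_self] in auto)
      have "(\<integral>u. indicator (S n) u * (g u * ?d u) \<partial>lborel)
         = (\<integral>u. indicator (S n) u * (g u * (?d u - pi_inf u)) + indicator (S n) u * (g u * pi_inf u) \<partial>lborel)"
        by (simp add: algebra_simps)
      also have "\<dots> = (\<integral>u. indicator (S n) u * (g u * (?d u - pi_inf u)) \<partial>lborel) + (\<integral>u. indicator (S n) u * (g u * pi_inf u) \<partial>lborel)"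
        by (intro Bochner_Integration.integral_add I1 pi_int[OF that(1) g])
      finally have "(\<integral>u. indicator (S n) u * (g u * ?d u) \<partial>lborel) - (\<integral>u. indicator (S n) u * (g u * pi_inf u) \<partial>lborel)
         = (\<integral>u. indicator (S n) u * (g u * (?d u - pi_inf u)) \<partial>lborel)" by simp
      also have "\<bar>\<dots>\<bar> \<le> (\<integral>u. \<bar>indicator (S n) u * (g u * (?d u - pi_inf u))\<bar> \<partial>lborel)" by (rule integral_abs_bound)
      also have "\<dots> \<le> (\<integral>u. C' * e' * indicator (S n) u \<partial>lborel)"
        using I1 I2 bd by (intro integral_mono) auto
      also have "\<dots> = C' * e' * v" by (simp add: v_def)
      finally show ?case unfolding eq dist_real_def using ee by simp
    qed
  qed

  \<comment> \<open>Uniform control of the tail by dyadic shells\<close>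
  define F where "F t = prob (?G t)" for t
  have F01: "0 \<le> F t" "F t \<le> 1" for t by (auto simp: F_def)
  \<comment> \<open>Half of the exponent is given away: \<open>b (2 * t) / b t\<close> tends to
    \<open>2 powr \<alpha>\<close>, so it eventually exceeds
    \<open>2 powr (\<alpha> / 2) = 1 / \<rho>\<close>.\<close>
  define \<rho> where "\<rho> = 2 powr (- \<alpha> / 2)"
  have \<rho>: "0 < \<rho>" "\<rho> < 1" using rvd_index_pos by (auto simp: \<rho>_def powr_less_one)
  have "2 powr (\<alpha> / 2) < 2 powr \<alpha>" using rvd_index_pos by simp
  then have "\<forall>\<^sub>F t in at_top. b (t * 2) / b t > 2 powr (\<alpha> / 2)"
    using order_tendstoD(1)[OF rvd_scaling_ratio[of 2]] by simp
  then have "\<forall>\<^sub>F t in at_top. t > 0 \<longrightarrow> b t \<le> \<rho> * b (2 * t)"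
  proof eventually_elim
    case (elim t)
    show ?case
    proof
      assume "t > 0"
      with elim have "2 powr (\<alpha> / 2) * b t < b (2 * t)" by (simp add: pos_less_divide_eq rvd_scaling_pos mult.commute)
      then show "b t \<le> \<rho> * b (2 * t)" by (simp add: \<rho>_def powr_minus_divide field_simps)
    qed
  qed
  \<comment> \<open>The limiting scaled mass of the first shell, plus 1 so that the scaled masses
    are eventually below it.\<close>
  moreover define c1 where "c1 = (\<integral>u. indicator (S 1) u * (1 * pi_inf u) \<partial>lborel) + 1"
  have F_diff: "F t - F (2 ^ n * t) = (\<integral>w. indicator (S n) (?W t w) * 1 \<partial>M)" if "t > 0" for t n
  proof -
    have le: "t \<le> 2 ^ n * t" using that mult_right_mono[of 1 "2 ^ n" t] by simp
    have "F t - F (2 ^ n * t) = prob ((?G t) - (?G (2 ^ n * t)))"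
      unfolding F_def using le by (subst finite_measure_Diff) auto
    also have "(?G t) - (?G (2 ^ n * t)) = {w \<in> space M. (1 / t) *\<^sub>R U w \<in> S n}"
      using that Nt[of "1 / t"] by (auto simp: S_def pos_less_divide_eq pos_divide_le_eq not_less)
    also have "prob \<dots> = (\<integral>w. indicator {w \<in> space M. (1 / t) *\<^sub>R U w \<in> S n} w \<partial>M)" by simp
    also have "\<dots> = (\<integral>w. indicator (S n) (?W t w) * 1 \<partial>M)"
      by (intro Bochner_Integration.integral_cong) (auto simp: indicator_def)
    finally show ?thesis .
  qed
  have "\<forall>\<^sub>F t in at_top. b t * (\<integral>w. indicator (S 1) (?W t w) * 1 \<partial>M) < c1"
    by (rule order_tendstoD(2)[OF trunc[of "\<lambda>_. 1" 1]]) (auto simp: c1_def)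
  ultimately obtain t0' where t0': "\<And>t. t \<ge> t0' \<Longrightarrow> t > 0 \<longrightarrow> b t \<le> \<rho> * b (2 * t)"
    "\<And>t. t \<ge> t0' \<Longrightarrow> b t * (\<integral>w. indicator (S 1) (?W t w) * 1 \<partial>M) < c1"
    unfolding eventually_at_top_linorder by (metis max.bounded_iff order_refl)
  define t0 where "t0 = max 1 t0'"
  have t0: "t0 > 0" and step: "\<And>t. t \<ge> t0 \<Longrightarrow> b t \<le> \<rho> * b (2 * t)"
    and shell: "\<And>t. t \<ge> t0 \<Longrightarrow> b t * (F t - F (2 * t)) \<le> c1"
    using t0' F_diff[of _ 1] by (auto simp: t0_def intro: less_imp_le)
  have steps: "b t \<le> \<rho> ^ n * b (2 ^ n * t)" "t0 \<le> 2 ^ n * t" if "t \<ge> t0" for t n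
  proof (induction n)
    case (Suc n)
    { case 1
      have "b t \<le> \<rho> ^ n * b (2 ^ n * t)" by (rule Suc)
      also have "\<dots> \<le> \<rho> ^ n * (\<rho> * b (2 * (2 ^ n * t)))"
        using \<rho> Suc(2) by (intro mult_left_mono step) auto
      finally show ?case by (simp add: ac_simps) }
    { case 2 show ?case using Suc(2) t0 by simp }
  qed (use that in auto)
  define C1 where "C1 = c1 / (1 - \<rho>)"
  have c1: "c1 \<ge> 0"
    unfolding c1_def using pi0 by (intro add_nonneg_nonneg integral_nonneg_AE) (auto simp: indicator_def)
  \<comment> \<open>Split into the shells between \<open>2 ^ i * t\<close> and
    \<open>2 ^ (i + 1) * t\<close>; on the \<open>i\<close>-th one
    \<open>b t \<le> \<rho> ^ i * b (2 ^ i * t)\<close>, and the one-shell bound applies at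
    \<open>2 ^ i * t\<close>.\<close>
  have tele: "b t * (F t - F (2 ^ n * t)) \<le> c1 * (\<Sum>i<n. \<rho> ^ i)" if t: "t \<ge> t0" for t n
  proof (induction n)
    case (Suc n)
    have "b (2 ^ n * t) > 0" using steps(2)[OF t, of n] t0 by (intro rvd_scaling_pos) auto
    have "F (2 ^ n * t) - F (2 * (2 ^ n * t)) \<ge> 0"
      unfolding F_def using steps(2)[OF t, of n] t0 by (simp, intro finite_measure_mono) auto
    then have "b t * (F (2 ^ n * t) - F (2 * (2 ^ n * t))) \<le> \<rho> ^ n * b (2 ^ n * t) * (F (2 ^ n * t) - F (2 * (2 ^ n * t)))"
      using steps(1)[OF t, of n] by (rule mult_right_mono[rotated])
    also have "\<dots> = \<rho> ^ n * (b (2 ^ n * t) * (F (2 ^ n * t) - F (2 * (2 ^ n * t))))" by simp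
    also have "\<dots> \<le> \<rho> ^ n * c1" using \<rho> steps(2)[OF t, of n] by (intro mult_left_mono shell) auto
    finally have "b t * (F (2 ^ n * t) - F (2 * (2 ^ n * t))) \<le> \<rho> ^ n * c1" .
    with Suc show ?case by (simp add: algebra_simps)
  qed simp
  have geo: "c1 * (\<Sum>i<n. \<rho> ^ i) \<le> C1" for n
  proof -
    have "(\<Sum>i<n. \<rho> ^ i) = (1 - \<rho> ^ n) / (1 - \<rho>)" using \<rho> by (subst sum_gp_strict) auto
    also have "\<dots> \<le> 1 / (1 - \<rho>)" using \<rho> by (intro divide_right_mono) auto
    finally show ?thesis using c1 unfolding C1_def by (metis mult_left_mono times_divide_eq_right mult.right_neutral)
  qed
  have F0: "(\<lambda>n. F (2 ^ n * t)) \<longlonglongrightarrow> 0" if t: "t > 0" for t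
  proof -
    have "(\<lambda>n. prob (?G (2 ^ n * t))) \<longlonglongrightarrow> prob (\<Inter>n. (?G (2 ^ n * t)))"
    proof (rule finite_Lim_measure_decseq)
      show "decseq (\<lambda>n. (?G (2 ^ n * t)))"
      proof (rule decseq_SucI)
        fix n
        have le: "2 ^ n * t \<le> 2 ^ Suc n * t" using t by simp
        then show "(?G (2 ^ Suc n * t)) \<subseteq> (?G (2 ^ n * t))"
          using order.strict_trans1[OF le] by blast
      qed
    qed auto
    also have "(\<Inter>n. (?G (2 ^ n * t))) = {}"
    proof -
      have "\<exists>n. \<not> N (U w) > 2 ^ n * t" for w
      proof -
        obtain n where "N (U w) / t < 2 ^ n" using real_arch_pow[of 2] by auto
        then show ?thesis using t by (intro exI[of _ n]) (auto simp: field_simps)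
      qed
      then show ?thesis by blast
    qed
    finally show ?thesis by (simp add: F_def)
  qed
  \<comment> \<open>The telescoped sum leaves out \<open>F (2 ^ n * t)\<close>, which tends to 0 for
    fixed \<open>t\<close>, while the bound \<open>C1\<close> does not depend on
    \<open>n\<close>.\<close>
  have bF: "b t * F t \<le> C1" if t: "t \<ge> t0" for t
  proof (rule LIMSEQ_le_const2)
    show "(\<lambda>n. b t * (F t - F (2 ^ n * t))) \<longlonglongrightarrow> b t * F t"
      using tendsto_mult[OF tendsto_const tendsto_diff[OF tendsto_const F0[of t]]] t t0 by fastforce
    show "\<exists>n0. \<forall>n\<ge>n0. b t * (F t - F (2 ^ n * t)) \<le> C1"
      using tele[OF t] geo order_trans by blast
  qed
  have C1: "C1 \<ge> 0" using c1 \<rho> by (simp add: C1_def)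
  \<comment> \<open>The bound is uniform in \<open>t \<ge> t0\<close>; this allows the limits in
    \<open>n\<close> and \<open>t\<close> to be interchanged.\<close>
  have tail: "b t * F (2 ^ n * t) \<le> \<rho> ^ n * C1" if t: "t \<ge> t0" for t n
  proof -
    have "b t * F (2 ^ n * t) \<le> \<rho> ^ n * b (2 ^ n * t) * F (2 ^ n * t)"
      using steps(1)[OF t] F01 by (intro mult_right_mono) auto
    also have "\<dots> \<le> \<rho> ^ n * C1"
      using bF[OF steps(2)[OF t, of n]] \<rho> by (simp add: mult.assoc mult_left_mono)
    finally show ?thesis .
  qed
  have Sinc: "S n \<subseteq> S (Suc n)" for n
  proof
    fix u assume "u \<in> S n"
    moreover have "(2::real) ^ n \<le> 2 ^ Suc n" by simp
    ultimately show "u \<in> S (Suc n)" unfolding S_def by (auto intro: order_trans)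
  qed
  have Slim: "(\<lambda>n. indicator (S n) u) \<longlonglongrightarrow> (indicator {u. N u > 1} u :: real)" for u
  proof (rule tendsto_eventually)
    obtain n0 where n0: "N u < 2 ^ n0" using real_arch_pow[of 2] by auto
    show "\<forall>\<^sub>F n in sequentially. indicator (S n) u = (indicator {u. N u > 1} u :: real)"
      using eventually_ge_at_top[of n0]
    proof eventually_elim
      case (elim n)
      have "(2::real) ^ n0 \<le> 2 ^ n" using elim by (intro power_increasing) auto
      with n0 have "N u \<le> 2 ^ n" by linarith
      then show ?case by (auto simp: S_def indicator_def)
    qed
  qed
  \<comment> \<open>The truncated integrals increase with \<open>n\<close> and are bounded by
    \<open>C1\<close>, since each is the limit of
    \<open>b t * (F t - F (2 ^ n * t))\<close>.\<close>
  have int1: "integrable lborel (\<lambda>u. indicator {u. N u > 1} u * pi_inf u)"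
  proof (rule integrable_monotone_convergence)
    show "integrable lborel (\<lambda>u. indicator (S n) u * pi_inf u)" for n using pi_int[of "\<lambda>_. 1" 1 n] by simp
    show "AE u in lborel. mono (\<lambda>n. indicator (S n) u * pi_inf u)"
    proof (intro AE_I2 monoI)
      fix u and i j :: nat assume "i \<le> j"
      then have "S i \<subseteq> S j" by (rule lift_Suc_mono_le[of S, OF Sinc])
      then show "indicator (S i) u * pi_inf u \<le> indicator (S j) u * pi_inf u"
        using pi0(1)[of u j] by (auto simp: indicator_def)
    qed
    show "AE u in lborel. (\<lambda>n. indicator (S n) u * pi_inf u) \<longlonglongrightarrow> indicator {u. N u > 1} u * pi_inf u"
      by (intro AE_I2 tendsto_mult Slim tendsto_const)
    define x where "x n = (\<integral>u. indicator (S n) u * pi_inf u \<partial>lborel)" for n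
    have "x n \<le> C1" for n
    proof -
      have "((\<lambda>t. b t * (\<integral>w. indicator (S n) (?W t w) * 1 \<partial>M)) \<longlongrightarrow> x n) at_top"
        using trunc[of "\<lambda>_. 1" 1 n] by (simp add: x_def)
      moreover have "\<forall>\<^sub>F t in at_top. b t * (\<integral>w. indicator (S n) (?W t w) * 1 \<partial>M) \<le> C1"
        using eventually_ge_at_top[of t0]
      proof eventually_elim
        case (elim t)
        then show ?case using tele[OF elim, of n] geo[of n] F_diff[of t n] t0 by simp
      qed
      ultimately show ?thesis by (rule tendsto_upperbound) simp
    qed
    moreover have "x n \<le> x (Suc n)" for n
      unfolding x_def using pi_int[of "\<lambda>_. 1" 1 n] pi_int[of "\<lambda>_. 1" 1 "Suc n"] Sinc[of n] pi0(1)
      by (intro integral_mono) (auto simp: indicator_def)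
    then have "incseq x" by (rule incseq_SucI)
    ultimately show "(\<lambda>n. \<integral>u. indicator (S n) u * pi_inf u \<partial>lborel) \<longlonglongrightarrow> (SUP n. x n)"
      unfolding x_def[symmetric] by (intro LIMSEQ_incseq_SUP bdd_aboveI[of _ C1]) auto
  qed measurable
  have hpi: "h u * pi_inf u = h u * (indicator {u. N u > 1} u * pi_inf u)" for u
    using h(3)[of u] by (auto simp: indicator_def N_def)
  have hb: "\<bar>h u * pi_inf u\<bar> \<le> C * (indicator {u. N u > 1} u * pi_inf u)" for u
  proof (cases "N u > 1")
    case True
    then have "pi_inf u \<ge> 0" using rvd_nonneg[OF nonzero_of_lq_norm[of u]] by (simp add: N_def)
    then show ?thesis using True h(2)[of u] by (simp add: abs_mult mult_right_mono)
  qed (use h(3)[of u] in \<open>simp add: N_def\<close>)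
  show I: "integrable lborel (\<lambda>u. h u * pi_inf u)"
    by (rule Bochner_Integration.integrable_bound[OF integrable_mult_right[OF int1, of C]])
       (use hb order_trans[OF hb abs_ge_self] in auto)
  define x where "x n = (\<integral>u. indicator (S n) u * (h u * pi_inf u) \<partial>lborel)" for n
  have xlim: "x \<longlonglongrightarrow> (\<integral>u. h u * pi_inf u \<partial>lborel)"
    unfolding x_def[abs_def]
  proof (rule integral_dominated_convergence[where w="\<lambda>u. C * (indicator {u. N u > 1} u * pi_inf u)"])
    show "integrable lborel (\<lambda>u. C * (indicator {u. N u > 1} u * pi_inf u))" using int1 by (rule integrable_mult_right)
    have "(\<lambda>n. indicator (S n) u * (h u * pi_inf u)) \<longlonglongrightarrow> indicator {u. N u > 1} u * (h u * pi_inf u)" for u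
      by (intro tendsto_mult Slim tendsto_const)
    moreover have "indicator {u. N u > 1} u * (h u * pi_inf u) = h u * pi_inf u" for u
      using h(3)[of u] by (cases "N u > 1") (auto simp: N_def)
    ultimately show "AE u in lborel. (\<lambda>n. indicator (S n) u * (h u * pi_inf u)) \<longlonglongrightarrow> h u * pi_inf u"
      by (intro AE_I2) simp
    show "AE u in lborel. norm (indicator (S n) u * (h u * pi_inf u)) \<le> C * (indicator {u. N u > 1} u * pi_inf u)" for n
    proof (intro AE_I2)
      fix u
      have "norm (indicator (S n) u * (h u * pi_inf u)) \<le> \<bar>h u * pi_inf u\<bar>" by (simp add: indicator_def)
      with hb[of u] show "norm (indicator (S n) u * (h u * pi_inf u)) \<le> C * (indicator {u. N u > 1} u * pi_inf u)" by simp
    qed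
  qed measurable
  show "((\<lambda>t. b t * (\<integral>w. h (?W t w) \<partial>M)) \<longlongrightarrow> (\<integral>u. h u * pi_inf u \<partial>lborel)) at_top"
  proof (rule tendstoI)
    fix e :: real assume e: "e > 0"
    \<comment> \<open>One third each for the mass beyond \<open>2 ^ n * t\<close>, for the
      truncation of the limit integral, and for the convergence on the truncated set.\<close>
    then have e3: "e / 3 > 0" by simp
    have "(\<lambda>n. C * (\<rho> ^ n * C1)) \<longlonglongrightarrow> C * (0 * C1)" using \<rho> by (intro tendsto_intros LIMSEQ_power_zero) auto
    then have "\<forall>\<^sub>F n in sequentially. C * (\<rho> ^ n * C1) < e / 3" using e3 by (intro order_tendstoD(2)) auto
    with tendstoD[OF xlim e3] have "\<forall>\<^sub>F n in sequentially. C * (\<rho> ^ n * C1) < e / 3 \<and> dist (x n) (\<integral>u. h u * pi_inf u \<partial>lborel) < e / 3"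
      by eventually_elim simp
    then obtain n where n: "C * (\<rho> ^ n * C1) < e / 3" "dist (x n) (\<integral>u. h u * pi_inf u \<partial>lborel) < e / 3"
      by (auto simp: eventually_sequentially)
    from tendstoD[OF trunc[OF h(1,2), of n] e3] eventually_ge_at_top[of t0]
    show "\<forall>\<^sub>F t in at_top. dist (b t * (\<integral>w. h (?W t w) \<partial>M)) (\<integral>u. h u * pi_inf u \<partial>lborel) < e"
    proof eventually_elim
      case (elim t)
      have t: "t > 0" using elim t0 by linarith
      let ?h = "\<lambda>w. h (?W t w)" and ?i = "\<lambda>w. indicator (S n) (?W t w)"
      have Ih: "integrable M ?h" "integrable M (\<lambda>w. ?i w * ?h w)"
        using h(2) C by (auto intro!: integrable_const_bound[where B=C] simp: indicator_def)
      have "\<bar>(\<integral>w. ?h w \<partial>M) - (\<integral>w. ?i w * ?h w \<partial>M)\<bar> = \<bar>\<integral>w. ?h w - ?i w * ?h w \<partial>M\<bar>"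
        by (subst Bochner_Integration.integral_diff[OF Ih]) simp
      also have "\<dots> \<le> (\<integral>w. \<bar>?h w - ?i w * ?h w\<bar> \<partial>M)" by (rule integral_abs_bound)
      also have "\<dots> \<le> (\<integral>w. C * indicator (?G (2 ^ n * t)) w \<partial>M)"
      proof (rule integral_mono)
        show "integrable M (\<lambda>w. \<bar>?h w - ?i w * ?h w\<bar>)" using Ih by auto
        show "integrable M (\<lambda>w. C * indicator (?G (2 ^ n * t)) w)"
          by (intro integrable_mult_right integrable_real_indicator) (auto simp: emeasure_eq_measure)
        fix w assume w: "w \<in> space M"
        show "\<bar>?h w - ?i w * ?h w\<bar> \<le> C * indicator (?G (2 ^ n * t)) w"
        proof (cases "N (U w) > 2 ^ n * t")
          case True
          then show ?thesis using w h(2) C by (auto simp: indicator_def)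
        next
          case False
          have "N (?W t w) = N (U w) / t" using Nt[of "1 / t"] t by simp
          moreover have "N (U w) / t \<le> 2 ^ n" using False t by (simp add: pos_divide_le_eq not_less)
          ultimately have "?h w = 0 \<or> ?i w = 1"
            using h(3)[of "(1 / t) *\<^sub>R U w"] by (auto simp: S_def indicator_def N_def not_less)
          then show ?thesis using C by (auto simp: indicator_def)
        qed
      qed
      also have "\<dots> = C * F (2 ^ n * t)" by (simp add: F_def)
      finally have *: "\<bar>(\<integral>w. ?h w \<partial>M) - (\<integral>w. ?i w * ?h w \<partial>M)\<bar> \<le> C * F (2 ^ n * t)" .
      have "\<bar>b t * (\<integral>w. ?h w \<partial>M) - b t * (\<integral>w. ?i w * ?h w \<partial>M)\<bar> = b t * \<bar>(\<integral>w. ?h w \<partial>M) - (\<integral>w. ?i w * ?h w \<partial>M)\<bar>"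
        using rvd_scaling_pos[OF t] by (simp add: right_diff_distrib[symmetric] abs_mult)
      also have "\<dots> \<le> b t * (C * F (2 ^ n * t))"
        using rvd_scaling_pos[OF t] * by (intro mult_left_mono) auto
      also have "\<dots> = C * (b t * F (2 ^ n * t))" by simp
      also have "\<dots> \<le> C * (\<rho> ^ n * C1)" using tail[OF elim(2)] C by (intro mult_left_mono) auto
      finally show ?case using n elim(1) unfolding dist_real_def x_def by linarith
    qed
  qed
qed

end

section \<open>The rescaled density\<close>

text \<open>The identification with a gauge integral over a compact interval gives access to
  continuity of parameter integrals.\<close>

lemma integral_compact_support:
  fixes g :: "real \<Rightarrow> real"
  assumes g: "continuous_on UNIV g" and supp: "\<And>y. \<bar>y\<bar> > C \<Longrightarrow> g y = 0"
  shows integrable_compact_support: "integrable lborel g"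
    and lborel_integral_compact_support: "(\<integral>y. g y \<partial>lborel) = integral {-C..C} g"
proof -
  have eq: "(\<lambda>y. indicator {-C..C} y * g y) = g" using supp by (force simp: indicator_def)
  have I: "set_integrable lborel {-C..C} g"
    using borel_integrable_atLeastAtMost'[of "-C" C g] continuous_on_subset[OF g] by auto
  then show "integrable lborel g" by (simp add: set_integrable_def eq)
  from set_borel_integral_eq_integral(2)[OF I] show "(\<integral>y. g y \<partial>lborel) = integral {-C..C} g"
    by (simp add: set_lebesgue_integral_def eq)
qed

lemma integral_diff_compact_support:
  fixes g1 g2 :: "real \<Rightarrow> real"
  assumes g: "continuous_on UNIV g1" "continuous_on UNIV g2"
    and supp: "\<And>y. \<bar>y\<bar> > C \<Longrightarrow> g1 y = 0" "\<And>y. \<bar>y\<bar> > C \<Longrightarrow> g2 y = 0"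
    and C: "C \<ge> 0" and close: "\<And>y. \<bar>y\<bar> \<le> C \<Longrightarrow> \<bar>g1 y - g2 y\<bar> \<le> e"
  shows "\<bar>(\<integral>y. g1 y \<partial>lborel) - (\<integral>y. g2 y \<partial>lborel)\<bar> \<le> 2 * C * e"
proof -
  have I: "integrable lborel g1" "integrable lborel g2"
    using integrable_compact_support[OF g(1) supp(1)] integrable_compact_support[OF g(2) supp(2)] by auto
  have "\<bar>(\<integral>y. g1 y \<partial>lborel) - (\<integral>y. g2 y \<partial>lborel)\<bar> = \<bar>\<integral>y. g1 y - g2 y \<partial>lborel\<bar>"
    by (simp add: Bochner_Integration.integral_diff[OF I])
  also have "\<dots> \<le> (\<integral>y. \<bar>g1 y - g2 y\<bar> \<partial>lborel)" by (rule integral_abs_bound)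
  also have "\<dots> \<le> (\<integral>y. e * indicator {-C..C} y \<partial>lborel)"
  proof (rule integral_mono)
    show "integrable lborel (\<lambda>y. e * indicator {-C..C} y)"
      by (intro integrable_mult_right integrable_real_indicator) (auto simp: emeasure_lborel_Icc_eq)
    show "\<bar>g1 y - g2 y\<bar> \<le> e * indicator {-C..C} y" for y
      using supp[of y] close[of y] by (cases "\<bar>y\<bar> \<le> C") (auto simp: indicator_def abs_le_iff)
  qed (use I in auto)
  also have "\<dots> = 2 * C * e" using C by simp
  finally show ?thesis .
qed

context
  fixes q :: ereal and M :: "'w measure" and X :: "'w \<Rightarrow> real^'d" and Z :: "'w \<Rightarrow> real"
    and \<pi> pi_inf :: "(real^'d) \<times> real \<Rightarrow> real" and b :: "real \<Rightarrow> real" and \<alpha> C :: real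
  assumes q: "1 \<le> q" and M: "prob_space M"
    and cont: "continuous_on (- {0}) \<pi>" and nonneg: "\<And>u. u \<noteq> 0 \<Longrightarrow> \<pi> u \<ge> 0"
    and D: "distributed M lborel (\<lambda>w. (X w, Z w)) (\<lambda>u. ennreal (\<pi> u))"
    and rd: "regularly_varying_density q \<alpha> b \<pi> pi_inf"
    and C: "C > 0" and bounded: "AE w in M. \<bar>Z w / lq_norm q (X w)\<bar> \<le> C"
begin

lemmas rvd = q cont nonneg rd

abbreviation (input) far :: "((real^'d) \<times> real) set" where
  "far \<equiv> {u. lq_norm q (fst u) > 1}"

abbreviation (input) quot :: "'w \<Rightarrow> real" where
  "quot w \<equiv> Z w / lq_norm q (X w)"

abbreviation exceed :: "real \<Rightarrow> 'w set" where
  "exceed t \<equiv> {w \<in> space M. lq_norm q (X w) > t}"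

lemma XZ_measurable: "X \<in> borel_measurable M" "Z \<in> borel_measurable M"
proof -
  have cf: "fst \<in> borel_measurable (borel :: ((real^'d) \<times> real) measure)" "snd \<in> borel_measurable (borel :: ((real^'d) \<times> real) measure)"
    by (auto intro!: borel_measurable_continuous_onI continuous_intros)
  have XZ: "(\<lambda>w. (X w, Z w)) \<in> measurable M borel" using distributed_measurable[OF D] by simp
  show "X \<in> borel_measurable M" "Z \<in> borel_measurable M"
    using measurable_compose[OF XZ cf(1)] measurable_compose[OF XZ cf(2)] by simp_all
qed

text \<open>Apart from points with \<open>x = 0\<close>, the law does not charge the open set
  \<open>V\<close> off the cone, so \<open>\<pi>\<close> vanishes almost everywhere on
  \<open>V\<close> and by continuity everywhere. \<open>V\<close> is invariant under positive
  scaling, hence the limit along rays vanishes as well.\<close>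

lemma density_support:
  assumes "\<bar>z\<bar> > C * lq_norm q x"
  shows "\<pi> (x, z) = 0" and "pi_inf (x, z) = 0"
proof -
  interpret prob_space M by (rule M)
  note [measurable] = XZ_measurable rvd_borel[OF rvd]
  define V where "V = {u :: (real^'d) \<times> real. C * lq_norm q (fst u) < \<bar>snd u\<bar>}"
  have V: "open V" unfolding V_def by (intro open_Collect_less continuous_intros continuous_lq_norm_fst q)
  have V0: "u \<noteq> 0" if "u \<in> V" for u using that lq_norm_0[OF q, where 'a="real^'d"] by (auto simp: V_def)
  \<comment> \<open>If \<open>X w = 0\<close>, the quotient is 0 by convention and its bound says
    nothing about \<open>Z w\<close>. Such points are left out; they form a Lebesgue null
    set.\<close>
  have "AE w in M. fst (X w, Z w) \<noteq> 0 \<longrightarrow> (X w, Z w) \<notin> V"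
    using bounded
  proof eventually_elim
    case (elim w)
    show ?case
    proof
      assume "fst (X w, Z w) \<noteq> 0"
      then have "lq_norm q (X w) > 0" using lq_norm_pos[OF _ q] by auto
      with elim show "(X w, Z w) \<notin> V" by (simp add: V_def abs_divide pos_divide_le_eq not_less)
    qed
  qed
  moreover have "Measurable.pred lborel (\<lambda>u. fst u \<noteq> 0 \<longrightarrow> u \<notin> V)"
  proof -
    have "open {u :: (real^'d) \<times> real. fst u \<noteq> 0}" by (intro open_Collect_neq continuous_intros)
    then have "{u :: (real^'d) \<times> real. \<not> (fst u \<noteq> 0 \<longrightarrow> u \<notin> V)} \<in> sets borel"
      using V by (auto simp: Collect_conj_eq)
    then have "{u :: (real^'d) \<times> real. fst u \<noteq> 0 \<longrightarrow> u \<notin> V} \<in> sets borel"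
      using sets.compl_sets[of "{u. \<not> (fst u \<noteq> 0 \<longrightarrow> u \<notin> V)}" borel] by (simp add: set_diff_eq imp_conv_disj)
    then show ?thesis by (simp add: pred_def imp_conv_disj)
  qed
  ultimately have "AE u in lborel. 0 < ennreal (\<pi> u) \<longrightarrow> (fst u \<noteq> 0 \<longrightarrow> u \<notin> V)"
    using distributed_AE2[OF D, of "\<lambda>u. fst u \<noteq> 0 \<longrightarrow> u \<notin> V"] by simp
  with AE_lborel_fst_nonzero have ae: "AE u in lborel. u \<in> V \<longrightarrow> \<pi> u = 0"
  proof eventually_elim
    case (elim u)
    show ?case
    proof
      assume u: "u \<in> V"
      with elim have "\<not> 0 < ennreal (\<pi> u)" by blast
      then have "\<pi> u \<le> 0" by (simp add: not_less)
      with nonneg[OF V0[OF u]] show "\<pi> u = 0" by (rule antisym[rotated])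
    qed
  qed
  have zero: "\<pi> u = 0" if "u \<in> V" for u
    by (rule AE_lborel_open_zero[OF V _ ae that]) (use V0 in \<open>auto intro!: continuous_on_subset[OF cont]\<close>)
  have "(x, z) \<in> V" using assms by (simp add: V_def)
  then show "\<pi> (x, z) = 0" by (rule zero)
  have "\<forall>\<^sub>F t in at_top. t ^ DIM((real^'d) \<times> real) * b t * \<pi> (t *\<^sub>R (x, z)) = 0"
    using eventually_gt_at_top[of 0]
  proof eventually_elim
    case (elim t)
    then have "t * (C * lq_norm q x) < t * \<bar>z\<bar>" using assms by (intro mult_strict_left_mono)
    then have "t *\<^sub>R (x, z) \<in> V" using elim q by (simp add: V_def lq_norm_scaleR abs_mult mult.left_commute)
    then show ?case using zero by simp
  qed
  then have "((\<lambda>t. t ^ DIM((real^'d) \<times> real) * b t * \<pi> (t *\<^sub>R (x, z))) \<longlongrightarrow> 0) at_top"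
    by (rule tendsto_eventually)
  from tendsto_unique[OF _ rvd_tendsto[OF rvd V0[OF \<open>(x, z) \<in> V\<close>]] this] show "pi_inf (x, z) = 0" by simp
qed

text \<open>The axis \<open>x = 0\<close> without the origin lies off the cone, where the limit
  density vanishes.\<close>

lemma limit_density_nonzero: "\<exists>x z. x \<noteq> 0 \<and> pi_inf (x, z) \<noteq> 0"
proof -
  obtain x z where u: "(x, z) \<noteq> 0" "pi_inf (x, z) \<noteq> 0"
    using rd by (auto simp: regularly_varying_density_def)
  have "x \<noteq> 0"
  proof
    assume "x = 0"
    with u(1) have "\<bar>z\<bar> > C * lq_norm q x" using lq_norm_0[OF q, where 'a="real^'d"] by (auto simp: zero_prod_def)
    with density_support(2) u(2) show False by blast
  qed
  with u show ?thesis by blast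
qed

text \<open>These are the three requirements on a test function in
  \<open>rvd_integral_tendsto\<close>; the last one holds because
  \<open>lq_norm q x \<le> lq_norm q (x, z)\<close>.\<close>

lemma superlevel_indicator:
  fixes g :: "(real^'d) \<times> real \<Rightarrow> real"
  assumes "g \<in> borel_measurable borel" "\<And>u. \<bar>g u\<bar> \<le> K"
  shows "(\<lambda>u. indicator far u * g u) \<in> borel_measurable borel"
    and "\<bar>indicator far u * g u\<bar> \<le> K"
    and "lq_norm q u \<le> 1 \<Longrightarrow> indicator far u * g u = 0"
proof -
  have [measurable]: "(\<lambda>u :: (real^'d) \<times> real. lq_norm q (fst u)) \<in> borel_measurable borel"
    by (intro borel_measurable_continuous_onI continuous_lq_norm_fst q)
  show "(\<lambda>u. indicator far u * g u) \<in> borel_measurable borel"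
    using assms(1) by measurable
  show "\<bar>indicator far u * g u\<bar> \<le> K"
    using assms(2)[of u] abs_ge_zero[of "g u"] by (auto simp: indicator_def simp del: abs_ge_zero)
  show "indicator far u * g u = 0" if "lq_norm q u \<le> 1"
    using that lq_norm_fst_le[OF q, of "fst u" "snd u"] by (auto simp: indicator_def)
qed

lemma superlevel_integral:
  fixes g :: "(real^'d) \<times> real \<Rightarrow> real"
  assumes g: "g \<in> borel_measurable borel" "\<And>u. \<bar>g u\<bar> \<le> K"
  shows superlevel_integrable: "integrable lborel (\<lambda>u. indicator far u * g u * pi_inf u)"
    and superlevel_tendsto: "((\<lambda>t. b t * (\<integral>w. indicator (exceed t) w * g ((1 / t) *\<^sub>R (X w, Z w)) \<partial>M))
      \<longlongrightarrow> (\<integral>u. indicator far u * g u * pi_inf u \<partial>lborel)) at_top"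
proof -
  note h = superlevel_indicator[of g K, OF g]
  show "integrable lborel (\<lambda>u. indicator far u * g u * pi_inf u)"
    by (rule rvd_integrable[OF rvd M D h(1,2,3)])
  have 1: "((\<lambda>t. b t * (\<integral>w. indicator far ((1 / t) *\<^sub>R (X w, Z w)) * g ((1 / t) *\<^sub>R (X w, Z w)) \<partial>M))
      \<longlongrightarrow> (\<integral>u. indicator far u * g u * pi_inf u \<partial>lborel)) at_top"
    by (rule rvd_tendsto_integral[OF rvd M D h(1,2,3)])
  have "\<forall>\<^sub>F t in at_top. b t * (\<integral>w. indicator far ((1 / t) *\<^sub>R (X w, Z w)) * g ((1 / t) *\<^sub>R (X w, Z w)) \<partial>M)
     = b t * (\<integral>w. indicator (exceed t) w * g ((1 / t) *\<^sub>R (X w, Z w)) \<partial>M)"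
    using eventually_gt_at_top[of 0]
  proof eventually_elim
    case (elim t)
    then show ?case
      by (intro arg_cong2[where f="(*)"] refl Bochner_Integration.integral_cong)
         (auto simp: indicator_def lq_norm_scaleR[OF q] pos_less_divide_eq)
  qed
  from Lim_transform_eventually[OF 1 this]
  show "((\<lambda>t. b t * (\<integral>w. indicator (exceed t) w * g ((1 / t) *\<^sub>R (X w, Z w)) \<partial>M))
      \<longlongrightarrow> (\<integral>u. indicator far u * g u * pi_inf u \<partial>lborel)) at_top" .
qed

text \<open>The limit of \<open>b t\<close> times the probability of \<open>exceed t\<close>. The
  factor 1 keeps the integrand an instance of \<open>superlevel_integral\<close> with a constant
  test function.\<close>

definition limit_mass :: real where
  "limit_mass = (\<integral>u. indicator far u * 1 * pi_inf u \<partial>lborel)"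

lemma superlevel_limit_density_nonneg: "0 \<le> indicator far u * 1 * pi_inf u"
proof (cases "lq_norm q (fst u) > 1")
  case True
  then have "u \<noteq> 0" using lq_norm_0[OF q, where 'a="real^'d"] by auto
  with rvd_nonneg[OF rvd] show ?thesis by simp
qed simp

text \<open>Otherwise the limit density would vanish almost everywhere, hence by continuity
  everywhere, on the open set \<open>far\<close>, and homogeneity would spread this to all points
  with \<open>x \<noteq> 0\<close>.\<close>

lemma limit_mass_pos: "limit_mass > 0"
proof (rule ccontr)
  have I: "integrable lborel (\<lambda>u. indicator far u * 1 * pi_inf u)"
    by (rule superlevel_integrable[where K=1]) auto
  assume "\<not> limit_mass > 0"
  moreover have "limit_mass \<ge> 0" unfolding limit_mass_def using superlevel_limit_density_nonneg by (intro integral_nonneg_AE) auto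
  ultimately have "(\<integral>u. indicator far u * 1 * pi_inf u \<partial>lborel) = 0" by (simp add: limit_mass_def)
  then have "AE u in lborel. indicator far u * 1 * pi_inf u = 0"
    using integral_nonneg_eq_0_iff_AE[OF I] superlevel_limit_density_nonneg by auto
  then have ae: "AE u in lborel. u \<in> far \<longrightarrow> pi_inf u = 0"
    by eventually_elim (auto simp: indicator_def)
  have op: "open {u :: (real^'d) \<times> real. lq_norm q (fst u) > 1}"
    by (intro open_Collect_less continuous_intros continuous_lq_norm_fst q)
  have c: "continuous_on far pi_inf"
    by (rule continuous_on_subset[OF rvd_continuous[OF rvd]]) (use lq_norm_0[OF q, where 'a="real^'d"] in auto)
  obtain x z where xz: "x \<noteq> 0" "pi_inf (x, z) \<noteq> 0" using limit_density_nonzero by blast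
  then have x: "lq_norm q x > 0" using lq_norm_pos[OF _ q] by auto
  \<comment> \<open>Moves the covariate to norm 2, inside \<open>far\<close>.\<close>
  define s where "s = 2 / lq_norm q x"
  have s: "s > 0" using x by (simp add: s_def)
  have "s *\<^sub>R (x, z) \<in> far" using x s q by (simp add: lq_norm_scaleR s_def)
  from AE_lborel_open_zero[OF op c ae this] have "pi_inf (s *\<^sub>R (x, z)) = 0" .
  moreover have "(x, z) \<noteq> 0" using xz by (auto simp: zero_prod_def)
  ultimately show False using rvd_homogeneous[OF rvd s, of "(x, z)"] xz s by simp
qed

section \<open>Tail of the covariate\<close>

definition covariate_tail :: "real \<Rightarrow> real" where
  "covariate_tail t = measure M (exceed t)"

lemma covariate_tail_tendsto: "((\<lambda>t. b t * covariate_tail t) \<longlongrightarrow> limit_mass) at_top"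
proof -
  interpret prob_space M by (rule M)
  note [measurable] = XZ_measurable
  have "(exceed t) \<in> sets M" for t using q by measurable
  then show ?thesis
    using superlevel_tendsto[of "\<lambda>_. 1" 1] by (simp add: limit_mass_def covariate_tail_def)
qed

lemma covariate_tail_ratio:
  assumes s: "s > 0"
  shows "((\<lambda>t. covariate_tail (t * s) / covariate_tail t) \<longlongrightarrow> s powr (-\<alpha>)) at_top"
proof -
  have lim: "filterlim (\<lambda>t. t * s) at_top at_top" using s by real_asymp
  have "((\<lambda>t. inverse (b (t * s) / b t) * (b (t * s) * covariate_tail (t * s)) / (b t * covariate_tail t)) \<longlongrightarrow> inverse (s powr \<alpha>) * limit_mass / limit_mass) at_top"
    using s limit_mass_pos
    by (intro tendsto_intros rvd_scaling_ratio[OF rvd] filterlim_compose[OF covariate_tail_tendsto lim] covariate_tail_tendsto) auto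
  moreover have "\<forall>\<^sub>F t in at_top. inverse (b (t * s) / b t) * (b (t * s) * covariate_tail (t * s)) / (b t * covariate_tail t) = covariate_tail (t * s) / covariate_tail t"
    using eventually_gt_at_top[of 0]
  proof eventually_elim
    case (elim t)
    have "b (t * s) > 0" "b t > 0" using elim s by (auto intro!: rvd_scaling_pos[OF rvd])
    then show ?case by simp
  qed
  ultimately have "((\<lambda>t. covariate_tail (t * s) / covariate_tail t) \<longlongrightarrow> inverse (s powr \<alpha>) * limit_mass / limit_mass) at_top"
    by (rule Lim_transform_eventually)
  then show ?thesis using limit_mass_pos by (simp add: powr_minus)
qed

text \<open>The function \<open>b\<close> need be neither monotone nor measurable; it is compared with the reciprocal of the
  monotone tail of the covariate.\<close>

lemma scaling_almost_increasing: "\<exists>t0>0. \<forall>t\<ge>t0. \<forall>s\<ge>1. b t \<le> 4 * b (t * s)"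
proof -
  interpret prob_space M by (rule M)
  note [measurable] = XZ_measurable
  have set: "(exceed t) \<in> sets M" for t using q by measurable
  note c = limit_mass_pos
  have "\<forall>\<^sub>F t in at_top. limit_mass / 2 < b t * covariate_tail t" by (rule order_tendstoD(1)[OF covariate_tail_tendsto]) (use c in simp)
  moreover have "\<forall>\<^sub>F t in at_top. b t * covariate_tail t < 2 * limit_mass" by (rule order_tendstoD(2)[OF covariate_tail_tendsto]) (use c in simp)
  ultimately have "\<forall>\<^sub>F t in at_top. limit_mass / 2 < b t * covariate_tail t \<and> b t * covariate_tail t < 2 * limit_mass" by (rule eventually_conj)
  then obtain t1 where t1: "\<And>t. t \<ge> t1 \<Longrightarrow> limit_mass / 2 < b t * covariate_tail t \<and> b t * covariate_tail t < 2 * limit_mass"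
    unfolding eventually_at_top_linorder by blast
  have "b t \<le> 4 * b (t * s)" if t: "t \<ge> max 1 t1" and s: "s \<ge> 1" for t s
  proof -
    have ts: "t \<le> t * s" using mult_left_mono[of 1 s t] t s by simp
    have bt: "b (t * s) > 0" "b t > 0" using t s by (auto intro!: rvd_scaling_pos[OF rvd] mult_pos_pos)
    have "covariate_tail (t * s) \<le> covariate_tail t" unfolding covariate_tail_def using set ts by (intro finite_measure_mono) auto
    then have m: "b (t * s) * covariate_tail (t * s) \<le> b (t * s) * covariate_tail t" using bt by (intro mult_left_mono) auto
    have t': "t1 \<le> t" using t by simp
    \<comment> \<open>The factor 4 is the quotient of the bounds \<open>2 * limit_mass\<close> and
      \<open>limit_mass / 2\<close>.\<close>
    from t1[OF t'] t1[OF order_trans[OF t' ts]] m have "b t * covariate_tail t \<le> 4 * b (t * s) * covariate_tail t" by linarith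
    moreover have "b t * covariate_tail t > 0" using t1[of t] t c by auto
    then have "covariate_tail t > 0" using bt by (simp add: zero_less_mult_iff)
    ultimately show ?thesis by simp
  qed
  then show ?thesis by (intro exI[of _ "max 1 t1"]) auto
qed

text \<open>Effect of \<open>phi q\<close> on a density, with the Jacobian in front; used for
  \<open>\<pi>\<close> and \<open>pi_inf\<close> alike. At \<open>fst u = 0\<close> it is 0 whatever
  the value of \<open>f\<close>.\<close>

definition rescaled :: "((real^'d) \<times> real \<Rightarrow> real) \<Rightarrow> (real^'d) \<times> real \<Rightarrow> real" where
  "rescaled f u = lq_norm q (fst u) * f (fst u, lq_norm q (fst u) * snd u)"

lemma continuous_on_rescaled:
  assumes "continuous_on (- {0}) f"
  shows "continuous_on {u. fst u \<noteq> 0} (rescaled f)"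
proof -
  have c: "continuous_on {u. fst u \<noteq> 0} (\<lambda>u :: (real^'d) \<times> real. lq_norm q (fst u))"
    by (rule continuous_on_subset[OF continuous_lq_norm_fst[OF q]]) simp
  show ?thesis unfolding rescaled_def[abs_def]
    by (intro continuous_intros c continuous_on_compose2[OF assms]) (auto simp: zero_prod_def)
qed

lemma rescaled_nonneg:
  assumes "\<And>u. u \<noteq> 0 \<Longrightarrow> f u \<ge> 0"
  shows "rescaled f u \<ge> 0"
proof (cases "fst u = 0")
  case False
  then show ?thesis using assms by (auto simp: rescaled_def zero_prod_def)
qed (simp add: rescaled_def lq_norm_0[OF q])

lemma rescaled_support:
  assumes "\<And>x z. \<bar>z\<bar> > C * lq_norm q x \<Longrightarrow> f (x, z) = 0" and "\<bar>y\<bar> > C"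
  shows "rescaled f (x, y) = 0"
proof (cases "x = 0")
  case False
  then have x: "lq_norm q x > 0" by (rule lq_norm_pos[OF _ q])
  then have "C * lq_norm q x < \<bar>lq_norm q x * y\<bar>" using assms(2) by (simp add: abs_mult mult.commute)
  then show ?thesis using assms(1) by (simp add: rescaled_def)
qed (simp add: rescaled_def lq_norm_0[OF q])

lemma rescaled_section_continuous:
  assumes "continuous_on (- {0}) f"
  shows "continuous_on UNIV (\<lambda>y. rescaled f (x, y))"
proof (cases "x = 0")
  case True
  then show ?thesis by (simp add: rescaled_def lq_norm_0[OF q])
next
  case False
  then show ?thesis by (intro continuous_on_compose2[OF continuous_on_rescaled[OF assms]] continuous_intros) auto
qed

text \<open>The factor does not depend on \<open>y\<close>, so it cancels in the regression
  function; it is positive, so positivity of the section integrals on the unit sphere spreads to all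
  \<open>x \<noteq> 0\<close>.\<close>

lemma rescaled_pi_inf_scaleR:
  assumes s: "s > 0" and x: "x \<noteq> 0"
  shows "rescaled pi_inf (s *\<^sub>R x, y) = s * (s powr (-\<alpha>) / s ^ DIM((real^'d) \<times> real)) * rescaled pi_inf (x, y)"
proof -
  have eq: "s *\<^sub>R (x, lq_norm q x * y) = (s *\<^sub>R x, lq_norm q (s *\<^sub>R x) * y)" using s q by (simp add: lq_norm_scaleR)
  have "(x, lq_norm q x * y) \<noteq> 0" using x by (simp add: zero_prod_def)
  from rvd_homogeneous[OF rvd s this] have "pi_inf (s *\<^sub>R x, lq_norm q (s *\<^sub>R x) * y) = s powr (-\<alpha>) / s ^ DIM((real^'d) \<times> real) * pi_inf (x, lq_norm q x * y)"
    unfolding eq .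
  then show ?thesis using s by (simp add: rescaled_def lq_norm_scaleR[OF q])
qed

text \<open>
  The factor \<open>lq_norm q x\<close> in the rescaled density is unbounded, so the uniform convergence of the
  scaled \<open>\<pi>\<close> is only used for \<open>lq_norm q u \<le> R\<close>. Beyond \<open>R\<close> both densities are, after multiplication by that
  factor, at most a constant times \<open>1 / lq_norm q u\<close>, since the dimension is at least two.
\<close>

lemma rescaled_uniform:
  assumes e: "e > 0"
  shows "\<forall>\<^sub>F t in at_top. \<forall>x y. lq_norm q x \<ge> 1 \<longrightarrow> \<bar>b t * t ^ CARD('d) * rescaled \<pi> (t *\<^sub>R x, y) - rescaled pi_inf (x, y)\<bar> \<le> e"
proof -
  let ?m = "DIM((real^'d) \<times> real)"
  obtain t0 where t0: "t0 > 0" "\<And>t s. t \<ge> t0 \<Longrightarrow> s \<ge> 1 \<Longrightarrow> b t \<le> 4 * b (t * s)"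
    using scaling_almost_increasing by blast
  obtain K where K: "K \<ge> 0" and K': "\<And>u. lq_norm q u \<ge> 1 \<Longrightarrow> pi_inf u \<le> K * lq_norm q u powr (-\<alpha>) / lq_norm q u ^ ?m"
    using rvd_bounded[OF rvd] by blast
  have Kb: "pi_inf u \<le> K / lq_norm q u ^ ?m" if u: "lq_norm q u \<ge> 1" for u
  proof -
    have "lq_norm q u powr (-\<alpha>) \<le> 1" using u rvd_index_pos[OF rvd]
      by (simp add: powr_minus inverse_le_1_iff ge_one_powr_ge_zero)
    then have "K * lq_norm q u powr (-\<alpha>) / lq_norm q u ^ ?m \<le> K * 1 / lq_norm q u ^ ?m"
      using K u by (intro divide_right_mono mult_left_mono) auto
    with K'[OF u] show ?thesis by simp
  qed
  obtain t1 where t1: "\<And>t u. t \<ge> t1 \<Longrightarrow> lq_norm q u \<ge> 1 \<Longrightarrow> \<bar>t ^ ?m * b t * \<pi> (t *\<^sub>R u) - pi_inf u\<bar> \<le> 1"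
    using rvd_uniform[OF rvd zero_less_one] unfolding eventually_at_top_linorder by blast
  \<comment> \<open>\<open>5 * K + 4\<close> is \<open>4 * (K + 1)\<close>, from the scaled density,
    plus \<open>K\<close>, from the limit density; beyond \<open>R\<close> this constant divided by
    the norm is at most \<open>e\<close>.\<close>
  define R where "R = max 1 ((5 * K + 4) / e)"
  have R: "R \<ge> 1" "5 * K + 4 \<le> R * e" using e by (auto simp: R_def field_simps max_def)
  have eR: "e / R > 0" using e R by simp
  have "\<forall>\<^sub>F t in at_top. \<forall>u. lq_norm q u \<ge> 1 \<longrightarrow> \<bar>t ^ ?m * b t * \<pi> (t *\<^sub>R u) - pi_inf u\<bar> \<le> e / R"
    by (rule rvd_uniform[OF rvd eR])
  then show ?thesis using eventually_ge_at_top[of "max t0 t1"]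
  proof eventually_elim
    case (elim t)
    have t: "t > 0" using elim t0 by auto
    show ?case
    proof (intro allI impI)
      fix x :: "real^'d" and y :: real
      assume x: "lq_norm q x \<ge> 1"
      define u where "u = (x, lq_norm q x * y)"
      define s where "s = lq_norm q u"
      define A where "A = t ^ ?m * b t * \<pi> (t *\<^sub>R u)"
      have xs: "lq_norm q x \<le> s" unfolding s_def u_def by (rule lq_norm_fst_le[OF q])
      with x have s: "s \<ge> 1" by linarith
      have u0: "u \<noteq> 0" using s q by (auto simp: s_def lq_norm_0)
      have lhs: "b t * t ^ CARD('d) * rescaled \<pi> (t *\<^sub>R x, y) = lq_norm q x * A"
        using t by (simp add: rescaled_def A_def u_def lq_norm_scaleR[OF q] mult.assoc)
      have rhs: "rescaled pi_inf (x, y) = lq_norm q x * pi_inf u" by (simp add: rescaled_def u_def)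
      have diff: "\<bar>b t * t ^ CARD('d) * rescaled \<pi> (t *\<^sub>R x, y) - rescaled pi_inf (x, y)\<bar> = lq_norm q x * \<bar>A - pi_inf u\<bar>"
        unfolding lhs rhs right_diff_distrib[symmetric] abs_mult by simp
      show "\<bar>b t * t ^ CARD('d) * rescaled \<pi> (t *\<^sub>R x, y) - rescaled pi_inf (x, y)\<bar> \<le> e"
      proof (cases "s \<le> R")
        case True
        have "\<bar>A - pi_inf u\<bar> \<le> e / R" unfolding A_def by (rule elim(1)[rule_format]) (use s in \<open>simp add: s_def\<close>)
        then have "lq_norm q x * \<bar>A - pi_inf u\<bar> \<le> R * (e / R)" using xs True x by (intro mult_mono) auto
        with R show ?thesis unfolding diff by simp
      next
        case False
        \<comment> \<open>The density at the far point is read off on the unit sphere at the larger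
          scale \<open>t * s\<close>, where it is within 1 of a value of at most \<open>K\<close>;
          returning to the scale \<open>t\<close> costs the factor 4.\<close>
        define dir where "dir = (1 / s) *\<^sub>R u"
        have dir: "lq_norm q dir = 1" using s by (simp add: dir_def lq_norm_scaleR[OF q] s_def)
        have uw: "t *\<^sub>R u = (t * s) *\<^sub>R dir" using s by (simp add: dir_def)
        \<comment> \<open>The dimension \<open>?m\<close> is at least 2: one power of
          \<open>s\<close> absorbs the Jacobian, the other gives the decay.\<close>
        have sm: "s * s \<le> s ^ ?m"
        proof -
          have "s ^ 2 \<le> s ^ ?m" using s by (intro power_increasing) (auto simp: Suc_le_eq)
          then show ?thesis by (simp add: power2_eq_square)
        qed
        have bts: "b (t * s) > 0" using t s by (intro rvd_scaling_pos[OF rvd]) auto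
        have "t \<le> t * s" using mult_left_mono[of 1 s t] t s by simp
        then have "\<bar>(t * s) ^ ?m * b (t * s) * \<pi> ((t * s) *\<^sub>R dir) - pi_inf dir\<bar> \<le> 1" using elim dir by (intro t1) auto
        moreover have "pi_inf dir \<le> K" using Kb[of dir] dir by simp
        ultimately have B: "(t * s) ^ ?m * b (t * s) * \<pi> ((t * s) *\<^sub>R dir) \<le> K + 1" by linarith
        have \<pi>0: "\<pi> (t *\<^sub>R u) \<ge> 0" using t u0 by (intro nonneg) auto
        have bt: "b t > 0" using t rvd_scaling_pos[OF rvd] by blast
        have "s ^ ?m * A = t ^ ?m * s ^ ?m * \<pi> (t *\<^sub>R u) * b t" by (simp add: A_def)
        also have "\<dots> \<le> t ^ ?m * s ^ ?m * \<pi> (t *\<^sub>R u) * (4 * b (t * s))"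
          using t0(2)[of t s] elim s t \<pi>0 by (intro mult_left_mono) auto
        also have "\<dots> = 4 * ((t * s) ^ ?m * b (t * s) * \<pi> ((t * s) *\<^sub>R dir))" unfolding uw by (simp add: power_mult_distrib)
        also have "\<dots> \<le> 4 * (K + 1)" using B by simp
        finally have sA: "s ^ ?m * A \<le> 4 * (K + 1)" .
        have A0: "A \<ge> 0" unfolding A_def using t bt \<pi>0 by simp
        have pi0: "pi_inf u \<ge> 0" using rvd_nonneg[OF rvd u0] .
        have "s ^ ?m * pi_inf u \<le> K" using Kb[of u] s by (simp add: s_def[symmetric] field_simps)
        then have sum: "s ^ ?m * (A + pi_inf u) \<le> 5 * K + 4" using sA by (simp add: distrib_left)
        have "s * (s * (A + pi_inf u)) \<le> s ^ ?m * (A + pi_inf u)"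
          using sm A0 pi0 by (simp only: mult.assoc[symmetric]) (intro mult_right_mono, auto)
        also have "\<dots> \<le> R * e" using sum R by linarith
        also have "\<dots> \<le> s * e" using False e by (intro mult_right_mono) auto
        finally have "s * (A + pi_inf u) \<le> e" using s by simp
        moreover have "lq_norm q x * \<bar>A - pi_inf u\<bar> \<le> s * (A + pi_inf u)"
          using xs A0 pi0 x by (intro mult_mono) auto
        ultimately show ?thesis unfolding diff by linarith
      qed
    qed
  qed
qed

section \<open>The limit law of the rescaled pair\<close>

definition limit_law :: "((real^'d) \<times> real) measure" where
  "limit_law = density lborel (\<lambda>u. ennreal (indicator far u * rescaled pi_inf u / limit_mass))"

text \<open>Let \<open>M'\<close> have the density \<open>pi_inf / limit_mass\<close> on
  \<open>far\<close>. Its image under \<open>phi q\<close> has the stated density by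
  \<open>distributed_rescale\<close>, and the integral formula is the change of variables. The map
  \<open>(fst u, snd u)\<close> is the identity, written in the form that
  \<open>regression_function_of_density\<close> expects.\<close>

lemma limit_law:
  shows limit_law_prob_space: "prob_space limit_law"
    and limit_law_distributed: "distributed limit_law lborel (\<lambda>u. (fst u, snd u))
      (\<lambda>u. ennreal (indicator far u * rescaled pi_inf u / limit_mass))"
    and limit_law_integral: "\<And>g. g \<in> borel_measurable borel \<Longrightarrow>
      (\<integral>u. g u \<partial>limit_law) = (\<integral>u. indicator far u * g (phi q u) * pi_inf u \<partial>lborel) / limit_mass"
proof -
  define f where "f u = indicator far u * 1 * pi_inf u / limit_mass" for u
  have f0: "f u \<ge> 0" for u
    unfolding f_def using superlevel_limit_density_nonneg[of u] limit_mass_pos by (intro divide_nonneg_pos)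
  have fI: "integrable lborel f" unfolding f_def[abs_def]
    by (intro integrable_divide superlevel_integrable[where K=1]) auto
  have f1: "(\<integral>u. f u \<partial>lborel) = 1"
    using limit_mass_pos by (simp add: f_def[abs_def] limit_mass_def[symmetric, unfolded mult_1_right])
  have fm [measurable]: "f \<in> borel_measurable borel" using borel_measurable_integrable[OF fI] by simp
  define M' where "M' = density lborel (\<lambda>u. ennreal (f u))"
  have "prob_space M'"
  proof (rule prob_spaceI)
    have "emeasure M' (space M') = (\<integral>\<^sup>+u. ennreal (f u) \<partial>lborel)"
      unfolding M'_def by (subst emeasure_density) (auto intro!: nn_integral_cong)
    also have "\<dots> = 1" using nn_integral_eq_integral[OF fI] f0 f1 by simp
    finally show "emeasure M' (space M') = 1" .
  qed
  then interpret M': prob_space M' .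
  have D': "distributed M' lborel (\<lambda>u. (fst u, snd u)) (\<lambda>u. ennreal (f u))"
    unfolding distributed_def by (auto simp: M'_def intro!: distr_id2)
  define p where "p u = indicator far u * rescaled pi_inf u / limit_mass" for u
  have "(\<lambda>u. ennreal (lq_norm q (fst u) * f (fst u, lq_norm q (fst u) * snd u))) = (\<lambda>u. ennreal (p u))"
    by (auto simp: f_def p_def rescaled_def indicator_def)
  with distributed_rescale[OF q D'] have D'': "distributed M' lborel (phi q) (\<lambda>u. ennreal (p u))"
    by (simp add: phi_def case_prod_beta')
  have law: "limit_law = density lborel (\<lambda>u. ennreal (p u))" by (simp add: limit_law_def p_def)
  have law': "limit_law = distr M' lborel (phi q)"
    unfolding law using distributed_distr_eq_density[OF D''] by simp
  show "prob_space limit_law" unfolding law' by (rule M'.prob_space_distr) (use distributed_measurable[OF D''] in simp)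
  have pm: "(\<lambda>u. ennreal (p u)) \<in> borel_measurable lborel" using distributed_borel_measurable[OF D''] .
  show "distributed limit_law lborel (\<lambda>u. (fst u, snd u)) (\<lambda>u. ennreal (indicator far u * rescaled pi_inf u / limit_mass))"
    unfolding distributed_def p_def[symmetric] using pm by (auto simp: law intro!: distr_id2)
  fix g :: "(real^'d) \<times> real \<Rightarrow> real" assume [measurable]: "g \<in> borel_measurable borel"
  have [measurable]: "phi q \<in> borel_measurable (borel :: ((real^'d) \<times> real) measure)" by (rule borel_measurable_phi[OF q])
  have "(\<integral>u. g u \<partial>limit_law) = (\<integral>u. g (phi q u) \<partial>M')"
    unfolding law' by (rule integral_distr) (auto simp: M'_def)
  also have "\<dots> = (\<integral>u. f u * g (phi q u) \<partial>lborel)"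
    unfolding M'_def by (rule integral_real_density) (use f0 in auto)
  also have "\<dots> = (\<integral>u. indicator far u * g (phi q u) * pi_inf u / limit_mass \<partial>lborel)"
    by (intro Bochner_Integration.integral_cong) (auto simp: f_def)
  finally show "(\<integral>u. g u \<partial>limit_law) = (\<integral>u. indicator far u * g (phi q u) * pi_inf u \<partial>lborel) / limit_mass"
    by simp
qed

lemma limit_law_superlevel: "AE u in limit_law. lq_norm q (fst u) > 1"
proof -
  have "(\<lambda>u. ennreal (indicator far u * rescaled pi_inf u / limit_mass)) \<in> borel_measurable lborel"
    by (rule distributed_borel_measurable[OF limit_law_distributed])
  then show ?thesis unfolding limit_law_def by (subst AE_density) (auto simp: indicator_def)
qed

lemma limit_law_cond_RV: "cond_RV q M X quot limit_law"
proof -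
  interpret prob_space M by (rule M)
  note [measurable] = XZ_measurable
  have set [measurable]: "(exceed t) \<in> sets M" for t using q by measurable
  have Ym [measurable]: "quot \<in> borel_measurable M" using q by measurable
  have "weak_limit (\<lambda>t. cond_law M (exceed t) (\<lambda>w. ((1 / t) *\<^sub>R X w, quot w))) limit_law at_top"
  proof (rule weak_limit_cond_lawI[OF M set _ limit_mass_pos])
    show "((\<lambda>t. b t * prob (exceed t)) \<longlongrightarrow> limit_mass) at_top"
      using covariate_tail_tendsto by (simp add: covariate_tail_def)
    show "\<forall>\<^sub>F t in at_top. 0 < b t"
      using eventually_gt_at_top[of 0] by eventually_elim (use rvd_scaling_pos[OF rvd] in blast)
    fix g :: "(real^'d) \<times> real \<Rightarrow> real" and K assume g: "continuous_on UNIV g" and K: "\<And>u. \<bar>g u\<bar> \<le> K"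
    have gm [measurable]: "g \<in> borel_measurable borel" using g by (rule borel_measurable_continuous_onI)
    have [measurable]: "phi q \<in> borel_measurable (borel :: ((real^'d) \<times> real) measure)" by (rule borel_measurable_phi[OF q])
    \<comment> \<open>Here the limit holds for bounded Borel functions, so \<open>phi q\<close> may
      be inserted despite its discontinuity at \<open>x = 0\<close>.\<close>
    have 1: "((\<lambda>t. b t * (\<integral>w. indicator (exceed t) w * g (phi q ((1 / t) *\<^sub>R (X w, Z w))) \<partial>M))
      \<longlongrightarrow> limit_mass * (\<integral>u. g u \<partial>limit_law)) at_top"
      using superlevel_tendsto[of "\<lambda>u. g (phi q u)" K] K limit_mass_pos by (simp add: limit_law_integral[OF gm])
    show "((\<lambda>t. b t * (\<integral>w. indicator (exceed t) w * g ((1 / t) *\<^sub>R X w, quot w) \<partial>M))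
      \<longlongrightarrow> limit_mass * (\<integral>u. g u \<partial>limit_law)) at_top"
      by (rule Lim_transform_eventually[OF 1], use eventually_gt_at_top[of 0] in eventually_elim)
        (simp add: phi_def lq_norm_scaleR[OF q])
  qed measurable
  moreover have "sets limit_law = sets borel" by (simp add: limit_law_def)
  ultimately show ?thesis
    unfolding cond_RV_def using rvd_index_pos[OF rvd] covariate_tail_ratio limit_law_prob_space limit_law_superlevel
    by (auto simp: covariate_tail_def)
qed

section \<open>Regression functions and condition (C)\<close>

definition density_regression :: "((real^'d) \<times> real \<Rightarrow> real) \<Rightarrow> real^'d \<Rightarrow> real" where
  "density_regression p x = (\<integral>y. y * p (x, y) \<partial>lborel) / (\<integral>y. p (x, y) \<partial>lborel)"

lemma rescaled_pi_inf_sections: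
  shows rescaled_pi_support: "\<bar>y\<bar> > C \<Longrightarrow> rescaled \<pi> (x, y) = 0"
    and rescaled_pi_inf_support: "\<bar>y\<bar> > C \<Longrightarrow> rescaled pi_inf (x, y) = 0"
    and rescaled_pi_nonneg: "rescaled \<pi> u \<ge> 0" and rescaled_pi_inf_nonneg: "rescaled pi_inf u \<ge> 0"
  using rescaled_support density_support rescaled_nonneg[of \<pi>, OF nonneg] rescaled_nonneg[of pi_inf, OF rvd_nonneg[OF rvd]]
  by (metis, metis, simp, metis)

text \<open>The quotient ignores the normalisation of the section. This removes
  \<open>limit_mass\<close> and the indicator from the limit law and yields the angular form by
  homogeneity.\<close>

lemma density_regression_scaled:
  assumes "c \<noteq> 0" "\<And>y. p' (x', y) = c * p (x, y)"
  shows "density_regression p' x' = density_regression p x"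
  using assms by (simp add: density_regression_def mult.left_commute[of _ c])

text \<open>The version chosen for the limit regression function is the quotient formed with
  \<open>rescaled pi_inf\<close>, without the restriction to \<open>far\<close>: it makes sense at
  every \<open>x \<noteq> 0\<close>, is continuous there and depends only on the angle.\<close>

lemma cond_C_of_lower_bound:
  assumes inf: "(INF w\<in>{w. lq_norm q w = 1}. \<integral>y. pi_inf (w, y) \<partial>lborel) > 0"
  shows "cond_C q M X quot limit_law"
proof -
  interpret prob_space M by (rule M)
  note [measurable] = XZ_measurable
  note sp = rescaled_pi_support and si = rescaled_pi_inf_support
  note cp = rescaled_section_continuous[OF cont] and ci = rescaled_section_continuous[OF rvd_continuous[OF rvd]]
  define \<kappa> where "\<kappa> = (INF w\<in>{w::real^'d. lq_norm q w = 1}. \<integral>y. pi_inf (w, y) \<partial>lborel)"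
  have \<kappa>: "\<kappa> > 0" using inf by (simp add: \<kappa>_def)
  define di where "di x = (\<integral>y. rescaled pi_inf (x, y) \<partial>lborel)" for x
  define ni where "ni x = (\<integral>y. y * rescaled pi_inf (x, y) \<partial>lborel)" for x
  define dt where "dt x = (\<integral>y. rescaled \<pi> (x, y) \<partial>lborel)" for x
  define nt where "nt x = (\<integral>y. y * rescaled \<pi> (x, y) \<partial>lborel)" for x
  have yi: "continuous_on UNIV (\<lambda>y. y * rescaled pi_inf (x, y))" "\<And>y. \<bar>y\<bar> > C \<Longrightarrow> y * rescaled pi_inf (x, y) = 0" for x
    using si by (auto intro!: continuous_intros ci)
  \<comment> \<open>On the unit sphere the Jacobian is 1, so the section integral of the rescaled
    limit density is the marginal density of the hypothesis.\<close>
  have di_sphere: "di x \<ge> \<kappa>" if x: "lq_norm q x = 1" for x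
  proof -
    have "bdd_below ((\<lambda>w. \<integral>y. pi_inf (w, y) \<partial>lborel) ` {w::real^'d. lq_norm q w = 1})"
    proof (rule bdd_belowI[of _ 0])
      fix v assume "v \<in> (\<lambda>w. \<integral>y. pi_inf (w, y) \<partial>lborel) ` {w::real^'d. lq_norm q w = 1}"
      then obtain w :: "real^'d" where vw: "lq_norm q w = 1" "v = (\<integral>y. pi_inf (w, y) \<partial>lborel)" by auto
      then have "w \<noteq> 0" using lq_norm_0[OF q, where 'a="real^'d"] by auto
      then have "pi_inf (w, y) \<ge> 0" for y using rvd_nonneg[OF rvd, of "(w, y)"] by (auto simp: zero_prod_def)
      then show "0 \<le> v" unfolding vw by (intro integral_nonneg_AE) auto
    qed
    then have "\<kappa> \<le> (\<integral>y. pi_inf (x, y) \<partial>lborel)" unfolding \<kappa>_def using x by (intro cINF_lower) auto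
    then show ?thesis using x by (simp add: di_def rescaled_def)
  qed
  have scale: "density_regression (rescaled pi_inf) (s *\<^sub>R x) = density_regression (rescaled pi_inf) x" if "s > 0" "x \<noteq> 0" for s x
    using that rescaled_pi_inf_scaleR[OF that] by (intro density_regression_scaled[of "s * (s powr (-\<alpha>) / s ^ DIM((real^'d) \<times> real))"]) auto
  have unit: "lq_norm q ((1 / lq_norm q x) *\<^sub>R x) = 1" if "x \<noteq> 0" for x :: "real^'d"
    using lq_norm_pos[OF that q] by (simp add: lq_norm_scaleR[OF q])
  have angular: "density_regression (rescaled pi_inf) x = density_regression (rescaled pi_inf) ((1 / lq_norm q x) *\<^sub>R x)" if "x \<noteq> 0" for x
    using scale[of "1 / lq_norm q x" x] lq_norm_pos[OF that q] that by simp
  have di_pos: "di x > 0" if x: "x \<noteq> 0" for x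
  proof -
    define s where "s = lq_norm q x"
    have s: "s > 0" unfolding s_def by (rule lq_norm_pos[OF x q])
    define dir where "dir = (1 / s) *\<^sub>R x"
    have dir: "lq_norm q dir = 1" "dir \<noteq> 0" using unit[OF x] s x by (auto simp: dir_def s_def)
    have xw: "x = s *\<^sub>R dir" using s by (simp add: dir_def)
    have "di x = s * (s powr (-\<alpha>) / s ^ DIM((real^'d) \<times> real)) * di dir"
      unfolding di_def xw rescaled_pi_inf_scaleR[OF s dir(2)] by (rule integral_mult_right_zero)
    moreover have "di dir > 0" using di_sphere[OF dir(1)] \<kappa> by linarith
    ultimately show ?thesis using s by simp
  qed
  have ni_di: "\<bar>ni x\<bar> \<le> C * di x" for x
  proof -
    have "\<bar>ni x\<bar> \<le> (\<integral>y. \<bar>y * rescaled pi_inf (x, y)\<bar> \<partial>lborel)" unfolding ni_def by (rule integral_abs_bound)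
    also have "\<dots> \<le> (\<integral>y. C * rescaled pi_inf (x, y) \<partial>lborel)"
    proof (rule integral_mono)
      show "integrable lborel (\<lambda>y. \<bar>y * rescaled pi_inf (x, y)\<bar>)"
        using integrable_compact_support[OF yi] by (rule integrable_abs)
      show "integrable lborel (\<lambda>y. C * rescaled pi_inf (x, y))"
        using integrable_compact_support[OF ci si] by (rule integrable_mult_right)
      show "\<bar>y * rescaled pi_inf (x, y)\<bar> \<le> C * rescaled pi_inf (x, y)" for y
        using si[of y x] rescaled_pi_inf_nonneg[of "(x, y)"] by (cases "\<bar>y\<bar> > C") (auto simp: abs_mult intro!: mult_right_mono)
    qed
    finally show ?thesis by (simp add: di_def)
  qed
  \<comment> \<open>Parameter integrals over the fixed interval \<open>cbox (- C) C\<close> are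
    continuous, and they equal the section integrals because the sections vanish outside it.\<close>
  have cr: "continuous_on ((- {0}) \<times> cbox (- C) C) (\<lambda>(x, y). rescaled pi_inf (x, y))"
    by (auto intro!: continuous_on_subset[OF continuous_on_rescaled[OF rvd_continuous[OF rvd]]])
  have "continuous_on (- {0}) (\<lambda>x. integral (cbox (- C) C) (\<lambda>y. rescaled pi_inf (x, y)))"
    using cr by (rule integral_continuous_on_param)
  then have cdi: "continuous_on (- {0}) di"
    by (rule continuous_on_eq) (simp add: di_def lborel_integral_compact_support[OF ci si])
  have "continuous_on ((- {0}) \<times> cbox (- C) C) (\<lambda>(x, y). y * rescaled pi_inf (x, y))"
    using cr unfolding case_prod_beta' by (intro continuous_intros) auto
  then have "continuous_on (- {0}) (\<lambda>x. integral (cbox (- C) C) (\<lambda>y. y * rescaled pi_inf (x, y)))"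
    by (rule integral_continuous_on_param)
  then have cni: "continuous_on (- {0}) ni"
    by (rule continuous_on_eq) (simp add: ni_def lborel_integral_compact_support[OF yi])
  have regression_eq: "density_regression (rescaled pi_inf) = (\<lambda>x. ni x / di x)" "density_regression (rescaled \<pi>) = (\<lambda>x. nt x / dt x)"
    by (auto simp: density_regression_def ni_def di_def nt_def dt_def)
  have cont_reg: "continuous_on (- {0}) (density_regression (rescaled pi_inf))"
    unfolding regression_eq using di_pos by (intro continuous_intros cni cdi) (auto simp: less_imp_neq[symmetric])
  have regP: "regression_function limit_law fst snd (density_regression (rescaled pi_inf))"
  proof -
    let ?p = "\<lambda>u. indicator far u * rescaled pi_inf u / limit_mass"
    have p0: "?p u \<ge> 0" for u using rescaled_pi_inf_nonneg limit_mass_pos by simp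
    have "regression_function limit_law (\<lambda>u. fst u) (\<lambda>u. snd u) (\<lambda>x. (\<integral>y. y * ?p (x, y) \<partial>lborel) / (\<integral>y. ?p (x, y) \<partial>lborel))"
      by (rule regression_function_of_density[OF limit_law_prob_space limit_law_distributed p0]) (use si C in auto)
    then have r: "integrable limit_law snd" "AE u in limit_law. density_regression ?p (fst u) = real_cond_exp limit_law (vimage_algebra (space limit_law) fst borel) snd u"
      by (auto simp: regression_function_def density_regression_def)
    have "AE u in limit_law. density_regression (rescaled pi_inf) (fst u) = real_cond_exp limit_law (vimage_algebra (space limit_law) fst borel) snd u"
      using r(2) limit_law_superlevel
    proof eventually_elim
      case (elim u)
      have "density_regression ?p (fst u) = density_regression (rescaled pi_inf) (fst u)"
        using elim limit_mass_pos by (intro density_regression_scaled[of "1 / limit_mass"]) auto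
      with elim show ?case by simp
    qed
    then show ?thesis unfolding regression_function_def
      using r(1) borel_measurable_continuous_off_0[OF cont_reg] by blast
  qed
  have regM: "regression_function M X quot (density_regression (rescaled \<pi>))"
    unfolding density_regression_def[abs_def]
  proof (rule regression_function_of_density[where p="rescaled \<pi>" and B=C])
    show "distributed M lborel (\<lambda>w. (X w, quot w)) (\<lambda>u. ennreal (rescaled \<pi> u))"
      using distributed_rescale[OF q D] by (simp add: rescaled_def[abs_def])
  qed (use C sp rescaled_pi_nonneg M in auto)
  have unif: "\<forall>\<^sub>F t in at_top. \<forall>x. lq_norm q x \<ge> t \<longrightarrow> \<bar>density_regression (rescaled \<pi>) x - density_regression (rescaled pi_inf) x\<bar> \<le> e" if e: "e > 0" for e
  proof -
    \<comment> \<open>The first bound keeps the scaled denominator at \<open>\<kappa> / 2\<close> or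
      above; the second keeps the error \<open>4 * C * C * e1\<close> of the cross difference at
      \<open>e * \<kappa> / 2\<close> or below.\<close>
    define e1 where "e1 = min (\<kappa> / (4 * C)) (e * \<kappa> / (8 * C * C))"
    have e1: "e1 > 0" using e \<kappa> C by (simp add: e1_def)
    have e1a: "2 * C * e1 \<le> \<kappa> / 2"
    proof -
      have "e1 \<le> \<kappa> / (4 * C)" by (simp add: e1_def)
      then show ?thesis using C by (simp add: field_simps)
    qed
    have e1b: "8 * C * C * e1 \<le> e * \<kappa>"
    proof -
      have "e1 \<le> e * \<kappa> / (8 * C * C)" by (simp add: e1_def)
      then show ?thesis using C by (simp add: field_simps)
    qed
    from rescaled_uniform[OF e1] obtain t0 where t0: "\<And>t x y. t \<ge> t0 \<Longrightarrow> lq_norm q x \<ge> 1 \<Longrightarrow>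
        \<bar>b t * t ^ CARD('d) * rescaled \<pi> (t *\<^sub>R x, y) - rescaled pi_inf (x, y)\<bar> \<le> e1"
      unfolding eventually_at_top_linorder by blast
    show ?thesis using eventually_ge_at_top[of "max 1 t0"]
    proof eventually_elim
      case (elim t)
      show ?case
      proof (intro allI impI)
        fix x :: "real^'d" assume x: "t \<le> lq_norm q x"
        \<comment> \<open>Each point is rescaled by its own norm, which is at least
          \<open>t\<close>, so the uniform convergence applies at the scale \<open>\<tau>\<close> on
          the unit sphere. The factor \<open>c\<close> below cancels in the quotient.\<close>
        define \<tau> where "\<tau> = lq_norm q x"
        have \<tau>: "\<tau> \<ge> t0" "\<tau> \<ge> 1" using elim x by (auto simp: \<tau>_def)
        have x0: "x \<noteq> 0" using \<tau>(2) lq_norm_0[OF q, where 'a="real^'d"] by (auto simp: \<tau>_def)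
        define dir where "dir = (1 / \<tau>) *\<^sub>R x"
        have dir: "lq_norm q dir = 1" using unit[OF x0] by (simp add: dir_def \<tau>_def)
        have xw: "x = \<tau> *\<^sub>R dir" using \<tau> by (simp add: dir_def)
        define c where "c = b \<tau> * \<tau> ^ CARD('d)"
        have c: "c > 0" using \<tau> rvd_scaling_pos[OF rvd, of \<tau>] by (simp add: c_def)
        have close: "\<bar>c * rescaled \<pi> (x, y) - rescaled pi_inf (dir, y)\<bar> \<le> e1" for y
          using t0[OF \<tau>(1), of dir y] dir by (simp add: c_def xw)
        have "\<bar>(\<integral>y. c * rescaled \<pi> (x, y) \<partial>lborel) - (\<integral>y. rescaled pi_inf (dir, y) \<partial>lborel)\<bar> \<le> 2 * C * e1"
          by (rule integral_diff_compact_support) (use sp si C close in \<open>auto intro!: continuous_intros cp ci\<close>)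
        then have d: "\<bar>c * dt x - di dir\<bar> \<le> 2 * C * e1" by (simp add: dt_def di_def)
        have "\<bar>(\<integral>y. c * (y * rescaled \<pi> (x, y)) \<partial>lborel) - (\<integral>y. y * rescaled pi_inf (dir, y) \<partial>lborel)\<bar> \<le> 2 * C * (C * e1)"
        proof (rule integral_diff_compact_support)
          fix y assume y: "\<bar>y\<bar> \<le> C"
          have "c * (y * rescaled \<pi> (x, y)) - y * rescaled pi_inf (dir, y) = y * (c * rescaled \<pi> (x, y) - rescaled pi_inf (dir, y))"
            by (simp add: algebra_simps)
          also have "\<bar>\<dots>\<bar> \<le> C * e1" unfolding abs_mult using y close C by (intro mult_mono) auto
          finally show "\<bar>c * (y * rescaled \<pi> (x, y)) - y * rescaled pi_inf (dir, y)\<bar> \<le> C * e1" .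
        qed (use sp si C in \<open>auto intro!: continuous_intros cp ci\<close>)
        then have n: "\<bar>c * nt x - ni dir\<bar> \<le> 2 * C * (C * e1)" by (simp add: nt_def ni_def)
        have diw: "di dir \<ge> \<kappa>" by (rule di_sphere[OF dir])
        then have dt: "c * dt x \<ge> \<kappa> / 2" using d e1a unfolding abs_le_iff by linarith
        define f where "f = ni dir / di dir"
        have fC: "\<bar>f\<bar> \<le> C" using ni_di[of dir] diw \<kappa> by (simp add: f_def abs_divide divide_le_eq)
        have nif: "ni dir = f * di dir" using diw \<kappa> by (simp add: f_def)
        \<comment> \<open>The comparison is made after multiplying by the denominator: as
          \<open>ni dir = f * di dir\<close>, the error splits into those of numerator and
          denominator, the latter weighted by \<open>\<bar>f\<bar> \<le> C\<close>.\<close>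
        have "\<bar>c * nt x - f * (c * dt x)\<bar> = \<bar>(c * nt x - ni dir) - f * (c * dt x - di dir)\<bar>"
          by (simp add: nif algebra_simps)
        also have "\<dots> \<le> \<bar>c * nt x - ni dir\<bar> + \<bar>f\<bar> * \<bar>c * dt x - di dir\<bar>"
          by (metis abs_mult abs_triangle_ineq4)
        also have "\<dots> \<le> 2 * C * (C * e1) + C * (2 * C * e1)"
          using n d fC C by (intro add_mono mult_mono) auto
        also have "\<dots> = 8 * C * C * e1 / 2" by simp
        also have "\<dots> \<le> e * \<kappa> / 2" using e1b by simp
        also have "\<dots> \<le> e * (c * dt x)" using dt mult_left_mono[OF dt, of e] e by simp
        finally have "\<bar>c * nt x - f * (c * dt x)\<bar> \<le> e * (c * dt x)" .
        moreover have cdt: "c * dt x > 0" using dt \<kappa> by linarith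
        moreover have "nt x / dt x - f = (c * nt x - f * (c * dt x)) / (c * dt x)"
        proof -
          have "dt x > 0" using cdt c by (simp add: zero_less_mult_iff)
          then show ?thesis using c by (simp add: field_simps)
        qed
        ultimately have "\<bar>nt x / dt x - f\<bar> \<le> e" by (simp add: abs_divide pos_divide_le_eq abs_of_pos)
        moreover have "density_regression (rescaled pi_inf) x = f"
          using angular[OF x0] by (simp add: dir_def \<tau>_def f_def regression_eq)
        ultimately show "\<bar>density_regression (rescaled \<pi>) x - density_regression (rescaled pi_inf) x\<bar> \<le> e" by (simp add: regression_eq)
      qed
    qed
  qed
  have "((\<lambda>t. \<integral>\<^sup>+w. ennreal \<bar>density_regression (rescaled \<pi>) (X w) - density_regression (rescaled pi_inf) (X w)\<bar>
     \<partial>uniform_measure M {w \<in> space M. lq_norm q (X w) \<ge> t}) \<longlongrightarrow> 0) at_top"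
  proof (rule ennreal_tendsto_0I)
    fix e :: real assume e: "e > 0"
    from unif[OF e] order_tendstoD(1)[OF covariate_tail_tendsto limit_mass_pos]
    show "\<forall>\<^sub>F t in at_top. (\<integral>\<^sup>+w. ennreal \<bar>density_regression (rescaled \<pi>) (X w) - density_regression (rescaled pi_inf) (X w)\<bar>
     \<partial>uniform_measure M {w \<in> space M. lq_norm q (X w) \<ge> t}) \<le> ennreal e"
    proof eventually_elim
      case (elim t)
      let ?E = "{w \<in> space M. lq_norm q (X w) \<ge> t}"
      have E: "?E \<in> sets M" using q by measurable
      \<comment> \<open>\<open>covariate_tail\<close> uses the strict inequality; the event
        conditioned on here is larger, so it has positive probability as well.\<close>
      have "covariate_tail t \<noteq> 0" using elim(2) by auto
      moreover have "covariate_tail t \<le> prob ?E" unfolding covariate_tail_def using E by (intro finite_measure_mono) auto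
      moreover have "covariate_tail t \<ge> 0" by (simp add: covariate_tail_def)
      ultimately have "prob ?E > 0" by linarith
      then have "emeasure M ?E \<noteq> 0" by (simp add: emeasure_eq_measure)
      then interpret E: prob_space "uniform_measure M ?E"
        by (intro prob_space_uniform_measure) (auto simp: emeasure_eq_measure)
      have "(\<integral>\<^sup>+w. ennreal \<bar>density_regression (rescaled \<pi>) (X w) - density_regression (rescaled pi_inf) (X w)\<bar> \<partial>uniform_measure M ?E)
        \<le> (\<integral>\<^sup>+w. ennreal e \<partial>uniform_measure M ?E)"
        by (rule nn_integral_mono_AE, rule AE_uniform_measureI[OF E]) (use elim(1) in \<open>auto intro!: ennreal_leI\<close>)
      also have "\<dots> = ennreal e" using E.emeasure_space_1 by simp
      finally show ?case .
    qed
  qed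
  then show ?thesis unfolding cond_C_def
    by (intro exI[of _ "density_regression (rescaled pi_inf)"] exI[of _ "density_regression (rescaled \<pi>)"] conjI regP cont_reg regM allI impI angular)
qed

lemma rescaled_density:
  defines "Y \<equiv> (\<lambda>w. Z w / lq_norm q (X w))"
    and "p \<equiv> (\<lambda>(x, y). lq_norm q x * \<pi> (x, lq_norm q x * y))"
    and "p_inf \<equiv> (\<lambda>(x, y). lq_norm q x * pi_inf (x, lq_norm q x * y))"
  shows "\<exists>P. cond_RV q M X Y P \<and>
              continuous_on {(x, y). x \<noteq> 0} p \<and>
              distributed M lborel (\<lambda>w. (X w, Y w)) (\<lambda>u. ennreal (p u)) \<and>
              (\<exists>x y. x \<noteq> 0 \<and> p_inf (x, y) \<noteq> 0) \<and>
              ((\<lambda>t. SUP (x, y)\<in>{(x, y). lq_norm q x \<ge> 1}.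
                       ennreal \<bar>b t * t ^ CARD('d) * p (t *\<^sub>R x, y) - p_inf (x, y)\<bar>) \<longlongrightarrow> 0) at_top \<and>
              ((INF w\<in>{w. lq_norm q w = 1}. \<integral>y. pi_inf (w, y) \<partial>lborel) > 0 \<longrightarrow>
                 cond_C q M X Y P)"
proof (intro exI[of _ limit_law] conjI impI)
  have p: "p = rescaled \<pi>" "p_inf = rescaled pi_inf" by (auto simp: p_def p_inf_def rescaled_def)
  show "cond_RV q M X Y limit_law" unfolding Y_def by (rule limit_law_cond_RV)
  show "continuous_on {(x, y). x \<noteq> 0} p"
    using continuous_on_rescaled[OF cont] by (simp add: p case_prod_beta')
  show "distributed M lborel (\<lambda>w. (X w, Y w)) (\<lambda>u. ennreal (p u))"
    using distributed_rescale[OF q D] by (simp add: p Y_def rescaled_def[abs_def])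
  obtain x z where xz: "x \<noteq> 0" "pi_inf (x, z) \<noteq> 0" using limit_density_nonzero by blast
  then have "lq_norm q x > 0" using lq_norm_pos[OF _ q] by auto
  then have "p_inf (x, z / lq_norm q x) \<noteq> 0" using xz by (simp add: p_inf_def)
  with xz show "\<exists>x y. x \<noteq> 0 \<and> p_inf (x, y) \<noteq> 0" by blast
  show "((\<lambda>t. SUP (x, y)\<in>{(x, y). lq_norm q x \<ge> 1}. ennreal \<bar>b t * t ^ CARD('d) * p (t *\<^sub>R x, y) - p_inf (x, y)\<bar>) \<longlongrightarrow> 0) at_top"
  proof (rule ennreal_tendsto_0I)
    fix e :: real assume "e > 0"
    from rescaled_uniform[OF this]
    show "\<forall>\<^sub>F t in at_top. (SUP (x, y)\<in>{(x, y). lq_norm q x \<ge> 1}. ennreal \<bar>b t * t ^ CARD('d) * p (t *\<^sub>R x, y) - p_inf (x, y)\<bar>) \<le> ennreal e"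
      by eventually_elim (auto simp: p intro!: SUP_least ennreal_leI)
  qed
  show "cond_C q M X Y limit_law" if "(INF w\<in>{w. lq_norm q w = 1}. \<integral>y. pi_inf (w, y) \<partial>lborel) > 0"
    unfolding Y_def using that by (rule cond_C_of_lower_bound)
qed

end

theorem proposition4p1:
  fixes q :: ereal and M :: "'w measure" and X :: "'w \<Rightarrow> real^'d"
  assumes "1 \<le> q" and "prob_space M" and "X \<in> borel_measurable M"
  shows
    "(\<forall>(Z :: 'w \<Rightarrow> real) L.
        Z \<in> borel_measurable M \<longrightarrow>
        regularly_varying_vec M (\<lambda>\<omega>. (X \<omega>, Z \<omega>)) \<longrightarrow>
        limit_distribution q M (\<lambda>\<omega>. (X \<omega>, Z \<omega>)) L \<longrightarrow>
        measure L {(x, z). lq_norm q x > 1} > 0 \<longrightarrow>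
        (\<exists>P. cond_RV q M X (\<lambda>\<omega>. Z \<omega> / lq_norm q (X \<omega>)) P \<and>
             (\<forall>A\<in>sets borel. A \<subseteq> {(x, y). lq_norm q x > 1} \<longrightarrow>
                measure P A = measure L (phi q -` A) / measure L {(x, z). lq_norm q x > 1})))
     \<and>
     (\<forall>(Y :: 'w \<Rightarrow> real) P.
        Y \<in> borel_measurable M \<longrightarrow> cond_B M Y \<longrightarrow> cond_RV q M X Y P \<longrightarrow>
        (\<exists>\<alpha> b \<nu> L.
           regularly_varying_with M (\<lambda>\<omega>. (X \<omega>, lq_norm q (X \<omega>) * Y \<omega>)) \<alpha> b \<nu> \<and>
           (\<forall>A\<in>sets borel. A \<subseteq> {(x, z). lq_norm q x > 1} \<longrightarrow>
              measure \<nu> A = measure P (phi q ` A)) \<and>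
           (\<forall>s>0. \<forall>A\<in>sets borel. A \<subseteq> {(x, z). lq_norm q x > 1 / s} \<longrightarrow>
              measure \<nu> A = s powr \<alpha> * measure P (phi q ` ((\<lambda>u. s *\<^sub>R u) ` A))) \<and>
           emeasure \<nu> {(x, z). x = 0 \<and> z \<noteq> 0} = 0 \<and>
           limit_distribution q M (\<lambda>\<omega>. (X \<omega>, lq_norm q (X \<omega>) * Y \<omega>)) L \<and>
           (\<forall>A\<in>sets borel. A \<subseteq> {u. lq_norm q u > 1} \<longrightarrow>
              measure L A = measure \<nu> A / measure \<nu> {u. lq_norm q u > 1}) \<and>
           measure L {(x, z). lq_norm q x > 1} > 0 \<and>
           (\<forall>A\<in>sets borel. A \<subseteq> {(x, z). lq_norm q x > 1} \<longrightarrow>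
              measure L A / measure L {(x, z). lq_norm q x > 1} = measure P (phi q ` A))))
     \<and>
     (\<forall>(Z :: 'w \<Rightarrow> real) \<pi> pi_inf b \<alpha>.
        Z \<in> borel_measurable M \<longrightarrow>
        continuous_on (- {0}) \<pi> \<longrightarrow> (\<forall>u. u \<noteq> 0 \<longrightarrow> \<pi> u \<ge> 0) \<longrightarrow>
        distributed M lborel (\<lambda>\<omega>. (X \<omega>, Z \<omega>)) (\<lambda>u. ennreal (\<pi> u)) \<longrightarrow>
        regularly_varying_density q \<alpha> b \<pi> pi_inf \<longrightarrow>
        cond_B M (\<lambda>\<omega>. Z \<omega> / lq_norm q (X \<omega>)) \<longrightarrow>
        (let Y = (\<lambda>\<omega>. Z \<omega> / lq_norm q (X \<omega>));
             p = (\<lambda>(x, y). lq_norm q x * \<pi> (x, lq_norm q x * y));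
             p_inf = (\<lambda>(x, y). lq_norm q x * pi_inf (x, lq_norm q x * y))
         in \<exists>P. cond_RV q M X Y P \<and>
              continuous_on {(x, y). x \<noteq> 0} p \<and>
              distributed M lborel (\<lambda>\<omega>. (X \<omega>, Y \<omega>)) (\<lambda>u. ennreal (p u)) \<and>
              (\<exists>x y. x \<noteq> 0 \<and> p_inf (x, y) \<noteq> 0) \<and>
              ((\<lambda>t. SUP (x, y)\<in>{(x, y). lq_norm q x \<ge> 1}.
                       ennreal \<bar>b t * t ^ CARD('d) * p (t *\<^sub>R x, y) - p_inf (x, y)\<bar>) \<longlongrightarrow> 0) at_top \<and>
              ((INF \<omega>\<in>{\<omega>. lq_norm q \<omega> = 1}. \<integral>y. pi_inf (\<omega>, y) \<partial>lborel) > 0 \<longrightarrow>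
                 cond_C q M X Y P)))"
proof (intro conjI allI impI, goal_cases)
  case (1 Z L)
  then show ?case by (rule rescaled_pair_cond_RV[OF assms])
next
  case (2 Y P)
  then show ?case by (rule regularly_varying_of_cond_RV[OF assms])
next
  case (3 Z \<pi> pi_inf b \<alpha>)
  then obtain C where C: "C > 0" and "AE \<omega> in M. Z \<omega> / lq_norm q (X \<omega>) \<in> {-C..C}"
    by (auto simp: cond_B_def)
  from this(2) have "AE \<omega> in M. \<bar>Z \<omega> / lq_norm q (X \<omega>)\<bar> \<le> C" by eventually_elim (auto simp: abs_le_iff)
  with 3 C show ?case
    unfolding Let_def by (intro rescaled_density[OF assms(1,2)]) auto
qed

end
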